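(* Let $s\ge1$ be an integer and let $\kappa_0,\kappa_1\in\mathbb{C}$ be such that none of $-\kappa_0+\frac12$, $-\kappa_1+\frac12$, $-s(\kappa_0+\kappa_1)$ is a positive integer. Suppose $a\ge b\ge 0$ are integers with $a\equiv b\pmod s$, and write $a=us+r$, $b=vs+r$ with $0\le r<s$ and $v\ge 0$. If $a>b$ then $$\begin{aligned}V(z^a\overline z^b)=a!\,b!\sum_{k=0}^{v}&\frac{\nu_{u+v-2k}^{-1}}{(ks+r)!\,(s\kappa_0+s\kappa_1+1)_{b+(u-k)s}}(z\overline z)^{ks+r}\Big\{c(f_{u+v-2k-1};u-k-1,v-k)\,f_{u+v-2k}(z^s)\\&+c(f_{u+v-2k-1};v-k-1,u-k)\,f_{u+v-2k}(\overline z^s)\Big\},\end{aligned}$$ $$V\left(\tfrac12(z^a\overline z^b-z^b\overline z^a)\right)=a!\,b!\sum_{k=0}^{v}\frac{\lambda^1_{u+v-2k}\;c(f^1_{u+v-2k};u-k,v-k)}{(ks+r)!\,(s\kappa_0+s\kappa_1+1)_{b+(u-k)s}}(z\overline z)^{ks+r}f^1_{u+v-2k}(z^s).$$ If $a\ge b$ then $$V\left(\tfrac12(z^a\overline z^b+z^b\overline z^a)\right)=a!\,b!\sum_{k=0}^{v}\frac{\lambda^0_{u+v-2k}\;c(f^0_{u+v-2k};u-k,v-k)}{(ks+r)!\,(s\kappa_0+s\kappa_1+1)_{b+(u-k)s}}(z\overline z)^{ks+r}f^0_{u+v-2k}(z^s).$$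
   Context: Notation: $(x)_n=x(x+1)\cdots(x+n-1)$, $(x)_0=1$. Polynomials are in $z=x_1+\mathrm{i}x_2$, $\overline z=x_1-\mathrm{i}x_2$; $f(z)$ abbreviates $f(z,\overline z)$; $f(z^s)$ means $f$ with $(z,\overline z)$ replaced by $(z^s,\overline z^s)$, $f(\overline z^s)$ means $f$ with $(z,\overline z)$ replaced by $(\overline z^s,z^s)$, and for a unimodular number $\eta$, $f(\overline z\eta)$ means $f(\overline z\eta,z\eta^{-1})$. For a polynomial $f$, $c(f;a,b)$ is the coefficient of $z^a\overline z^b$ in $f$ (zero if $a<0$ or $b<0$). Operators (dihedral group $I_2(2s)$): with $\omega=e^{\mathrm{i}\pi/s}$, for polynomials $f$, $$Tf(z)=\frac{\partial f}{\partial z}+\kappa_0\sum_{j=0}^{s-1}\frac{f(z)-f(\overline z\omega^{2j})}{z-\overline z\omega^{2j}}+\kappa_1\sum_{j=0}^{s-1}\frac{f(z)-f(\overline z\omega^{2j+1})}{z-\overline z\omega^{2j+1}},$$ $$\overline Tf(z)=\frac{\partial f}{\partial\overline z}-\kappa_0\sum_{j=0}^{s-1}\frac{f(z)-f(\overline z\omega^{2j})}{z-\overline z\omega^{2j}}\omega^{2j}-\kappa_1\sum_{j=0}^{s-1}\frac{f(z)-f(\overline z\omega^{2j+1})}{z-\overline z\omega^{2j+1}}\omega^{2j+1}.$$ The intertwining operator $V$ is the unique linear map on polynomials in $z,\overline z$ that maps homogeneous polynomials to homogeneous polynomials of the same degree and satisfies $TVf=V\frac{\partial f}{\partial z}$,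 $\overline TVf=V\frac{\partial f}{\partial\overline z}$, $V1=1$. Polynomials $f_n^0,f_n^1,f_n$: let $P_n^{(\alpha,\beta)}(x)=\frac1{n!}\sum_{l=0}^n\frac{(-n)_l(n+\alpha+\beta+1)_l(\alpha+1+l)_{n-l}}{l!}\left(\frac{1-x}{2}\right)^l$ be the Jacobi polynomials, $P_{-1}^{(\alpha,\beta)}=0$, and put $x=\frac{z^2+\overline z^2}{2z\overline z}$ (so $x=\cos 2\theta$ if $z=re^{\mathrm{i}\theta}$). For $n\ge0$, $$f_{2n}^0=(z\overline z)^nP_n^{(\kappa_0-\frac12,\kappa_1-\frac12)}(x),\qquad f_{2n}^1=\tfrac14(z^2-\overline z^2)(z\overline z)^{n-1}P_{n-1}^{(\kappa_0+\frac12,\kappa_1+\frac12)}(x),$$ $$f_{2n+1}^0=\left(n+\kappa_0+\tfrac12\right)\tfrac{z+\overline z}{2}(z\overline z)^nP_n^{(\kappa_0-\frac12,\kappa_1+\frac12)}(x),\qquad f_{2n+1}^1=\left(n+\kappa_1+\tfrac12\right)\tfrac{z-\overline z}{2}(z\overline z)^nP_n^{(\kappa_0+\frac12,\kappa_1-\frac12)}(x),$$ and $f_n=f_n^0+f_n^1$. These are polynomials in $z,\overline z$, homogeneous of degree equal to the subscript. Structural constants: $\lambda_0^0=1$; for $n\ge1$, $$\lambda_{2n}^0=\frac{n!\,(\kappa_0+\kappa_1+1)_n(\kappa_0+\kappa_1+2n)}{(\kappa_0+\frac12)_n(\kappa_1+\frac12)_n(\kappa_0+\kappa_1+n)},\qquad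 \lambda_{2n}^1=\frac{(n-1)!\,(\kappa_0+\kappa_1+1)_n(\kappa_0+\kappa_1+2n)}{(\kappa_0+\frac12)_n(\kappa_1+\frac12)_n},$$ $$\nu_{2n}=\frac{2(\kappa_0+\frac12)_n(\kappa_1+\frac12)_n}{(n-1)!\,(\kappa_0+\kappa_1+1)_{n-1}(\kappa_0+\kappa_1+2n)};$$ for $n\ge0$, $$\lambda_{2n+1}^0=\frac{n!\,(\kappa_0+\kappa_1+1)_n(\kappa_0+\kappa_1+2n+1)}{(n+\kappa_0+\frac12)(\kappa_0+\frac12)_{n+1}(\kappa_1+\frac12)_{n+1}},\qquad \lambda_{2n+1}^1=\frac{n!\,(\kappa_0+\kappa_1+1)_n(\kappa_0+\kappa_1+2n+1)}{(n+\kappa_1+\frac12)(\kappa_0+\frac12)_{n+1}(\kappa_1+\frac12)_{n+1}},$$ $$\nu_{2n+1}=\frac{2(\kappa_0+\frac12)_{n+1}(\kappa_1+\frac12)_{n+1}}{n!\,(\kappa_0+\kappa_1+1)_n(\kappa_0+\kappa_1+2n+1)}.$$ *)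

theory Defs
  imports Complex_Main "HOL-Computational_Algebra.Polynomial" "HOL-Number_Theory.Cong"
begin

section \<open>Polynomials in \<open>z\<close> and its conjugate\<close>

text \<open>
  Polynomials in \<open>z = x\<^sub>1 + i x\<^sub>2\<close> and \<open>zbar = x\<^sub>1 - i x\<^sub>2\<close> are formal polynomials in two
  independent variables: the outer variable is \<open>z\<close>, the inner one is \<open>zbar\<close>, so that the
  coefficient of \<open>z\<^sup>a zbar\<^sup>b\<close> in \<open>f\<close> is \<open>coeff (coeff f a) b\<close>.
\<close>

type_synonym bipoly = "complex poly poly"

definition Z :: bipoly where "Z = [:0, 1:]"

definition Zb :: bipoly where "Zb = [:[:0, 1:]:]"

definition scal :: "complex \<Rightarrow> bipoly \<Rightarrow> bipoly" where
  "scal c f = smult [:c:] f"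

definition cf :: "bipoly \<Rightarrow> int \<Rightarrow> int \<Rightarrow> complex" where
  "cf f a b = (if a < 0 \<or> b < 0 then 0 else coeff (coeff f (nat a)) (nat b))"

text \<open>\<open>subst2 f p q\<close> is \<open>f(p, q)\<close>, i.e. \<open>f\<close> with \<open>(z, zbar)\<close> replaced by \<open>(p, q)\<close>.\<close>

definition subst2 :: "bipoly \<Rightarrow> bipoly \<Rightarrow> bipoly \<Rightarrow> bipoly" where
  "subst2 f p q = poly (map_poly (\<lambda>g. poly (map_poly (\<lambda>x. [:[:x:]:]) g) q) f) p"

definition homogeneous :: "nat \<Rightarrow> bipoly \<Rightarrow> bool" where
  "homogeneous d f \<longleftrightarrow> (\<forall>a b. coeff (coeff f a) b \<noteq> 0 \<longrightarrow> a + b = d)"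


section \<open>Dunkl operators and the intertwining operator of \<open>I\<^sub>2(2s)\<close>\<close>

definition omega :: "nat \<Rightarrow> complex" where
  "omega s = exp (\<i> * of_real pi / of_nat s)"

definition reflect :: "complex \<Rightarrow> bipoly \<Rightarrow> bipoly" where
  "reflect \<eta> f = subst2 f (scal \<eta> Zb) (scal (inverse \<eta>) Z)"

text \<open>The division is exact for \<open>\<eta> \<noteq> 0\<close>, see \<open>reflect_dvd\<close> below.\<close>

definition divdiff :: "complex \<Rightarrow> bipoly \<Rightarrow> bipoly" where
  "divdiff \<eta> f = (f - reflect \<eta> f) div (Z - scal \<eta> Zb)"

definition dunkl_T :: "nat \<Rightarrow> complex \<Rightarrow> complex \<Rightarrow> bipoly \<Rightarrow> bipoly" where
  "dunkl_T s \<kappa>0 \<kappa>1 f = pderiv f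
     + scal \<kappa>0 (\<Sum>j<s. divdiff (omega s ^ (2 * j)) f)
     + scal \<kappa>1 (\<Sum>j<s. divdiff (omega s ^ (2 * j + 1)) f)"

definition dunkl_Tbar :: "nat \<Rightarrow> complex \<Rightarrow> complex \<Rightarrow> bipoly \<Rightarrow> bipoly" where
  "dunkl_Tbar s \<kappa>0 \<kappa>1 f = map_poly pderiv f
     - scal \<kappa>0 (\<Sum>j<s. scal (omega s ^ (2 * j)) (divdiff (omega s ^ (2 * j)) f))
     - scal \<kappa>1 (\<Sum>j<s. scal (omega s ^ (2 * j + 1)) (divdiff (omega s ^ (2 * j + 1)) f))"

text \<open>For the parameters considered (the nonsingular ones) there is exactly one such map.\<close>

definition intertwining :: "nat \<Rightarrow> complex \<Rightarrow> complex \<Rightarrow> (bipoly \<Rightarrow> bipoly) \<Rightarrow> bool" where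
  "intertwining s \<kappa>0 \<kappa>1 V \<longleftrightarrow>
     Vector_Spaces.linear scal scal V \<and>
     (\<forall>d f. homogeneous d f \<longrightarrow> homogeneous d (V f)) \<and>
     (\<forall>f. dunkl_T s \<kappa>0 \<kappa>1 (V f) = V (pderiv f)) \<and>
     (\<forall>f. dunkl_Tbar s \<kappa>0 \<kappa>1 (V f) = V (map_poly pderiv f)) \<and>
     V 1 = 1"


section \<open>The polynomials \<open>f\<^sub>n\<close>\<close>

definition jacobi :: "nat \<Rightarrow> complex \<Rightarrow> complex \<Rightarrow> complex poly" where
  "jacobi n \<alpha> \<beta> = smult (1 / fact n) (\<Sum>l\<le>n.
     smult (pochhammer (- of_nat n) l * pochhammer (of_nat n + \<alpha> + \<beta> + 1) l
            * pochhammer (\<alpha> + 1 + of_nat l) (n - l) / fact l)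
       ([:1/2, -1/2:] ^ l))"

text \<open>
  For \<open>degree p \<le> n\<close>, \<open>homogenize n p\<close> is the polynomial \<open>(z zbar)\<^sup>n p(x)\<close> with
  \<open>x = (z\<^sup>2 + zbar\<^sup>2) / (2 z zbar)\<close>, see \<open>poly_homogenize\<close> below.
\<close>

definition homogenize :: "nat \<Rightarrow> complex poly \<Rightarrow> bipoly" where
  "homogenize n p =
     (\<Sum>i\<le>n. scal (coeff p i) (scal (1/2) (Z^2 + Zb^2) ^ i * (Z * Zb) ^ (n - i)))"

definition f0 :: "complex \<Rightarrow> complex \<Rightarrow> nat \<Rightarrow> bipoly" where
  "f0 \<kappa>0 \<kappa>1 m = (let n = m div 2 in
     if even m then homogenize n (jacobi n (\<kappa>0 - 1/2) (\<kappa>1 - 1/2))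
     else scal (of_nat n + \<kappa>0 + 1/2)
            (scal (1/2) (Z + Zb) * homogenize n (jacobi n (\<kappa>0 - 1/2) (\<kappa>1 + 1/2))))"

text \<open>The case \<open>m = 0\<close> reflects the convention that the Jacobi polynomial of index \<open>-1\<close> is \<open>0\<close>.\<close>

definition f1 :: "complex \<Rightarrow> complex \<Rightarrow> nat \<Rightarrow> bipoly" where
  "f1 \<kappa>0 \<kappa>1 m = (let n = m div 2 in
     if m = 0 then 0
     else if even m then
       scal (1/4) (Z^2 - Zb^2) * homogenize (n - 1) (jacobi (n - 1) (\<kappa>0 + 1/2) (\<kappa>1 + 1/2))
     else scal (of_nat n + \<kappa>1 + 1/2)
            (scal (1/2) (Z - Zb) * homogenize n (jacobi n (\<kappa>0 + 1/2) (\<kappa>1 - 1/2))))"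

definition ff :: "complex \<Rightarrow> complex \<Rightarrow> nat \<Rightarrow> bipoly" where
  "ff \<kappa>0 \<kappa>1 m = f0 \<kappa>0 \<kappa>1 m + f1 \<kappa>0 \<kappa>1 m"


section \<open>Structural constants\<close>

text \<open>The values \<open>lam1 \<kappa>0 \<kappa>1 0\<close> and \<open>nu \<kappa>0 \<kappa>1 0\<close> are irrelevant.\<close>

definition lam0 :: "complex \<Rightarrow> complex \<Rightarrow> nat \<Rightarrow> complex" where
  "lam0 \<kappa>0 \<kappa>1 m = (let n = m div 2 in
     if m = 0 then 1
     else if even m then
       fact n * pochhammer (\<kappa>0 + \<kappa>1 + 1) n * (\<kappa>0 + \<kappa>1 + 2 * of_nat n)
       / (pochhammer (\<kappa>0 + 1/2) n * pochhammer (\<kappa>1 + 1/2) n * (\<kappa>0 + \<kappa>1 + of_nat n))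
     else
       fact n * pochhammer (\<kappa>0 + \<kappa>1 + 1) n * (\<kappa>0 + \<kappa>1 + 2 * of_nat n + 1)
       / ((of_nat n + \<kappa>0 + 1/2) * pochhammer (\<kappa>0 + 1/2) (n + 1) * pochhammer (\<kappa>1 + 1/2) (n + 1)))"

definition lam1 :: "complex \<Rightarrow> complex \<Rightarrow> nat \<Rightarrow> complex" where
  "lam1 \<kappa>0 \<kappa>1 m = (let n = m div 2 in
     if even m then
       fact (n - 1) * pochhammer (\<kappa>0 + \<kappa>1 + 1) n * (\<kappa>0 + \<kappa>1 + 2 * of_nat n)
       / (pochhammer (\<kappa>0 + 1/2) n * pochhammer (\<kappa>1 + 1/2) n)
     else
       fact n * pochhammer (\<kappa>0 + \<kappa>1 + 1) n * (\<kappa>0 + \<kappa>1 + 2 * of_nat n + 1)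
       / ((of_nat n + \<kappa>1 + 1/2) * pochhammer (\<kappa>0 + 1/2) (n + 1) * pochhammer (\<kappa>1 + 1/2) (n + 1)))"

definition nu :: "complex \<Rightarrow> complex \<Rightarrow> nat \<Rightarrow> complex" where
  "nu \<kappa>0 \<kappa>1 m = (let n = m div 2 in
     if even m then
       2 * pochhammer (\<kappa>0 + 1/2) n * pochhammer (\<kappa>1 + 1/2) n
       / (fact (n - 1) * pochhammer (\<kappa>0 + \<kappa>1 + 1) (n - 1) * (\<kappa>0 + \<kappa>1 + 2 * of_nat n))
     else
       2 * pochhammer (\<kappa>0 + 1/2) (n + 1) * pochhammer (\<kappa>1 + 1/2) (n + 1)
       / (fact n * pochhammer (\<kappa>0 + \<kappa>1 + 1) n * (\<kappa>0 + \<kappa>1 + 2 * of_nat n + 1)))"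


section \<open>Well-definedness of the encodings\<close>

lemma vector_space_scal: "vector_space scal"
proof
  show "scal a (x + y) = scal a x + scal a y" for a x y
    by (simp add: scal_def smult_add_right)
  show "scal (a + b) x = scal a x + scal b x" for a b x
    unfolding scal_def by (metis add_pCons add_0 smult_add_left)
  show "scal a (scal b x) = scal (a * b) x" for a b x
    by (simp add: scal_def mult.commute)
  show "scal 1 x = x" for x
    by (simp add: scal_def flip: one_pCons)
qed

lemma scal_eq_mult: "scal c f = [:[:c:]:] * f"
  by (simp add: scal_def)

lemma subst2_0 [simp]: "subst2 0 p q = 0"
  by (simp add: subst2_def)

lemma subst2_pCons: "subst2 (pCons g f) p q = poly (map_poly (\<lambda>x. [:[:x:]:]) g) q + p * subst2 f p q"
  by (simp add: subst2_def map_poly_pCons)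

lemma inner_dvd:
  assumes "\<eta> \<noteq> 0"
  shows "(Z - scal \<eta> Zb) dvd ([:g:] - poly (map_poly (\<lambda>x. [:[:x:]:]) g) (scal (inverse \<eta>) Z))"
proof (induction g)
  case 0
  then show ?case by simp
next
  case (pCons x g)
  let ?h = "poly (map_poly (\<lambda>x. [:[:x:]:]) g) (scal (inverse \<eta>) Z)"
  have *: "[:pCons x g:] - poly (map_poly (\<lambda>x. [:[:x:]:]) (pCons x g)) (scal (inverse \<eta>) Z)
     = Zb * ([:g:] - ?h) + (Zb - scal (inverse \<eta>) Z) * ?h"
    by (simp add: map_poly_pCons algebra_simps) (simp add: Zb_def)
  have "Zb - scal (inverse \<eta>) Z = (Z - scal \<eta> Zb) * [:[:- inverse \<eta>:]:]"
    using assms by (simp add: Z_def Zb_def scal_def)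
  then have "(Z - scal \<eta> Zb) dvd (Zb - scal (inverse \<eta>) Z)"
    by (metis dvd_triv_left)
  then show ?case
    unfolding * using pCons.IH by (intro dvd_add dvd_mult dvd_mult2)
qed

lemma reflect_dvd:
  assumes "\<eta> \<noteq> 0"
  shows "(Z - scal \<eta> Zb) dvd (f - reflect \<eta> f)"
  unfolding reflect_def
proof (induction f)
  case 0
  then show ?case by simp
next
  case (pCons g f)
  let ?g = "poly (map_poly (\<lambda>x. [:[:x:]:]) g) (scal (inverse \<eta>) Z)"
  let ?f = "subst2 f (scal \<eta> Zb) (scal (inverse \<eta>) Z)"
  have "pCons g f = [:g:] + Z * f"
    by (simp add: Z_def)
  moreover have "subst2 (pCons g f) (scal \<eta> Zb) (scal (inverse \<eta>) Z) = ?g + scal \<eta> Zb * ?f"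
    by (simp add: subst2_pCons)
  ultimately have "pCons g f - subst2 (pCons g f) (scal \<eta> Zb) (scal (inverse \<eta>) Z)
    = ([:g:] - ?g) + (Z * (f - ?f) + (Z - scal \<eta> Zb) * ?f)"
    by (simp only:) (simp add: algebra_simps)
  then show ?case
    using inner_dvd[OF assms, of g] pCons.IH by (auto intro!: dvd_add)
qed

lemma divdiff_exact:
  "\<eta> \<noteq> 0 \<Longrightarrow> (Z - scal \<eta> Zb) * divdiff \<eta> f = f - reflect \<eta> f"
  unfolding divdiff_def using reflect_dvd by (rule dvd_mult_div_cancel)

lemma degree_jacobi: "degree (jacobi n \<alpha> \<beta>) \<le> n"
proof -
  have "degree ([:1/2, -1/2 :: complex:] ^ l) \<le> n" if "l \<le> n" for l
    using degree_power_le[of "[:1/2, -1/2 :: complex:]" l] that by simp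
  then show ?thesis
    unfolding jacobi_def
    by (intro order.trans[OF degree_smult_le] degree_sum_le) (auto intro: order.trans[OF degree_smult_le])
qed

lemma poly_homogenize:
  fixes z w :: complex
  assumes "degree p \<le> n" and "z \<noteq> 0" and "w \<noteq> 0"
  shows "poly (poly (homogenize n p) [:z:]) w
           = (z * w) ^ n * poly p ((z^2 + w^2) / (2 * z * w))"
proof -
  have *: "(z * w) ^ n * ((z^2 + w^2) / (2 * z * w)) ^ i = ((z^2 + w^2) / 2) ^ i * (z * w) ^ (n - i)"
    if "i \<le> n" for i
  proof -
    have "(z * w) ^ n = (z * w) ^ i * (z * w) ^ (n - i)"
      using that by (simp flip: power_add)
    moreover have "(z * w) ^ i * ((z^2 + w^2) / (2 * z * w)) ^ i = ((z^2 + w^2) / 2) ^ i"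
      using assms(2,3) by (simp flip: power_mult_distrib)
    ultimately show ?thesis by (simp add: mult_ac)
  qed
  have "poly p x = (\<Sum>i\<le>n. coeff p i * x ^ i)" for x
    unfolding poly_altdef using assms(1)
    by (intro sum.mono_neutral_left) (auto simp: not_le intro: coeff_eq_0)
  then show ?thesis
    unfolding homogenize_def
    by (simp add: poly_sum scal_def Z_def Zb_def sum_distrib_left mult.left_commute[of "(z*w)^n"] *
        mult.commute[of w z])
qed

end

theory Submission imports Defs begin

text \<open>
  Write \<open>F\<^sub>m = f\<^sub>m(z\<^sup>s, zbar\<^sup>s)\<close>, let \<open>G\<^sub>m\<close> be \<open>F\<^sub>m\<close> with \<open>z\<close> and \<open>zbar\<close> swapped and \<open>\<rho> = z zbar\<close>.
  Contiguous relations of Jacobi polynomials give a two-term recursion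
  \<open>f\<^sub>m\<^sub>+\<^sub>1 = a\<^sub>m z f\<^sub>m + b\<^sub>m zbar swap(f\<^sub>m)\<close> of the kind satisfied by orthogonal polynomials on the unit
  circle. It implies by induction that \<open>T G\<^sub>m = 0\<close> and that \<open>T F\<^sub>m\<close> is a multiple of
  \<open>z\<^sup>s\<^sup>-\<^sup>1 F\<^sub>m\<^sub>-\<^sub>1\<close>, hence explicit formulas for \<open>T\<^sup>s\<close> and for \<open>T Tbar\<close> on \<open>\<rho>\<^sup>j F\<^sub>m\<close> and
  \<open>\<rho>\<^sup>j G\<^sub>m\<close>. For \<open>r = 0\<close> the claimed value \<open>w(u,v)\<close> of \<open>V\<close> at the divided monomial
  \<open>z\<^sup>u\<^sup>s zbar\<^sup>v\<^sup>s / ((us)! (vs)!)\<close> therefore satisfies \<open>T\<^sup>s w(u+1,v) = w(u,v)\<close> and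
  \<open>Tbar\<^sup>s w(u,v+1) = w(u,v)\<close>; once more this uses the two-term recursion, now for the coefficients
  of \<open>f\<^sub>m\<close>. Since \<open>V\<close> is bijective on homogeneous polynomials of given degree and turns \<open>T\<close>, \<open>Tbar\<close> into
  partial derivatives, these relations determine the values of \<open>V\<close> by induction on \<open>u + v\<close>. The
  case \<open>r > 0\<close> follows by applying \<open>(T Tbar)\<^sup>s\<^sup>-\<^sup>r\<close> to the value at \<open>(u+1, v+1)\<close>.
\<close>

section \<open>The algebra of bivariate polynomials\<close>

text \<open>\<open>T\<close> is not a derivation, but on a homogeneous polynomial in
  \<open>Z ^ s\<close> and \<open>Zb ^ s\<close> all reflections of one class act as the swap with a
  common sign. The reflection sums in \<open>T (Z ^ i * g)\<close> then reduce to power sums of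
  roots of unity, and for \<open>i \<le> s\<close> only one term of them survives; hence the
  restriction to such factors throughout. The quotient \<open>sb m / sa m\<close> of the two
  recursion coefficients, in the role of a Verblunsky coefficient, is
  \<open>eps (Suc m) / (m + 1 + \<kappa>0 + \<kappa>1)\<close>. This is exactly the value for which
  \<open>T\<close> annihilates the next \<open>G\<close>. The kernel of a power of \<open>T\<close>
  is hard to describe directly. Pulled back through \<open>V\<close> it becomes the kernel of a
  power of an ordinary derivative and can be read off the coefficients; this is what bijectivity in
  each degree is for. Since \<open>T\<close> and \<open>Tb\<close> only lower exponents, the case
  \<open>r > 0\<close> has to descend from \<open>(u+1, v+1)\<close> and cannot climb from
  \<open>(u, v)\<close>.\<close>

definition bconst :: "complex \<Rightarrow> bipoly" where "bconst c = [:[:c:]:]"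

definition swap :: "bipoly \<Rightarrow> bipoly" where "swap f = subst2 f Zb Z"

abbreviation pderivb :: "bipoly \<Rightarrow> bipoly" where "pderivb \<equiv> map_poly pderiv"

lemma scal_bconst: "scal c f = bconst c * f"
  by (simp add: scal_def bconst_def)

lemma bconst_0 [simp]: "bconst 0 = 0" and bconst_1 [simp]: "bconst 1 = 1"
  by (simp_all add: bconst_def one_pCons)

lemma bconst_add: "bconst (a + b) = bconst a + bconst b"
  and bconst_diff: "bconst (a - b) = bconst a - bconst b"
  and bconst_minus: "bconst (- a) = - bconst a"
  and bconst_mult: "bconst (a * b) = bconst a * bconst b"
  by (simp_all add: bconst_def mult.commute)

lemma bconst_power: "bconst (a ^ n) = bconst a ^ n"
  by (induction n) (auto simp: bconst_mult)

lemma bconst_of_nat: "bconst (of_nat n) = of_nat n"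
  by (induction n) (auto simp: bconst_add)

lemma bconst_numeral: "bconst (numeral n) = numeral n"
  using bconst_of_nat[of "numeral n"] by simp

lemma bconst_sum: "bconst (\<Sum>i\<in>A. f i) = (\<Sum>i\<in>A. bconst (f i))"
  by (induction A rule: infinite_finite_induct) (auto simp: bconst_add)

lemmas bconst_hom = bconst_add bconst_diff bconst_minus bconst_mult bconst_power bconst_of_nat
  bconst_numeral

lemma bconst_eq_0_iff [simp]: "bconst c = 0 \<longleftrightarrow> c = 0"
  by (simp add: bconst_def)

lemma Z_neq_0 [simp]: "Z \<noteq> 0" and Zb_neq_0 [simp]: "Zb \<noteq> 0"
  by (simp_all add: Z_def Zb_def)

lemma Z_minus_scal_neq_0: "Z - scal \<eta> Zb \<noteq> 0"
  by (simp add: Z_def Zb_def scal_def)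

text \<open>The two variables and the constants generate the algebra, so an identity between ring
  homomorphisms or derivations need only be checked on them.\<close>

lemma bipoly_induct [case_names const Z Zb add mult]:
  assumes const: "\<And>c. P (bconst c)" and Z: "P Z" and Zb: "P Zb"
    and add: "\<And>f g. P f \<Longrightarrow> P g \<Longrightarrow> P (f + g)"
    and mult: "\<And>f g. P f \<Longrightarrow> P g \<Longrightarrow> P (f * g)"
  shows "P f"
proof (induction f)
  case 0
  show ?case using const[of 0] by simp
next
  case (pCons g f)
  have "P [:g:]"
  proof (induction g)
    case 0
    show ?case using const[of 0] by simp
  next
    case (pCons c g)
    have "[:pCons c g:] = bconst c + Zb * [:g:]"
      by (simp add: bconst_def Zb_def)
    then show ?case using add[OF const mult[OF Zb pCons(2)]] by simp
  qed
  moreover have "pCons g f = [:g:] + Z * f"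
    by (simp add: Z_def)
  ultimately show ?case using add mult Z pCons.IH by simp
qed

section \<open>Substitution as a ring homomorphism\<close>

context
begin

private abbreviation (input) ev :: "complex poly \<Rightarrow> bipoly \<Rightarrow> bipoly" where
  "ev g q \<equiv> poly (map_poly (\<lambda>x. [:[:x:]:]) g) q"

private lemma ev_pCons: "ev (pCons x g) q = [:[:x:]:] + q * ev g q"
  by (simp add: map_poly_pCons)

private lemma ev_add: "ev (f + g) q = ev f q + ev g q"
proof (induction f g rule: poly_induct2)
  case (pCons a p b q')
  have "[:[:a + b:]:] = [:[:a:]:] + [:[:b:]:]" by simp
  then show ?case using pCons by (simp only: add_pCons ev_pCons) (simp add: algebra_simps)
qed simp

private lemma ev_smult: "ev (smult c f) q = [:[:c:]:] * ev f q"
proof (induction f)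
  case (pCons a p)
  have "[:[:c * a:]:] = [:[:c:]:] * [:[:a:]:]" by simp
  then show ?case using pCons by (simp only: smult_pCons ev_pCons) (simp only: algebra_simps)
qed simp

private lemma ev_mult: "ev (f * g) q = ev f q * ev g q"
proof (induction f)
  case (pCons a p)
  show ?case
    by (simp only: mult_pCons_left ev_add ev_smult ev_pCons pCons.IH) (simp add: algebra_simps)
qed simp

lemma subst2_add: "subst2 (f + g) p q = subst2 f p q + subst2 g p q"
proof (induction f g rule: poly_induct2)
  case (pCons a f b g)
  then show ?case by (simp add: subst2_pCons ev_add algebra_simps)
qed simp

private lemma subst2_smult: "subst2 (smult c f) p q = ev c q * subst2 f p q"
proof (induction f)
  case (pCons a f)
  then show ?case by (simp add: subst2_pCons ev_mult algebra_simps)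
qed simp

lemma subst2_mult: "subst2 (f * g) p q = subst2 f p q * subst2 g p q"
proof (induction f)
  case (pCons a f)
  show ?case
    by (simp only: mult_pCons_left subst2_add subst2_smult subst2_pCons pCons.IH)
      (simp add: algebra_simps)
qed simp

lemma subst2_bconst [simp]: "subst2 (bconst c) p q = bconst c"
  by (simp add: bconst_def subst2_pCons map_poly_pCons)

lemma subst2_Z [simp]: "subst2 Z p q = p"
  by (simp add: Z_def subst2_pCons map_poly_pCons flip: one_pCons)
    (simp add: one_pCons subst2_pCons map_poly_pCons)

lemma subst2_Zb [simp]: "subst2 Zb p q = q"
  by (simp add: Zb_def subst2_pCons map_poly_pCons flip: one_pCons)

end

lemma subst2_1 [simp]: "subst2 1 p q = 1"
  using subst2_bconst[of 1] by simp

lemma subst2_minus: "subst2 (- f) p q = - subst2 f p q"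
  using subst2_mult[of "bconst (-1)" f p q] unfolding subst2_bconst by (simp add: bconst_minus)

lemma subst2_diff: "subst2 (f - g) p q = subst2 f p q - subst2 g p q"
  using subst2_add[of f "- g"] by (simp add: subst2_minus)

lemma subst2_power: "subst2 (f ^ n) p q = subst2 f p q ^ n"
  by (induction n) (auto simp: subst2_mult)

lemma subst2_scal: "subst2 (scal c f) p q = scal c (subst2 f p q)"
  by (simp add: scal_bconst subst2_mult)

lemma subst2_sum: "subst2 (\<Sum>i\<in>A. f i) p q = (\<Sum>i\<in>A. subst2 (f i) p q)"
  by (induction A rule: infinite_finite_induct) (auto simp: subst2_add)

lemmas subst2_hom = subst2_add subst2_minus subst2_diff subst2_mult subst2_power subst2_scal

lemma subst2_subst2: "subst2 (subst2 f p q) p' q' = subst2 f (subst2 p p' q') (subst2 q p' q')"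
  by (induction f rule: bipoly_induct) (auto simp: subst2_hom)

lemma subst2_Z_Zb [simp]: "subst2 f Z Zb = f"
  by (induction f rule: bipoly_induct) (auto simp: subst2_hom)

section \<open>Swap, reflections and the two partial derivatives\<close>

lemma swap_bconst [simp]: "swap (bconst c) = bconst c"
  and swap_Z [simp]: "swap Z = Zb" and swap_Zb [simp]: "swap Zb = Z"
  and swap_0 [simp]: "swap 0 = 0" and swap_1 [simp]: "swap 1 = 1"
  by (simp_all add: swap_def)

lemma swap_add: "swap (f + g) = swap f + swap g"
  and swap_diff: "swap (f - g) = swap f - swap g"
  and swap_minus: "swap (- f) = - swap f"
  and swap_mult: "swap (f * g) = swap f * swap g"
  and swap_power: "swap (f ^ n) = swap f ^ n"
  and swap_scal: "swap (scal c f) = scal c (swap f)"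
  and swap_sum: "swap (\<Sum>i\<in>I. h i) = (\<Sum>i\<in>I. swap (h i))"
  by (simp_all add: swap_def subst2_hom subst2_sum)

lemmas swap_hom = swap_add swap_diff swap_minus swap_mult swap_power swap_scal

lemma swap_swap [simp]: "swap (swap f) = f"
  by (simp add: swap_def subst2_subst2)

lemma subst2_swap: "subst2 (swap f) p q = subst2 f q p"
  by (simp add: swap_def subst2_subst2)

lemma swap_subst2: "swap (subst2 f p q) = subst2 f (swap p) (swap q)"
  by (simp add: swap_def subst2_subst2)

lemma reflect_bconst [simp]: "reflect \<eta> (bconst c) = bconst c"
  and reflect_Z [simp]: "reflect \<eta> Z = bconst \<eta> * Zb"
  and reflect_Zb [simp]: "reflect \<eta> Zb = bconst (inverse \<eta>) * Z"
  by (simp_all add: reflect_def scal_bconst)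

lemma reflect_add: "reflect \<eta> (f + g) = reflect \<eta> f + reflect \<eta> g"
  and reflect_mult: "reflect \<eta> (f * g) = reflect \<eta> f * reflect \<eta> g"
  and reflect_power: "reflect \<eta> (f ^ n) = reflect \<eta> f ^ n"
  and reflect_1 [simp]: "reflect \<eta> 1 = 1"
  by (simp_all add: reflect_def subst2_hom)

lemma swap_reflect: "\<eta> \<noteq> 0 \<Longrightarrow> swap (reflect \<eta> f) = reflect (inverse \<eta>) (swap f)"
  by (induction f rule: bipoly_induct) (auto simp: swap_hom reflect_add reflect_mult)

lemma reflect_rho: "\<eta> \<noteq> 0 \<Longrightarrow> reflect \<eta> (Z * Zb) = Z * Zb"
proof -
  assume "\<eta> \<noteq> 0"
  have "bconst \<eta> * bconst (inverse \<eta>) = 1"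
    using \<open>\<eta> \<noteq> 0\<close> by (simp flip: bconst_mult)
  then show ?thesis
    by (simp add: reflect_mult mult_ac flip: mult.assoc)
qed

lemma pderiv_bconst [simp]: "pderiv (bconst c) = 0"
  and pderiv_Z [simp]: "pderiv Z = 1" and pderiv_Zb [simp]: "pderiv Zb = 0"
  by (simp_all add: bconst_def Z_def Zb_def pderiv_pCons one_pCons)

lemma pderivb_bconst [simp]: "pderivb (bconst c) = 0"
  and pderivb_Z [simp]: "pderivb Z = 0" and pderivb_Zb [simp]: "pderivb Zb = 1"
  by (simp_all add: bconst_def Z_def Zb_def map_poly_pCons pderiv_pCons one_pCons)

lemma pderivb_add: "pderivb (f + g) = pderivb f + pderivb g"
  by (rule poly_eqI) (simp add: coeff_map_poly pderiv_add)

lemma pderivb_mult: "pderivb (f * g) = pderivb f * g + f * pderivb g"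
proof (rule poly_eqI)
  fix n
  \<comment> \<open>At order 1, \<open>higher_pderiv_sum\<close> says that \<open>pderiv\<close>
    commutes with finite sums.\<close>
  have "coeff (pderivb (f * g)) n = (\<Sum>i\<le>n. pderiv (coeff f i * coeff g (n - i)))"
    using higher_pderiv_sum[of 1] by (simp add: coeff_map_poly coeff_mult)
  also have "\<dots> = coeff (pderivb f * g + f * pderivb g) n"
    by (simp add: coeff_map_poly coeff_mult pderiv_mult sum.distrib add.commute mult.commute[of "coeff g _"])
  finally show "coeff (pderivb (f * g)) n = coeff (pderivb f * g + f * pderivb g) n" .
qed

lemma swap_pderiv: "swap (pderiv f) = pderivb (swap f)"
  by (induction f rule: bipoly_induct)
    (auto simp: swap_hom pderiv_add pderiv_mult pderivb_add pderivb_mult)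

section \<open>Divided differences and Dunkl operators\<close>

lemma pderiv_power: "pderiv (f ^ n) = of_nat n * f ^ (n - 1) * pderiv f"
proof (induction n)
  case (Suc n)
  then show ?case by (cases n) (simp_all add: pderiv_mult algebra_simps)
qed simp

text \<open>Bivariate polynomials have no zero divisors, so the exact quotient is determined by its
  product with the divisor. All later values of \<open>divdiff\<close> are found this way instead of
  by polynomial division.\<close>

lemma divdiff_eqI:
  assumes "\<eta> \<noteq> 0" and "(Z - scal \<eta> Zb) * q = f - reflect \<eta> f"
  shows "divdiff \<eta> f = q"
proof -
  have "(Z - scal \<eta> Zb) * divdiff \<eta> f = (Z - scal \<eta> Zb) * q"
    using divdiff_exact[OF assms(1), of f] assms(2) by simp
  then show ?thesis using Z_minus_scal_neq_0 by simp
qed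

lemma divdiff_add: "\<eta> \<noteq> 0 \<Longrightarrow> divdiff \<eta> (f + g) = divdiff \<eta> f + divdiff \<eta> g"
  by (rule divdiff_eqI) (simp_all add: reflect_add distrib_left divdiff_exact)

text \<open>A Leibniz rule twisted by the reflection \<open>R\<close>: it comes from
  \<open>f g - R f R g = f (g - R g) + (f - R f) R g\<close>.\<close>

lemma divdiff_mult:
  assumes "\<eta> \<noteq> 0"
  shows "divdiff \<eta> (f * g) = f * divdiff \<eta> g + divdiff \<eta> f * reflect \<eta> g"
proof (rule divdiff_eqI[OF assms])
  let ?x = "Z - scal \<eta> Zb"
  have "?x * (f * divdiff \<eta> g + divdiff \<eta> f * reflect \<eta> g)
    = f * (?x * divdiff \<eta> g) + (?x * divdiff \<eta> f) * reflect \<eta> g"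
    by (simp only: distrib_left mult_ac)
  also have "\<dots> = f * g - reflect \<eta> (f * g)"
    by (simp only: divdiff_exact[OF assms] reflect_mult) (simp add: algebra_simps)
  finally show "?x * (f * divdiff \<eta> g + divdiff \<eta> f * reflect \<eta> g) = f * g - reflect \<eta> (f * g)" .
qed

lemma divdiff_invariant: "\<eta> \<noteq> 0 \<Longrightarrow> reflect \<eta> f = f \<Longrightarrow> divdiff \<eta> f = 0"
  by (rule divdiff_eqI) simp_all

lemma divdiff_bconst_mult: "\<eta> \<noteq> 0 \<Longrightarrow> divdiff \<eta> (bconst c * f) = bconst c * divdiff \<eta> f"
  by (simp add: divdiff_mult divdiff_invariant)

lemma divdiff_rho_power_mult:
  assumes "\<eta> \<noteq> 0"
  shows "divdiff \<eta> ((Z * Zb) ^ j * f) = (Z * Zb) ^ j * divdiff \<eta> f"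
  using assms by (simp add: divdiff_mult divdiff_invariant reflect_power reflect_rho)

lemma divdiff_Z_power:
  assumes "\<eta> \<noteq> 0"
  shows "divdiff \<eta> (Z ^ i) = (\<Sum>l<i. bconst (\<eta> ^ l) * (Z ^ (i - Suc l) * Zb ^ l))"
proof (rule divdiff_eqI[OF assms])
  have "(Z - scal \<eta> Zb) * (\<Sum>l<i. bconst (\<eta> ^ l) * (Z ^ (i - Suc l) * Zb ^ l))
    = - ((scal \<eta> Zb - Z) * (\<Sum>l<i. Z ^ (i - Suc l) * scal \<eta> Zb ^ l))"
    by (simp add: scal_bconst power_mult_distrib bconst_power mult_ac flip: mult_minus_left)
  also have "\<dots> = Z ^ i - reflect \<eta> (Z ^ i)"
    by (subst power_diff_sumr2[symmetric]) (simp add: reflect_power scal_bconst)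
  finally show "(Z - scal \<eta> Zb) * (\<Sum>l<i. bconst (\<eta> ^ l) * (Z ^ (i - Suc l) * Zb ^ l))
    = Z ^ i - reflect \<eta> (Z ^ i)" .
qed

text \<open>The reflection sends \<open>Zb ^ i\<close> to \<open>inverse \<eta> ^ i * Z ^ i\<close>,
  so the difference to be divided is \<open>- inverse \<eta> ^ i\<close> times the one already
  divided for \<open>Z ^ i\<close>.\<close>

lemma divdiff_Zb_power:
  assumes "\<eta> \<noteq> 0"
  shows "divdiff \<eta> (Zb ^ i)
    = - (\<Sum>l<i. bconst (inverse \<eta> ^ (i - l)) * (Z ^ (i - Suc l) * Zb ^ l))"
proof (rule divdiff_eqI[OF assms])
  have "(Z - scal \<eta> Zb) * - (\<Sum>l<i. bconst (inverse \<eta> ^ (i - l)) * (Z ^ (i - Suc l) * Zb ^ l))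
    = - (bconst (inverse \<eta> ^ i) *
        ((Z - scal \<eta> Zb) * (\<Sum>l<i. bconst (\<eta> ^ l) * (Z ^ (i - Suc l) * Zb ^ l))))"
    unfolding sum_distrib_left mult_minus_right
  proof (intro arg_cong[where f = uminus] sum.cong refl)
    fix l assume "l \<in> {..<i}"
    then have "inverse \<eta> ^ (i - l) = inverse \<eta> ^ i * \<eta> ^ l"
      using assms by (simp add: power_diff field_simps)
    then show "(Z - scal \<eta> Zb) * (bconst (inverse \<eta> ^ (i - l)) * (Z ^ (i - Suc l) * Zb ^ l))
      = bconst (inverse \<eta> ^ i) * ((Z - scal \<eta> Zb) * (bconst (\<eta> ^ l) * (Z ^ (i - Suc l) * Zb ^ l)))"
      by (simp only: bconst_mult mult_ac)
  qed
  also have "\<dots> = - (bconst (inverse \<eta> ^ i) * (Z ^ i - reflect \<eta> (Z ^ i)))"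
    by (simp only: divdiff_Z_power[OF assms, symmetric] divdiff_exact[OF assms])
  also have "\<dots> = Zb ^ i - reflect \<eta> (Zb ^ i)"
  proof -
    have "bconst (inverse \<eta>) ^ i * bconst \<eta> ^ i = 1"
      using assms by (simp flip: bconst_power bconst_mult power_mult_distrib)
    then show ?thesis
      by (simp add: reflect_power power_mult_distrib bconst_power right_diff_distrib flip: mult.assoc)
  qed
  finally show "(Z - scal \<eta> Zb) * - (\<Sum>l<i. bconst (inverse \<eta> ^ (i - l)) * (Z ^ (i - Suc l) * Zb ^ l))
    = Zb ^ i - reflect \<eta> (Zb ^ i)" .
qed

text \<open>The swap turns the divisor \<open>Z - \<eta> Zb\<close> into
  \<open>-\<eta> (Z - inverse \<eta> Zb)\<close>; this accounts for both the sign and the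
  scalar.\<close>

lemma swap_divdiff:
  assumes "\<eta> \<noteq> 0"
  shows "swap (divdiff \<eta> f) = - scal (inverse \<eta>) (divdiff (inverse \<eta>) (swap f))"
proof -
  have "(Z - scal (inverse \<eta>) Zb) * - (bconst \<eta> * swap (divdiff \<eta> f))
    = swap ((Z - scal \<eta> Zb) * divdiff \<eta> f)"
    using assms
    by (simp add: swap_hom scal_bconst left_diff_distrib flip: mult.assoc bconst_mult)
  also have "\<dots> = swap f - reflect (inverse \<eta>) (swap f)"
    by (simp only: divdiff_exact[OF assms] swap_diff swap_reflect[OF assms])
  finally have "divdiff (inverse \<eta>) (swap f) = - (bconst \<eta> * swap (divdiff \<eta> f))"
    using assms by (intro divdiff_eqI) auto
  then show ?thesis
    using assms by (simp add: scal_bconst flip: mult.assoc bconst_mult)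
qed

section \<open>Power sums of roots of unity\<close>

lemma omega_neq_0 [simp]: "omega s \<noteq> 0"
  by (simp add: omega_def)

lemma omega_power: "omega s ^ k = cis (pi * of_nat k / of_nat s)"
  unfolding omega_def cis_conv_exp by (simp flip: exp_of_nat_mult) (simp add: mult_ac)

lemma omega_power_s: "s \<ge> 1 \<Longrightarrow> omega s ^ s = -1"
  by (simp add: omega_power)

lemma omega_power_even_neq_1:
  assumes "0 < e" "e < s"
  shows "omega s ^ (2 * e) \<noteq> 1"
proof
  assume *: "omega s ^ (2 * e) = 1"
  \<comment> \<open>The argument of the root of unity lies strictly between \<open>0\<close> and
    \<open>2 pi\<close>, where the cosine never equals 1.\<close>
  define x where "x = 2 * pi * (of_nat e / of_nat s)"
  have x: "0 < x" "x < 2 * pi"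
    using assms by (auto simp: x_def field_simps)
  have "Re (omega s ^ (2 * e)) = cos x"
    by (simp add: omega_power x_def mult_ac)
  with * have "cos x = 1" by simp
  then consider n :: nat where "x = of_nat n * 2 * pi" | n :: nat where "x = - (of_nat n * 2 * pi)"
    using cos_one_2pi[of x] by auto
  then show False
  proof cases
    case 1
    with x have "of_nat n * (2 * pi) < 1 * (2 * pi)" "n \<noteq> 0" by auto
    then show False by (subst (asm) mult_less_cancel_right) auto
  next
    case 2
    have "of_nat n * 2 * pi \<ge> (0 :: real)" by simp
    with 2 x show False by linarith
  qed
qed

lemma sum_power_root_of_unity:
  fixes x :: complex
  assumes "x ^ s = 1" "x \<noteq> 1"
  shows "(\<Sum>j<s. x ^ j) = 0"
  using assms geometric_sum[of x s] by simp

lemma sum_omega_even: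
  assumes "l < s"
  shows "(\<Sum>j<s. (omega s ^ (2 * j)) ^ l) = (if l = 0 then of_nat s else 0)"
proof (cases "l = 0")
  case False
  have "(omega s ^ (2 * l)) ^ s = ((omega s ^ s) ^ 2) ^ l"
    by (simp add: mult_ac flip: power_mult)
  then have "(\<Sum>j<s. (omega s ^ (2 * l)) ^ j) = 0"
    using assms False by (intro sum_power_root_of_unity omega_power_even_neq_1) (auto simp: omega_power_s)
  with False show ?thesis by (simp add: mult_ac flip: power_mult)
qed auto

lemma sum_omega_odd:
  assumes "l < s"
  shows "(\<Sum>j<s. (omega s ^ (2 * j + 1)) ^ l) = (if l = 0 then of_nat s else 0)"
proof -
  have "(\<Sum>j<s. (omega s ^ (2 * j + 1)) ^ l) = omega s ^ l * (\<Sum>j<s. (omega s ^ (2 * j)) ^ l)"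
    by (simp add: sum_distrib_left power_mult_distrib)
  then show ?thesis using sum_omega_even[OF assms] by simp
qed

text \<open>The exponents run over \<open>1..s\<close>, the range that occurs for powers of
  \<open>Zb\<close>, so the surviving exponent is \<open>s\<close> and not \<open>0\<close>. For odd
  powers of \<open>omega\<close> it contributes with the opposite sign because
  \<open>omega s ^ s = -1\<close>.\<close>

lemma sum_inverse_omega_even:
  assumes "0 < l" "l \<le> s"
  shows "(\<Sum>j<s. inverse (omega s ^ (2 * j)) ^ l) = (if l = s then of_nat s else 0)"
proof (cases "l = s")
  case True
  have "inverse (omega s ^ (2 * j)) ^ s = inverse (((omega s ^ s) ^ 2) ^ j)" for j
    by (simp add: power_inverse mult_ac flip: power_mult)
  then show ?thesis using True assms by (simp add: omega_power_s)
next
  case False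
  have "inverse (omega s ^ (2 * l)) ^ s = inverse (((omega s ^ s) ^ 2) ^ l)"
    by (simp add: power_inverse mult_ac flip: power_mult)
  then have "(\<Sum>j<s. inverse (omega s ^ (2 * l)) ^ j) = 0"
    using assms False omega_power_even_neq_1[of l s]
    by (intro sum_power_root_of_unity) (auto simp: omega_power_s inverse_eq_1_iff)
  with False show ?thesis by (simp add: power_inverse mult_ac flip: power_mult)
qed

lemma sum_inverse_omega_odd:
  assumes "0 < l" "l \<le> s"
  shows "(\<Sum>j<s. inverse (omega s ^ (2 * j + 1)) ^ l) = (if l = s then - of_nat s else 0)"
proof -
  have "(\<Sum>j<s. inverse (omega s ^ (2 * j + 1)) ^ l)
    = inverse (omega s ^ l) * (\<Sum>j<s. inverse (omega s ^ (2 * j)) ^ l)"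
    by (simp add: sum_distrib_left power_mult_distrib power_inverse)
  then show ?thesis using assms by (simp add: sum_inverse_omega_even omega_power_s)
qed

text \<open>For \<open>g = p(Z\<^sup>s, Zb\<^sup>s)\<close> with \<open>p\<close> homogeneous of degree \<open>m\<close>, the reflection with index \<open>k\<close>
  acts on \<open>g\<close> as the swap up to the sign \<open>(-1)\<^sup>k\<^sup>m\<close>, because \<open>\<omega>\<^sup>s = -1\<close>.\<close>

definition refl_class :: "nat \<Rightarrow> nat \<Rightarrow> bipoly \<Rightarrow> bool" where
  "refl_class s m g \<longleftrightarrow> (\<forall>k. reflect (omega s ^ k) g = bconst ((-1) ^ (k * m)) * swap g)"

section \<open>Dunkl operators on products\<close>

locale dihedral =
  fixes s :: nat and \<kappa>0 \<kappa>1 :: complex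
  assumes s_pos: "s \<ge> 1"
begin

abbreviation T :: "bipoly \<Rightarrow> bipoly" where "T \<equiv> dunkl_T s \<kappa>0 \<kappa>1"

abbreviation Tb :: "bipoly \<Rightarrow> bipoly" where "Tb \<equiv> dunkl_Tbar s \<kappa>0 \<kappa>1"

text \<open>The total weight of a reflection from each class on polynomials of class
  \<open>m\<close>: the second class enters with the sign \<open>(-1) ^ m\<close>.\<close>

definition eps :: "nat \<Rightarrow> complex" where "eps m = \<kappa>0 + (-1) ^ m * \<kappa>1"

lemma T_add: "T (f + g) = T f + T g"
  by (simp add: dunkl_T_def pderiv_add divdiff_add sum.distrib scal_bconst algebra_simps)

lemma T_bconst_mult: "T (bconst c * f) = bconst c * T f"
  by (simp add: dunkl_T_def pderiv_mult divdiff_bconst_mult scal_bconst distrib_left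
      mult.left_commute flip: sum_distrib_left)

lemma T_0 [simp]: "T 0 = 0"
  using T_bconst_mult[of 0 0] by simp

lemma T_minus: "T (- f) = - T f"
  using T_bconst_mult[of "-1" f] by (simp add: bconst_minus)

lemma T_diff: "T (f - g) = T f - T g"
  using T_add[of f "- g"] by (simp add: T_minus)

lemma T_rho_power_mult:
  "T ((Z * Zb) ^ j * g) = of_nat j * (Zb * (Z * Zb) ^ (j - 1) * g) + (Z * Zb) ^ j * T g"
proof -
  have "pderiv ((Z * Zb) ^ j * g) = of_nat j * (Zb * (Z * Zb) ^ (j - 1) * g) + (Z * Zb) ^ j * pderiv g"
    unfolding pderiv_mult[of "(Z * Zb) ^ j"] pderiv_power by (simp add: pderiv_mult mult_ac)
  then show ?thesis
    by (simp add: dunkl_T_def divdiff_rho_power_mult scal_bconst distrib_left mult.left_commute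
        add.assoc flip: sum_distrib_left)
qed

lemma pderiv_Z_power_mult: "pderiv (Z ^ i * g) = of_nat i * (Z ^ (i - 1) * g) + Z ^ i * pderiv g"
  by (simp add: pderiv_mult pderiv_power algebra_simps)

lemma pderiv_Zb_power_mult: "pderiv (Zb ^ i * g) = Zb ^ i * pderiv g"
  by (simp add: pderiv_mult pderiv_power)

text \<open>Within one class the reflected \<open>g\<close> does not depend on the reflection, so
  \<open>swap g\<close> factors out of both sums in the twisted Leibniz rule.\<close>

lemma sum_divdiff_mult:
  assumes g: "refl_class s m g"
  shows "bconst \<kappa>0 * (\<Sum>j<s. divdiff (omega s ^ (2 * j)) (f * g))
      + bconst \<kappa>1 * (\<Sum>j<s. divdiff (omega s ^ (2 * j + 1)) (f * g))
    = f * (bconst \<kappa>0 * (\<Sum>j<s. divdiff (omega s ^ (2 * j)) g)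
        + bconst \<kappa>1 * (\<Sum>j<s. divdiff (omega s ^ (2 * j + 1)) g))
      + (bconst \<kappa>0 * (\<Sum>j<s. divdiff (omega s ^ (2 * j)) f)
        + bconst (\<kappa>1 * (-1) ^ m) * (\<Sum>j<s. divdiff (omega s ^ (2 * j + 1)) f)) * swap g"
proof -
  have even: "reflect (omega s ^ (2 * j)) g = swap g"
    and odd: "reflect (omega s ^ (2 * j + 1)) g = bconst ((-1) ^ m) * swap g" for j
    using g[unfolded refl_class_def, rule_format, of "2 * j"]
      g[unfolded refl_class_def, rule_format, of "2 * j + 1"]
    by (simp_all add: power_add power_mult distrib_right)
  have "(\<Sum>j<s. divdiff (omega s ^ (2 * j)) (f * g))
    = f * (\<Sum>j<s. divdiff (omega s ^ (2 * j)) g) + (\<Sum>j<s. divdiff (omega s ^ (2 * j)) f) * swap g"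
    by (simp add: divdiff_mult even sum.distrib sum_distrib_left sum_distrib_right)
  moreover have "(\<Sum>j<s. divdiff (omega s ^ (2 * j + 1)) (f * g))
    = f * (\<Sum>j<s. divdiff (omega s ^ (2 * j + 1)) g)
      + bconst ((-1) ^ m) * (\<Sum>j<s. divdiff (omega s ^ (2 * j + 1)) f) * swap g"
    using odd by (simp add: divdiff_mult sum.distrib sum_distrib_left sum_distrib_right mult_ac)
  ultimately show ?thesis
    by (simp add: bconst_mult algebra_simps)
qed

lemma sum_bconst_single:
  fixes c :: "nat \<Rightarrow> complex" and h :: "nat \<Rightarrow> bipoly"
  assumes "\<And>l. l < i \<Longrightarrow> c l = (if l = 0 then a else 0)" and "0 < i"
  shows "(\<Sum>l<i. bconst (c l) * h l) = bconst a * h 0"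
proof -
  have "(\<Sum>l<i. bconst (c l) * h l) = (\<Sum>l<i. if l = 0 then bconst a * h 0 else 0)"
    by (intro sum.cong) (auto simp: assms(1))
  then show ?thesis using assms(2) by simp
qed

text \<open>Summed over the reflections, the coefficient of \<open>Zb ^ l\<close> becomes a sum of
  \<open>l\<close>-th powers of roots of unity. As \<open>l < i \<le> s\<close>, only
  \<open>l = 0\<close> survives.\<close>

lemma sum_divdiff_Z_power:
  assumes "1 \<le> i" "i \<le> s"
  shows "(\<Sum>j<s. divdiff (omega s ^ (2 * j)) (Z ^ i)) = of_nat s * Z ^ (i - 1)"
    and "(\<Sum>j<s. divdiff (omega s ^ (2 * j + 1)) (Z ^ i)) = of_nat s * Z ^ (i - 1)"
proof -
  have *: "(\<Sum>j<s. divdiff (\<eta> j) (Z ^ i)) = of_nat s * Z ^ (i - 1)"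
    if "\<And>j. \<eta> j \<noteq> 0" and "\<And>l. l < s \<Longrightarrow> (\<Sum>j<s. \<eta> j ^ l) = (if l = 0 then of_nat s else 0)" for \<eta>
  proof -
    have "(\<Sum>j<s. divdiff (\<eta> j) (Z ^ i))
      = (\<Sum>l<i. bconst (\<Sum>j<s. \<eta> j ^ l) * (Z ^ (i - Suc l) * Zb ^ l))"
      using that(1) by (simp add: divdiff_Z_power bconst_sum sum_distrib_right) (rule sum.swap)
    also have "\<dots> = bconst (of_nat s) * (Z ^ (i - Suc 0) * Zb ^ 0)"
      using assms that(2) by (intro sum_bconst_single) auto
    finally show ?thesis by (simp add: bconst_of_nat)
  qed
  show "(\<Sum>j<s. divdiff (omega s ^ (2 * j)) (Z ^ i)) = of_nat s * Z ^ (i - 1)"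
    by (rule *) (use sum_omega_even in auto)
  show "(\<Sum>j<s. divdiff (omega s ^ (2 * j + 1)) (Z ^ i)) = of_nat s * Z ^ (i - 1)"
    by (rule *) (use sum_omega_odd in auto)
qed

text \<open>Here the powers have exponents \<open>i - l\<close> in \<open>1..i\<close>. Only
  exponent \<open>s\<close> survives, which forces \<open>i = s\<close> and \<open>l = 0\<close>;
  the two classes then differ in sign.\<close>

lemma sum_divdiff_Zb_power:
  assumes "1 \<le> i" "i \<le> s"
  shows "(\<Sum>j<s. divdiff (omega s ^ (2 * j)) (Zb ^ i)) = (if i = s then - of_nat s * Z ^ (s - 1) else 0)"
    and "(\<Sum>j<s. divdiff (omega s ^ (2 * j + 1)) (Zb ^ i)) = (if i = s then of_nat s * Z ^ (s - 1) else 0)"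
proof -
  have *: "(\<Sum>j<s. divdiff (\<eta> j) (Zb ^ i)) = - (bconst (if i = s then a else 0) * Z ^ (i - 1))"
    if "\<And>j. \<eta> j \<noteq> 0"
      and "\<And>l. 0 < l \<Longrightarrow> l \<le> s \<Longrightarrow> (\<Sum>j<s. inverse (\<eta> j) ^ l) = (if l = s then a else 0)" for \<eta> a
  proof -
    have "(\<Sum>j<s. divdiff (\<eta> j) (Zb ^ i))
      = - (\<Sum>l<i. bconst (\<Sum>j<s. inverse (\<eta> j) ^ (i - l)) * (Z ^ (i - Suc l) * Zb ^ l))"
      using that(1) by (simp add: divdiff_Zb_power bconst_sum sum_distrib_right sum_negf) (rule sum.swap)
    also have "\<dots> = - (bconst (if i = s then a else 0) * (Z ^ (i - Suc 0) * Zb ^ 0))"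
      using assms that(2) by (intro arg_cong[where f = uminus] sum_bconst_single) auto
    finally show ?thesis by simp
  qed
  have "(\<Sum>j<s. divdiff (omega s ^ (2 * j)) (Zb ^ i)) = - (bconst (if i = s then of_nat s else 0) * Z ^ (i - 1))"
    by (rule *) (use sum_inverse_omega_even in auto)
  then show "(\<Sum>j<s. divdiff (omega s ^ (2 * j)) (Zb ^ i)) = (if i = s then - of_nat s * Z ^ (s - 1) else 0)"
    by (auto simp: bconst_of_nat)
  have "(\<Sum>j<s. divdiff (omega s ^ (2 * j + 1)) (Zb ^ i)) = - (bconst (if i = s then - of_nat s else 0) * Z ^ (i - 1))"
    by (rule *) (use sum_inverse_omega_odd in auto)
  then show "(\<Sum>j<s. divdiff (omega s ^ (2 * j + 1)) (Zb ^ i)) = (if i = s then of_nat s * Z ^ (s - 1) else 0)"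
    by (auto simp: bconst_of_nat bconst_minus)
qed

lemma T_Z_power_mult:
  assumes "refl_class s m g" "1 \<le> i" "i \<le> s"
  shows "T (Z ^ i * g)
    = of_nat i * (Z ^ (i - 1) * g) + Z ^ i * T g + bconst (of_nat s * eps m) * (Z ^ (i - 1) * swap g)"
  unfolding dunkl_T_def scal_bconst add.assoc sum_divdiff_mult[OF assms(1)] pderiv_Z_power_mult
    sum_divdiff_Z_power[OF assms(2,3)]
  by (simp add: eps_def bconst_hom algebra_simps)

lemma T_Zb_power_mult:
  assumes "refl_class s m g" "i < s"
  shows "T (Zb ^ i * g) = Zb ^ i * T g"
proof (cases "i = 0")
  case False
  then have i: "1 \<le> i" "i \<le> s" using assms(2) by auto
  show ?thesis
    unfolding dunkl_T_def scal_bconst add.assoc sum_divdiff_mult[OF assms(1)] pderiv_Zb_power_mult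
      sum_divdiff_Zb_power[OF i]
    using assms(2) by (simp add: algebra_simps)
qed simp

lemma T_Zb_power_s_mult:
  assumes "refl_class s m g"
  shows "T (Zb ^ s * g) = Zb ^ s * T g - bconst (of_nat s * eps (Suc m)) * (Z ^ (s - 1) * swap g)"
  unfolding dunkl_T_def scal_bconst add.assoc sum_divdiff_mult[OF assms(1)] pderiv_Zb_power_mult
    sum_divdiff_Zb_power[OF s_pos order_refl]
  by (simp add: eps_def bconst_hom algebra_simps)

text \<open>The swap replaces each \<open>\<eta>\<close> by its inverse, and inversion permutes the
  even and the odd powers of \<open>omega s\<close> separately. The factor in
  \<open>swap_divdiff\<close> supplies the minus sign and the scalar in the definition of
  \<open>Tb\<close>.\<close>

lemma swap_T: "swap (T f) = Tb (swap f)"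
proof -
  define \<phi> where "\<phi> \<eta> = scal \<eta> (divdiff \<eta> (swap f))" for \<eta>
  have period: "omega s ^ (2 * s) = 1"
    using s_pos by (simp add: mult.commute[of 2] power_mult omega_power_s)
  have even: "(\<Sum>j<s. \<phi> (inverse (omega s ^ (2 * j)))) = (\<Sum>j<s. \<phi> (omega s ^ (2 * j)))"
  proof -
    \<comment> \<open>Inversion sends the index \<open>j\<close> to \<open>s - j\<close>, written as
      \<open>Suc (s - Suc j)\<close>: a reversal followed by a shift, and the shift closes up
      because \<open>omega s ^ (2 * s) = 1\<close>.\<close>
    have "inverse (omega s ^ (2 * j)) = omega s ^ (2 * Suc (s - Suc j))" if "j < s" for j
    proof -
      have "omega s ^ (2 * Suc (s - Suc j)) * omega s ^ (2 * j) = omega s ^ (2 * s)"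
        unfolding power_add[symmetric] using that by (intro arg_cong[where f = "\<lambda>x. omega s ^ x"]) simp
      then show ?thesis using period by (intro inverse_unique) (simp add: mult.commute)
    qed
    then have "(\<Sum>j<s. \<phi> (inverse (omega s ^ (2 * j)))) = (\<Sum>j<s. \<phi> (omega s ^ (2 * Suc (s - Suc j))))"
      by simp
    also have "\<dots> = (\<Sum>j<s. \<phi> (omega s ^ (2 * Suc j)))"
      by (rule sum.nat_diff_reindex)
    also have "\<dots> = (\<Sum>j<s. \<phi> (omega s ^ (2 * j)))"
      using sum.lessThan_Suc_shift[of "\<lambda>j. \<phi> (omega s ^ (2 * j))" s] period by simp
    finally show ?thesis .
  qed
  have odd: "(\<Sum>j<s. \<phi> (inverse (omega s ^ (2 * j + 1)))) = (\<Sum>j<s. \<phi> (omega s ^ (2 * j + 1)))"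
  proof -
    have "inverse (omega s ^ (2 * j + 1)) = omega s ^ (2 * (s - Suc j) + 1)" if "j < s" for j
    proof -
      have "omega s ^ (2 * (s - Suc j) + 1) * omega s ^ (2 * j + 1) = omega s ^ (2 * s)"
        unfolding power_add[symmetric] using that by (intro arg_cong[where f = "\<lambda>x. omega s ^ x"]) simp
      then show ?thesis using period by (intro inverse_unique) (simp only: mult.commute)
    qed
    then have "(\<Sum>j<s. \<phi> (inverse (omega s ^ (2 * j + 1)))) = (\<Sum>j<s. \<phi> (omega s ^ (2 * (s - Suc j) + 1)))"
      by simp
    also have "\<dots> = (\<Sum>j<s. \<phi> (omega s ^ (2 * j + 1)))"
      by (rule sum.nat_diff_reindex)
    finally show ?thesis .
  qed
  have "swap (divdiff (omega s ^ k) f) = - \<phi> (inverse (omega s ^ k))" for k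
    by (simp only: swap_divdiff \<phi>_def power_not_zero omega_neq_0 not_False_eq_True)
  then have "swap (T f) = pderivb (swap f) + scal \<kappa>0 (\<Sum>j<s. - \<phi> (inverse (omega s ^ (2 * j))))
      + scal \<kappa>1 (\<Sum>j<s. - \<phi> (inverse (omega s ^ (2 * j + 1))))"
    unfolding dunkl_T_def by (simp only: swap_add swap_scal swap_sum swap_pderiv)
  then show ?thesis
    unfolding sum_negf even odd by (simp add: dunkl_Tbar_def \<phi>_def scal_bconst)
qed

lemma Tb_eq: "Tb f = swap (T (swap f))"
  by (simp add: swap_T)

end

section \<open>Contiguous relations of Jacobi polynomials\<close>

text \<open>The coefficient with respect to powers of \<open>(1 - x)/2\<close>. Extension by zero
  beyond the degree lets polynomials of different degrees be compared over a common range.\<close>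

definition jacobi_coeff :: "nat \<Rightarrow> complex \<Rightarrow> complex \<Rightarrow> nat \<Rightarrow> complex" where
  "jacobi_coeff n \<alpha> \<beta> l = (if l \<le> n then
     (-1) ^ l * pochhammer (of_nat n + \<alpha> + \<beta> + 1) l * pochhammer (\<alpha> + 1 + of_nat l) (n - l)
       / (fact l * fact (n - l)) else 0)"

lemma pochhammer_minus_of_nat:
  "l \<le> n \<Longrightarrow> pochhammer (- of_nat n :: complex) l * fact (n - l) = (-1) ^ l * fact n"
proof (induction l)
  case (Suc l)
  then obtain k where k: "n = Suc (l + k)" using less_imp_Suc_add[of l n] by auto
  have "pochhammer (- of_nat n :: complex) (Suc l) * fact (n - Suc l)
    = - (pochhammer (- of_nat n) l * fact (n - l))"
    by (simp add: pochhammer_Suc k algebra_simps Suc_diff_le)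
  then show ?case using Suc by simp
qed simp

lemma smult_sum_right: "smult c (\<Sum>i\<in>I. f i) = (\<Sum>i\<in>I. smult c (f i))"
  by (induction I rule: infinite_finite_induct) (auto simp: smult_add_right)

lemma jacobi_eq_sum:
  assumes "n \<le> N"
  shows "jacobi n \<alpha> \<beta> = (\<Sum>l\<le>N. smult (jacobi_coeff n \<alpha> \<beta> l) ([:1/2, -1/2:] ^ l))"
proof -
  have "1 / fact n * (pochhammer (- of_nat n) l * p * q / fact l) = (-1) ^ l * p * q / (fact l * fact (n - l))"
    if "l \<le> n" for l and p q :: complex
    using pochhammer_minus_of_nat[OF that] by (simp add: field_simps)
  then have "jacobi n \<alpha> \<beta> = (\<Sum>l\<le>n. smult (jacobi_coeff n \<alpha> \<beta> l) ([:1/2, -1/2:] ^ l))"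
    unfolding jacobi_def jacobi_coeff_def smult_sum_right smult_smult by (intro sum.cong) auto
  also have "\<dots> = (\<Sum>l\<le>N. smult (jacobi_coeff n \<alpha> \<beta> l) ([:1/2, -1/2:] ^ l))"
    using assms by (intro sum.mono_neutral_left) (auto simp: jacobi_coeff_def)
  finally show ?thesis .
qed

lemma jacobi_0 [simp]: "jacobi 0 \<alpha> \<beta> = 1"
  by (simp add: jacobi_def)

lemma mult_jacobi_eq_sum:
  assumes "n \<le> N"
  shows "[:1/2, -1/2:] * jacobi n \<alpha> \<beta>
    = (\<Sum>l\<le>Suc N. smult (case l of 0 \<Rightarrow> 0 | Suc k \<Rightarrow> jacobi_coeff n \<alpha> \<beta> k) ([:1/2, -1/2:] ^ l))"
  unfolding jacobi_eq_sum[OF assms] sum_distrib_left mult_smult_right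
  by (subst sum.atMost_Suc_shift) simp

lemma pochhammer_shift:
  fixes a b :: complex
  assumes "b = a + 1"
  shows "a * pochhammer b n = pochhammer a n * (a + of_nat n)"
  using assms pochhammer_rec[of a n] pochhammer_Suc[of a n] by simp

text \<open>All three coefficients are multiples of one quantity \<open>r\<close>, and the claim
  reduces to \<open>x + k = (x - 1) + (k + 1)\<close>.\<close>

lemma jacobi_coeff_raise_snd:
  "jacobi_coeff (Suc n) \<alpha> (\<beta> + 1) l
    = jacobi_coeff (Suc n) \<alpha> \<beta> l - (case l of 0 \<Rightarrow> 0 | Suc k \<Rightarrow> jacobi_coeff n (\<alpha> + 1) (\<beta> + 1) k)"
proof (cases l)
  case (Suc k)
  show ?thesis
  proof (cases "k \<le> n")
    case True
    define x where "x = of_nat n + \<alpha> + \<beta> + 3"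
    have arg: "of_nat (Suc n) + \<alpha> + (\<beta> + 1) + 1 = x" "of_nat (Suc n) + \<alpha> + \<beta> + 1 = x - 1"
      "of_nat n + (\<alpha> + 1) + (\<beta> + 1) + 1 = x" "\<alpha> + 1 + 1 + of_nat k = \<alpha> + 1 + of_nat (Suc k)"
      by (simp_all add: x_def)
    define q where "q = pochhammer (\<alpha> + 1 + of_nat (Suc k)) (n - k)"
    define r where "r = (-1) ^ k * pochhammer x k * q / (fact k * fact (n - k))"
    have eq1: "jacobi_coeff (Suc n) \<alpha> (\<beta> + 1) l = - r * (x + of_nat k) / of_nat (Suc k)"
      unfolding jacobi_coeff_def Suc arg r_def pochhammer_Suc diff_Suc_Suc q_def[symmetric] using True
      by (simp add: field_simps del: of_nat_Suc)
    have eq2: "jacobi_coeff (Suc n) \<alpha> \<beta> l = - r * (x - 1) / of_nat (Suc k)"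
      unfolding jacobi_coeff_def Suc arg r_def pochhammer_rec[of "x - 1"] diff_Suc_Suc q_def[symmetric]
      using True by (simp add: field_simps del: of_nat_Suc)
    have eq3: "jacobi_coeff n (\<alpha> + 1) (\<beta> + 1) k = r"
      unfolding jacobi_coeff_def arg r_def q_def using True by simp
    show ?thesis
      unfolding eq1 eq2 unfolding Suc nat.case eq3 using of_nat_neq_0[of k, where 'a = complex] by (simp add: divide_simps) (simp add: algebra_simps)
  qed (simp add: Suc jacobi_coeff_def)
qed (simp add: jacobi_coeff_def)

lemma jacobi_coeff_raise_both:
  "(of_nat n + \<alpha> + \<beta> + 2) * jacobi_coeff n (\<alpha> + 1) (\<beta> + 1) l
    = (of_nat n + \<alpha> + 1) * jacobi_coeff n \<alpha> (\<beta> + 1) l + (of_nat n + \<beta> + 1) * jacobi_coeff n (\<alpha> + 1) \<beta> l"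
proof (cases "l \<le> n")
  case True
  define x where "x = of_nat n + \<alpha> + \<beta> + 2"
  define y where "y = \<alpha> + 1 + of_nat l"
  have arg: "of_nat n + (\<alpha> + 1) + (\<beta> + 1) + 1 = x + 1" "of_nat n + \<alpha> + (\<beta> + 1) + 1 = x"
    "of_nat n + (\<alpha> + 1) + \<beta> + 1 = x" "\<alpha> + 1 + 1 + of_nat l = y + 1"
    "\<alpha> + 1 + of_nat l = y" "of_nat n + \<alpha> + 1 = y + of_nat (n - l)"
    using True by (simp_all add: x_def y_def of_nat_diff)
  define r where "r = (-1) ^ l / (fact l * fact (n - l) :: complex)"
  have 1: "x * pochhammer (x + 1) l = pochhammer x l * (x + of_nat l)"
    and 2: "pochhammer y (n - l) * (y + of_nat (n - l)) = y * pochhammer (y + 1) (n - l)"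
    by (simp_all add: pochhammer_shift)
  have eq: "jacobi_coeff n (\<alpha> + 1) (\<beta> + 1) l = r * pochhammer (x + 1) l * pochhammer (y + 1) (n - l)"
    "jacobi_coeff n \<alpha> (\<beta> + 1) l = r * pochhammer x l * pochhammer y (n - l)"
    "jacobi_coeff n (\<alpha> + 1) \<beta> l = r * pochhammer x l * pochhammer (y + 1) (n - l)"
    unfolding jacobi_coeff_def arg r_def using True by simp_all
  have "x + of_nat l = y + (of_nat n + \<beta> + 1)"
    by (simp add: x_def y_def)
  with 1 2 have "x * (r * pochhammer (x + 1) l * pochhammer (y + 1) (n - l))
    = (y + of_nat (n - l)) * (r * pochhammer x l * pochhammer y (n - l))
      + (of_nat n + \<beta> + 1) * (r * pochhammer x l * pochhammer (y + 1) (n - l))"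
    by algebra
  then show ?thesis
    unfolding eq arg(6) x_def[symmetric] .
qed (simp add: jacobi_coeff_def)

text \<open>The relation mirrors the previous one under \<open>x -> -x\<close>, but an expansion in
  powers of \<open>1 - x\<close> does not show that symmetry. It is derived from a relation that
  moves the increment from the second parameter to the first.\<close>

lemma jacobi_coeff_raise_fst:
  "jacobi_coeff (Suc n) (\<alpha> + 1) \<beta> l
    = jacobi_coeff (Suc n) \<alpha> \<beta> l + jacobi_coeff n (\<alpha> + 1) (\<beta> + 1) l
      - (case l of 0 \<Rightarrow> 0 | Suc k \<Rightarrow> jacobi_coeff n (\<alpha> + 1) (\<beta> + 1) k)"
proof -
  have "jacobi_coeff (Suc n) (\<alpha> + 1) \<beta> l
    = jacobi_coeff (Suc n) \<alpha> (\<beta> + 1) l + jacobi_coeff n (\<alpha> + 1) (\<beta> + 1) l"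
  proof (cases "l \<le> n")
    case True
    define x where "x = of_nat n + \<alpha> + \<beta> + 3"
    define y where "y = \<alpha> + 1 + of_nat l"
    have arg: "of_nat (Suc n) + (\<alpha> + 1) + \<beta> + 1 = x" "of_nat (Suc n) + \<alpha> + (\<beta> + 1) + 1 = x"
      "of_nat n + (\<alpha> + 1) + (\<beta> + 1) + 1 = x" "\<alpha> + 1 + 1 + of_nat l = y + 1" "\<alpha> + 1 + of_nat l = y"
      by (simp_all add: x_def y_def)
    define r where "r = (-1) ^ l * pochhammer x l * pochhammer (y + 1) (n - l) / (fact l * fact (n - l))"
    have "jacobi_coeff (Suc n) (\<alpha> + 1) \<beta> l = r * (y + of_nat (Suc (n - l))) / of_nat (Suc (n - l))"
      unfolding jacobi_coeff_def arg r_def Suc_diff_le[OF True] pochhammer_Suc using True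
      by (simp add: field_simps del: of_nat_Suc) (simp add: of_nat_diff algebra_simps)
    note eq1 = this
    have eq2: "jacobi_coeff (Suc n) \<alpha> (\<beta> + 1) l = r * y / of_nat (Suc (n - l))"
      unfolding jacobi_coeff_def arg r_def Suc_diff_le[OF True] pochhammer_rec using True
      by (simp add: field_simps del: of_nat_Suc)
    have eq3: "jacobi_coeff n (\<alpha> + 1) (\<beta> + 1) l = r"
      unfolding jacobi_coeff_def arg r_def using True by simp
    show ?thesis
      unfolding eq1 eq2 eq3 by (simp add: field_simps del: of_nat_Suc)
  next
    case False
    then show ?thesis
      by (cases "l = Suc n") (simp_all add: jacobi_coeff_def add_ac)
  qed
  then show ?thesis
    by (simp add: jacobi_coeff_raise_snd)
qed

lemma jacobi_coeff_Suc:
  "of_nat (Suc n) * jacobi_coeff (Suc n) \<alpha> \<beta> l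
    = (of_nat n + \<alpha> + 1) * jacobi_coeff n \<alpha> (\<beta> + 1) l
      - (of_nat n + \<alpha> + \<beta> + 2) * (case l of 0 \<Rightarrow> 0 | Suc k \<Rightarrow> jacobi_coeff n (\<alpha> + 1) (\<beta> + 1) k)"
proof (cases l)
  case 0
  show ?thesis
    by (simp add: jacobi_coeff_def 0 pochhammer_Suc field_simps del: of_nat_Suc)
next
  case (Suc k)
  define x where "x = of_nat n + \<alpha> + \<beta> + 2"
  define y where "y = \<alpha> + 1 + of_nat (Suc k)"
  have arg: "of_nat (Suc n) + \<alpha> + \<beta> + 1 = x" "of_nat n + \<alpha> + (\<beta> + 1) + 1 = x"
    "of_nat n + (\<alpha> + 1) + (\<beta> + 1) + 1 = x + 1" "\<alpha> + 1 + 1 + of_nat k = y" "\<alpha> + 1 + of_nat (Suc k) = y"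
    by (simp_all add: x_def y_def)
  show ?thesis
  proof (cases "k < n")
    case True
    then obtain d where d: "n = Suc (k + d)"
      using less_imp_Suc_add by blast
    have diffs: "Suc n - Suc k = Suc d" "n - Suc k = d" "n - k = Suc d"
      by (simp_all add: d)
    define r where "r = (-1) ^ k * x * pochhammer (x + 1) k * pochhammer y d / (fact k * fact d)"
    have y: "of_nat n + \<alpha> + 1 = y + of_nat d"
      by (simp add: y_def d)
    have eq1: "jacobi_coeff (Suc n) \<alpha> \<beta> (Suc k) = - r * (y + of_nat d) / (of_nat (Suc k) * of_nat (Suc d))"
      unfolding jacobi_coeff_def arg r_def diffs pochhammer_rec[of x] pochhammer_Suc[of y] using True
      by (simp add: field_simps del: of_nat_Suc)
    have eq2: "jacobi_coeff n \<alpha> (\<beta> + 1) (Suc k) = - r / of_nat (Suc k)"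
      unfolding jacobi_coeff_def arg r_def diffs pochhammer_rec[of x] using True
      by (simp add: field_simps del: of_nat_Suc)
    have eq3: "x * jacobi_coeff n (\<alpha> + 1) (\<beta> + 1) k = r * (y + of_nat d) / of_nat (Suc d)"
      unfolding jacobi_coeff_def arg r_def diffs pochhammer_Suc using True
      by (simp add: field_simps del: of_nat_Suc)
    have eq4: "of_nat (Suc n) = of_nat (Suc k) + (of_nat (Suc d) :: complex)"
      by (simp add: d)
    show ?thesis
      unfolding Suc nat.case y x_def[symmetric] eq1 eq2 eq3 eq4
      by (simp add: divide_simps del: of_nat_Suc) (simp add: algebra_simps)
  next
    case False
    show ?thesis
    proof (cases "k = n")
      case True
      have "x * jacobi_coeff n (\<alpha> + 1) (\<beta> + 1) n = (-1) ^ n * pochhammer x (Suc n) / fact n"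
        unfolding jacobi_coeff_def arg pochhammer_rec[of x] by simp
      moreover have "of_nat (Suc n) * jacobi_coeff (Suc n) \<alpha> \<beta> (Suc n)
        = - ((-1) ^ n * pochhammer x (Suc n) / fact n)"
        unfolding jacobi_coeff_def arg by (simp add: field_simps del: of_nat_Suc)
      ultimately show ?thesis
        unfolding Suc True x_def[symmetric] by (simp add: jacobi_coeff_def)
    qed (use False in \<open>simp add: Suc jacobi_coeff_def\<close>)
  qed
qed

lemma jacobi_raise_snd:
  "jacobi (Suc n) \<alpha> (\<beta> + 1) = jacobi (Suc n) \<alpha> \<beta> - [:1/2, -1/2:] * jacobi n (\<alpha> + 1) (\<beta> + 1)"
  unfolding mult_jacobi_eq_sum[OF order_refl] jacobi_eq_sum[OF order_refl, of "Suc n"]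
    sum_subtractf[symmetric] smult_diff_left[symmetric] jacobi_coeff_raise_snd ..

lemma jacobi_raise_fst:
  "jacobi (Suc n) (\<alpha> + 1) \<beta> = jacobi (Suc n) \<alpha> \<beta> + [:1/2, 1/2:] * jacobi n (\<alpha> + 1) (\<beta> + 1)"
proof -
  have "jacobi (Suc n) (\<alpha> + 1) \<beta>
    = jacobi (Suc n) \<alpha> \<beta> + jacobi n (\<alpha> + 1) (\<beta> + 1) - [:1/2, -1/2:] * jacobi n (\<alpha> + 1) (\<beta> + 1)"
    unfolding mult_jacobi_eq_sum[OF order_refl]
    unfolding jacobi_eq_sum[OF order_refl, of "Suc n"]
      jacobi_eq_sum[OF le_SucI[OF order_refl], of n] sum_subtractf[symmetric] sum.distrib[symmetric]
      smult_diff_left[symmetric] smult_add_left[symmetric] jacobi_coeff_raise_fst ..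
  moreover have "[:1/2, 1/2:] = 1 - [:1/2, -1/2 :: complex:]"
    by (simp add: one_pCons)
  ultimately show ?thesis by (simp only: left_diff_distrib mult_1_left) simp
qed

lemma jacobi_raise_both:
  "smult (of_nat n + \<alpha> + \<beta> + 2) (jacobi n (\<alpha> + 1) (\<beta> + 1))
    = smult (of_nat n + \<alpha> + 1) (jacobi n \<alpha> (\<beta> + 1)) + smult (of_nat n + \<beta> + 1) (jacobi n (\<alpha> + 1) \<beta>)"
  unfolding jacobi_eq_sum[OF order_refl] smult_sum_right smult_smult sum.distrib[symmetric]
    smult_add_left[symmetric] jacobi_coeff_raise_both ..

lemma jacobi_Suc:
  "smult (of_nat (Suc n)) (jacobi (Suc n) \<alpha> \<beta>)
    = smult (of_nat n + \<alpha> + 1) (jacobi n \<alpha> (\<beta> + 1))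
      - smult (of_nat n + \<alpha> + \<beta> + 2) ([:1/2, -1/2:] * jacobi n (\<alpha> + 1) (\<beta> + 1))"
  unfolding mult_jacobi_eq_sum[OF order_refl]
  unfolding jacobi_eq_sum[OF order_refl, of "Suc n"]
    jacobi_eq_sum[OF le_SucI[OF order_refl], of n] smult_sum_right smult_smult sum_subtractf[symmetric]
    smult_diff_left[symmetric] jacobi_coeff_Suc ..

section \<open>Symmetric and antisymmetric parts of the two-term recursion\<close>

lemma homogenize_add: "homogenize n (p + q) = homogenize n p + homogenize n q"
  by (simp add: homogenize_def scal_bconst bconst_add sum.distrib distrib_right)

lemma homogenize_smult: "homogenize n (smult c p) = bconst c * homogenize n p"
  by (simp add: homogenize_def scal_bconst bconst_mult sum_distrib_left mult.assoc)

lemma homogenize_diff: "homogenize n (p - q) = homogenize n p - homogenize n q"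
proof -
  have "p - q = p + smult (-1) q" by simp
  then show ?thesis
    by (simp only: homogenize_add homogenize_smult) (simp add: bconst_minus)
qed

lemma homogenize_Suc:
  assumes "degree p \<le> n"
  shows "homogenize (Suc n) p = Z * Zb * homogenize n p"
proof -
  have "coeff p (Suc n) = 0" using assms by (intro coeff_eq_0) simp
  then show ?thesis
    unfolding homogenize_def sum_distrib_left sum.atMost_Suc
    by (simp add: scal_bconst) (intro sum.cong, auto simp: Suc_diff_le mult_ac)
qed

lemma homogenize_pCons_0:
  "homogenize (Suc n) (pCons 0 p) = bconst (1/2) * (Z^2 + Zb^2) * homogenize n p"
  unfolding homogenize_def sum_distrib_left
  by (subst sum.atMost_Suc_shift) (simp add: scal_bconst mult_ac)

lemma homogenize_linear_mult:
  assumes "degree p \<le> n"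
  shows "homogenize (Suc n) ([:c, d:] * p)
    = (bconst c * (Z * Zb) + bconst d * bconst (1/2) * (Z^2 + Zb^2)) * homogenize n p"
proof -
  have "[:c, d:] * p = smult c p + smult d (pCons 0 p)" by simp
  then show ?thesis
    by (simp only: homogenize_add homogenize_smult homogenize_Suc[OF assms] homogenize_pCons_0)
      (simp add: algebra_simps)
qed

text \<open>Ring normalisation treats \<open>bconst (1/2)\<close> as an atom; splitting a half into
  two quarters lets it recognise the squares below.\<close>

lemma half_eq: "bconst (1/2) * f = bconst (1/2) * (bconst (1/2) * f) + bconst (1/2) * (bconst (1/2) * f)"
proof -
  have "bconst (1/2) = bconst (1/2) * bconst (1/2) + bconst (1/2) * bconst (1/2)"
    by (simp flip: bconst_mult bconst_add)
  then show ?thesis by (metis distrib_right mult.assoc)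
qed

text \<open>Homogenised, \<open>(1 - x)/2\<close> becomes \<open>-(z - zbar)^2 / 4\<close> and
  \<open>(1 + x)/2\<close> becomes \<open>(z + zbar)^2 / 4\<close>. These squares pair with the
  factors \<open>z - zbar\<close> and \<open>z + zbar\<close> in the definitions of
  \<open>f0\<close> and \<open>f1\<close>.\<close>

lemma homogenize_minus_factor:
  assumes "degree p \<le> n"
  shows "homogenize (Suc n) ([:1/2, -1/2:] * p) = - (bconst (1/2) ^ 2 * (Z - Zb) ^ 2) * homogenize n p"
proof -
  have "bconst (- 1/2) = - bconst (1/2)" by (simp flip: bconst_minus)
  moreover have "bconst (1/2) * (Z * Zb) - bconst (1/2) * bconst (1/2) * (Z^2 + Zb^2)
    = - (bconst (1/2) ^ 2 * (Z - Zb) ^ 2)"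
    by (subst half_eq) (simp add: algebra_simps power2_eq_square)
  ultimately show ?thesis
    unfolding homogenize_linear_mult[OF assms] by (simp del: bconst_eq_0_iff)
qed

lemma homogenize_plus_factor:
  assumes "degree p \<le> n"
  shows "homogenize (Suc n) ([:1/2, 1/2:] * p) = bconst (1/2) ^ 2 * (Z + Zb) ^ 2 * homogenize n p"
proof -
  have "bconst (1/2) * (Z * Zb) + bconst (1/2) * bconst (1/2) * (Z^2 + Zb^2)
    = bconst (1/2) ^ 2 * (Z + Zb) ^ 2"
    by (subst half_eq) (simp add: algebra_simps power2_eq_square)
  then show ?thesis
    unfolding homogenize_linear_mult[OF assms] by simp
qed

lemma swap_homogenize [simp]: "swap (homogenize n p) = homogenize n p"
  by (simp add: homogenize_def swap_sum swap_hom add.commute mult.commute)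

text \<open>\<open>szp\<close> and \<open>szq\<close> are \<open>a\<^sub>m + b\<^sub>m\<close> and \<open>a\<^sub>m - b\<^sub>m\<close> for the coefficients of the two-term recursion
  \<open>ff_Suc\<close>; the recursion decouples into these for the symmetric and antisymmetric parts.\<close>

definition szp :: "complex \<Rightarrow> complex \<Rightarrow> nat \<Rightarrow> complex" where
  "szp \<kappa>0 \<kappa>1 m = (if even m then of_nat (m div 2) + \<kappa>0 + 1/2 else 1 / of_nat (m div 2 + 1))"

definition szq :: "complex \<Rightarrow> complex \<Rightarrow> nat \<Rightarrow> complex" where
  "szq \<kappa>0 \<kappa>1 m = (if even m then of_nat (m div 2) + \<kappa>1 + 1/2
     else 1 / (of_nat (m div 2) + \<kappa>0 + \<kappa>1 + 1))"

lemma even_oddE: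
  fixes m :: nat
  obtains "m = 0" | n where "m = Suc (Suc (2 * n))" | n where "m = Suc (2 * n)"
proof (cases "even m")
  case True
  then obtain k where "m = 2 * k" by (elim evenE)
  then show ?thesis using that(1,2) by (cases k) auto
next
  case False
  then show ?thesis using that(3) by (auto elim!: oddE)
qed

lemma f0_even: "f0 \<kappa>0 \<kappa>1 (2 * n) = homogenize n (jacobi n (\<kappa>0 - 1/2) (\<kappa>1 - 1/2))"
  by (simp add: f0_def)

lemma f0_odd: "f0 \<kappa>0 \<kappa>1 (Suc (2 * n)) = bconst (of_nat n + \<kappa>0 + 1/2)
    * (bconst (1/2) * (Z + Zb) * homogenize n (jacobi n (\<kappa>0 - 1/2) (\<kappa>1 + 1/2)))"
  by (simp add: f0_def scal_bconst)

lemma f1_0: "f1 \<kappa>0 \<kappa>1 0 = 0"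
  by (simp add: f1_def)

lemma f1_even: "f1 \<kappa>0 \<kappa>1 (Suc (Suc (2 * n)))
    = bconst (1/2) ^ 2 * (Z^2 - Zb^2) * homogenize n (jacobi n (\<kappa>0 + 1/2) (\<kappa>1 + 1/2))"
  by (simp add: f1_def scal_bconst power2_eq_square flip: bconst_mult)

lemma f1_odd: "f1 \<kappa>0 \<kappa>1 (Suc (2 * n)) = bconst (of_nat n + \<kappa>1 + 1/2)
    * (bconst (1/2) * (Z - Zb) * homogenize n (jacobi n (\<kappa>0 + 1/2) (\<kappa>1 - 1/2)))"
  by (simp add: f1_def scal_bconst)

lemma szp_even: "szp \<kappa>0 \<kappa>1 (Suc (Suc (2 * n))) = of_nat (Suc n) + \<kappa>0 + 1/2"
  and szp_odd: "szp \<kappa>0 \<kappa>1 (Suc (2 * n)) = 1 / of_nat (Suc n)"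
  and szq_even: "szq \<kappa>0 \<kappa>1 (Suc (Suc (2 * n))) = of_nat (Suc n) + \<kappa>1 + 1/2"
  and szq_odd: "szq \<kappa>0 \<kappa>1 (Suc (2 * n)) = 1 / (of_nat n + \<kappa>0 + \<kappa>1 + 1)"
  by (simp_all add: szp_def szq_def)

text \<open>From even to odd degree this is \<open>jacobi_raise_snd\<close>, with
  \<open>z^2 - zbar^2\<close> factored. From odd to even degree it is \<open>jacobi_Suc\<close>; the
  scalar prefactors of the odd polynomials are those of the contiguous relations.\<close>

lemma f0_Suc:
  "f0 \<kappa>0 \<kappa>1 (Suc m) = bconst (szp \<kappa>0 \<kappa>1 m) * bconst (1/2)
     * ((Z + Zb) * f0 \<kappa>0 \<kappa>1 m + (Z - Zb) * f1 \<kappa>0 \<kappa>1 m)"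
proof -
  define \<alpha> \<beta> where "\<alpha> = \<kappa>0 - 1/2" and "\<beta> = \<kappa>1 - 1/2"
  have raise: "\<kappa>0 + 1/2 = \<alpha> + 1" "\<kappa>1 + 1/2 = \<beta> + 1"
    by (simp_all add: \<alpha>_def \<beta>_def)
  show ?thesis
  proof (cases m rule: even_oddE)
    case 1
    show ?thesis
      using f0_odd[of \<kappa>0 \<kappa>1 0] f0_even[of \<kappa>0 \<kappa>1 0]
      by (simp add: 1 f1_0 szp_def homogenize_def scal_bconst mult_ac)
  next
    case (2 n)
    define c where "c = bconst (of_nat (Suc n) + \<kappa>0 + 1/2)"
    define h where "h = bconst (1/2)"
    define P where "P = homogenize (Suc n) (jacobi (Suc n) \<alpha> \<beta>)"
    define Q where "Q = homogenize n (jacobi n (\<alpha> + 1) (\<beta> + 1))"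
    have "homogenize (Suc n) (jacobi (Suc n) \<alpha> (\<beta> + 1)) = P + h ^ 2 * (Z - Zb) ^ 2 * Q"
      unfolding jacobi_raise_snd homogenize_diff homogenize_minus_factor[OF degree_jacobi]
      by (simp add: P_def Q_def h_def)
    then have "f0 \<kappa>0 \<kappa>1 (Suc m) = c * (h * (Z + Zb) * (P + h ^ 2 * (Z - Zb) ^ 2 * Q))"
      using f0_odd[of \<kappa>0 \<kappa>1 "Suc n"] by (simp add: 2 raise c_def h_def flip: \<alpha>_def)
    moreover have "f0 \<kappa>0 \<kappa>1 m = P"
      using f0_even[of \<kappa>0 \<kappa>1 "Suc n"] by (simp add: 2 P_def \<alpha>_def \<beta>_def)
    moreover have "f1 \<kappa>0 \<kappa>1 m = h ^ 2 * (Z^2 - Zb^2) * Q"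
      unfolding 2 f1_even raise Q_def h_def ..
    moreover have "bconst (szp \<kappa>0 \<kappa>1 m) = c"
      unfolding 2 szp_even c_def ..
    ultimately show ?thesis
      unfolding h_def[symmetric] by (simp only:) (simp add: algebra_simps power2_eq_square)
  next
    case (3 n)
    define h where "h = bconst (1/2)"
    define A where "A = homogenize n (smult (of_nat n + \<alpha> + 1) (jacobi n \<alpha> (\<beta> + 1)))"
    define B where "B = homogenize n (smult (of_nat n + \<beta> + 1) (jacobi n (\<alpha> + 1) \<beta>))"
    \<comment> \<open>\<open>jacobi_raise_both\<close> eliminates the polynomial with both
      parameters raised, leaving only the two that occur in degree \<open>m\<close>.\<close>
    have "smult (of_nat (Suc n)) (jacobi (Suc n) \<alpha> \<beta>)
      = [:1/2, 1/2:] * smult (of_nat n + \<alpha> + 1) (jacobi n \<alpha> (\<beta> + 1))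
        - [:1/2, -1/2:] * smult (of_nat n + \<beta> + 1) (jacobi n (\<alpha> + 1) \<beta>)"
    proof -
      have "[:1/2, 1/2:] = 1 - [:1/2, -1/2 :: complex:]"
        by (simp add: one_pCons)
      then show ?thesis
        unfolding jacobi_Suc mult_smult_right[symmetric] jacobi_raise_both
        by (simp only: left_diff_distrib mult_1_left distrib_left) simp
    qed
    moreover have "degree (smult c (jacobi n \<alpha>' \<beta>')) \<le> n" for c \<alpha>' \<beta>'
      by (rule order.trans[OF degree_smult_le degree_jacobi])
    ultimately have "homogenize (Suc n) (smult (of_nat (Suc n)) (jacobi (Suc n) \<alpha> \<beta>))
      = h ^ 2 * (Z + Zb) ^ 2 * A + h ^ 2 * (Z - Zb) ^ 2 * B"
      by (simp only: homogenize_diff homogenize_plus_factor homogenize_minus_factor A_def B_def h_def) simp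
    moreover have "f0 \<kappa>0 \<kappa>1 (Suc m) = homogenize (Suc n) (jacobi (Suc n) \<alpha> \<beta>)"
      using f0_even[of \<kappa>0 \<kappa>1 "Suc n"] by (simp add: 3 \<alpha>_def \<beta>_def)
    ultimately have scaled: "bconst (of_nat (Suc n)) * f0 \<kappa>0 \<kappa>1 (Suc m)
      = h ^ 2 * (Z + Zb) ^ 2 * A + h ^ 2 * (Z - Zb) ^ 2 * B"
      by (simp only: homogenize_smult)
    have e0: "f0 \<kappa>0 \<kappa>1 m = h * (Z + Zb) * A"
      unfolding 3 f0_odd A_def homogenize_smult h_def add.assoc raise by (simp add: \<alpha>_def mult_ac)
    have e1: "f1 \<kappa>0 \<kappa>1 m = h * (Z - Zb) * B"
      unfolding 3 f1_odd B_def homogenize_smult h_def add.assoc raise by (simp add: \<beta>_def mult_ac)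
    have inv: "bconst (szp \<kappa>0 \<kappa>1 m) * bconst (of_nat (Suc n)) = 1"
      unfolding 3 szp_odd bconst_mult[symmetric] by (simp del: of_nat_Suc)
    have "f0 \<kappa>0 \<kappa>1 (Suc m)
      = bconst (szp \<kappa>0 \<kappa>1 m) * (bconst (of_nat (Suc n)) * f0 \<kappa>0 \<kappa>1 (Suc m))"
      unfolding mult.assoc[symmetric] inv by simp
    then show ?thesis
      unfolding scaled e0 e1 h_def[symmetric] by (simp add: algebra_simps power2_eq_square)
  qed
qed

text \<open>The assumption allows division by the factor on the left of
  \<open>jacobi_raise_both\<close>, whose value here is
  \<open>n + \<kappa>0 + \<kappa>1 + 1\<close>, in the step from odd to even degree.\<close>

lemma f1_Suc:
  assumes "\<And>n. of_nat n + \<kappa>0 + \<kappa>1 + 1 \<noteq> 0"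
  shows "f1 \<kappa>0 \<kappa>1 (Suc m) = bconst (szq \<kappa>0 \<kappa>1 m) * bconst (1/2)
     * ((Z - Zb) * f0 \<kappa>0 \<kappa>1 m + (Z + Zb) * f1 \<kappa>0 \<kappa>1 m)"
proof -
  define \<alpha> \<beta> where "\<alpha> = \<kappa>0 - 1/2" and "\<beta> = \<kappa>1 - 1/2"
  have raise: "\<kappa>0 + 1/2 = \<alpha> + 1" "\<kappa>1 + 1/2 = \<beta> + 1"
    by (simp_all add: \<alpha>_def \<beta>_def)
  show ?thesis
  proof (cases m rule: even_oddE)
    case 1
    show ?thesis
      using f1_odd[of \<kappa>0 \<kappa>1 0] f0_even[of \<kappa>0 \<kappa>1 0]
      by (simp add: 1 f1_0 szq_def homogenize_def scal_bconst mult_ac)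
  next
    case (2 n)
    define c where "c = bconst (of_nat (Suc n) + \<kappa>1 + 1/2)"
    define h where "h = bconst (1/2)"
    define P where "P = homogenize (Suc n) (jacobi (Suc n) \<alpha> \<beta>)"
    define Q where "Q = homogenize n (jacobi n (\<alpha> + 1) (\<beta> + 1))"
    have "homogenize (Suc n) (jacobi (Suc n) (\<alpha> + 1) \<beta>) = P + h ^ 2 * (Z + Zb) ^ 2 * Q"
      unfolding jacobi_raise_fst homogenize_add homogenize_plus_factor[OF degree_jacobi]
      by (simp add: P_def Q_def h_def)
    then have "f1 \<kappa>0 \<kappa>1 (Suc m) = c * (h * (Z - Zb) * (P + h ^ 2 * (Z + Zb) ^ 2 * Q))"
      using f1_odd[of \<kappa>0 \<kappa>1 "Suc n"] by (simp add: 2 raise c_def h_def flip: \<beta>_def)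
    moreover have "f0 \<kappa>0 \<kappa>1 m = P"
      using f0_even[of \<kappa>0 \<kappa>1 "Suc n"] by (simp add: 2 P_def \<alpha>_def \<beta>_def)
    moreover have "f1 \<kappa>0 \<kappa>1 m = h ^ 2 * (Z^2 - Zb^2) * Q"
      unfolding 2 f1_even raise Q_def h_def ..
    moreover have "bconst (szq \<kappa>0 \<kappa>1 m) = c"
      unfolding 2 szq_even c_def ..
    ultimately show ?thesis
      unfolding h_def[symmetric] by (simp only:) (simp add: algebra_simps power2_eq_square)
  next
    case (3 n)
    define h where "h = bconst (1/2)"
    define A where "A = homogenize n (smult (of_nat n + \<alpha> + 1) (jacobi n \<alpha> (\<beta> + 1)))"
    define B where "B = homogenize n (smult (of_nat n + \<beta> + 1) (jacobi n (\<alpha> + 1) \<beta>))"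
    have sum: "bconst (of_nat n + \<alpha> + \<beta> + 2) * homogenize n (jacobi n (\<alpha> + 1) (\<beta> + 1)) = A + B"
      using arg_cong[OF jacobi_raise_both, of "homogenize n" n \<alpha> \<beta>]
      by (simp only: A_def B_def homogenize_add homogenize_smult)
    have arg: "of_nat n + \<alpha> + \<beta> + 2 = of_nat n + \<kappa>0 + \<kappa>1 + 1"
      by (simp add: \<alpha>_def \<beta>_def)
    have f1: "f1 \<kappa>0 \<kappa>1 (Suc m)
      = h ^ 2 * (Z^2 - Zb^2) * homogenize n (jacobi n (\<alpha> + 1) (\<beta> + 1))"
      unfolding 3 f1_even raise h_def ..
    have scaled: "bconst (of_nat n + \<kappa>0 + \<kappa>1 + 1) * f1 \<kappa>0 \<kappa>1 (Suc m)
      = h ^ 2 * (Z^2 - Zb^2) * (A + B)"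
      unfolding f1 sum[symmetric] arg by (simp only: mult_ac)
    have e0: "f0 \<kappa>0 \<kappa>1 m = h * (Z + Zb) * A"
      unfolding 3 f0_odd A_def homogenize_smult h_def add.assoc raise by (simp add: \<alpha>_def mult_ac)
    have e1: "f1 \<kappa>0 \<kappa>1 m = h * (Z - Zb) * B"
      unfolding 3 f1_odd B_def homogenize_smult h_def add.assoc raise by (simp add: \<beta>_def mult_ac)
    have inv: "bconst (szq \<kappa>0 \<kappa>1 m) * bconst (of_nat n + \<kappa>0 + \<kappa>1 + 1) = 1"
      unfolding 3 szq_odd bconst_mult[symmetric] using assms[of n] by simp
    have "f1 \<kappa>0 \<kappa>1 (Suc m)
      = bconst (szq \<kappa>0 \<kappa>1 m) * (bconst (of_nat n + \<kappa>0 + \<kappa>1 + 1) * f1 \<kappa>0 \<kappa>1 (Suc m))"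
      unfolding mult.assoc[symmetric] inv by simp
    then show ?thesis
      unfolding scaled e0 e1 h_def[symmetric] by (simp add: algebra_simps power2_eq_square)
  qed
qed

lemma swap_f0: "swap (f0 \<kappa>0 \<kappa>1 m) = f0 \<kappa>0 \<kappa>1 m"
proof (cases "even m")
  case True
  then show ?thesis by (auto elim!: evenE simp: f0_even)
next
  case False
  then obtain n where "m = Suc (2 * n)" by (auto elim!: oddE)
  then show ?thesis by (simp only: f0_odd swap_hom swap_bconst swap_Z swap_Zb swap_homogenize add.commute)
qed

lemma swap_f1: "swap (f1 \<kappa>0 \<kappa>1 m) = - f1 \<kappa>0 \<kappa>1 m"
proof (cases m rule: even_oddE)
  case (2 n)
  show ?thesis
    unfolding 2 f1_even by (simp only: swap_hom swap_bconst swap_Z swap_Zb swap_homogenize)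
      (simp add: algebra_simps)
next
  case (3 n)
  show ?thesis
    unfolding 3 f1_odd by (simp only: swap_hom swap_bconst swap_Z swap_Zb swap_homogenize)
      (simp add: algebra_simps)
qed (simp add: f1_0)

section \<open>Dunkl operators on the harmonic polynomials\<close>

lemma refl_class_mult: "refl_class s m f \<Longrightarrow> refl_class s n g \<Longrightarrow> refl_class s (m + n) (f * g)"
  unfolding refl_class_def by (simp add: reflect_mult swap_mult distrib_left power_add bconst_mult)

lemma refl_class_add: "refl_class s m f \<Longrightarrow> refl_class s m g \<Longrightarrow> refl_class s m (f + g)"
  unfolding refl_class_def by (simp add: reflect_add swap_add distrib_left)

lemma refl_class_bconst: "refl_class s 0 (bconst c)"
  unfolding refl_class_def by simp

text \<open>Reflections are involutions and the sign squares to 1, so the defining relation can be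
  solved for the reflection of \<open>swap f\<close>.\<close>

lemma refl_class_swap:
  assumes "refl_class s m f"
  shows "refl_class s m (swap f)"
  unfolding refl_class_def
proof
  fix k
  have "reflect (omega s ^ k) (bconst ((-1) ^ (k * m)) * swap f)
    = reflect (omega s ^ k) (reflect (omega s ^ k) f)"
    using assms by (simp add: refl_class_def)
  also have "reflect \<eta> (reflect \<eta> f) = f" if "\<eta> \<noteq> 0" for \<eta>
    using that by (induction f rule: bipoly_induct)
      (simp_all add: reflect_add reflect_mult flip: mult.assoc bconst_mult)
  finally have "bconst ((-1) ^ (k * m)) * reflect (omega s ^ k) (swap f) = f"
    by (simp add: reflect_mult)
  then have "bconst ((-1) ^ (k * m)) * (bconst ((-1) ^ (k * m)) * reflect (omega s ^ k) (swap f))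
    = bconst ((-1) ^ (k * m)) * f" by simp
  then show "reflect (omega s ^ k) (swap f) = bconst ((-1) ^ (k * m)) * swap (swap f)"
    by (simp flip: mult.assoc bconst_mult power_mult_distrib)
qed

lemma refl_class_Z_power:
  assumes "s \<ge> 1"
  shows "refl_class s 1 (Z ^ s)"
proof -
  have "(omega s ^ k) ^ s = (-1) ^ k" for k
    using omega_power_s[OF assms] by (metis mult.commute power_mult)
  then show ?thesis
    unfolding refl_class_def
    by (simp add: reflect_power swap_power power_mult_distrib flip: bconst_power)
qed

definition sza :: "complex \<Rightarrow> complex \<Rightarrow> nat \<Rightarrow> complex" where
  "sza \<kappa>0 \<kappa>1 m = (szp \<kappa>0 \<kappa>1 m + szq \<kappa>0 \<kappa>1 m) / 2"

definition szb :: "complex \<Rightarrow> complex \<Rightarrow> nat \<Rightarrow> complex" where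
  "szb \<kappa>0 \<kappa>1 m = (szp \<kappa>0 \<kappa>1 m - szq \<kappa>0 \<kappa>1 m) / 2"

text \<open>For positive index this is \<open>a - b^2 / a\<close>, the factor that appears when the
  two-term recursion is inverted; compare \<open>1 - |\<alpha>|^2\<close> for monic orthogonal
  polynomials on the circle. The value 0 at index 0 removes terms that would refer to index
  \<open>-1\<close>.\<close>

definition szt :: "complex \<Rightarrow> complex \<Rightarrow> nat \<Rightarrow> complex" where
  "szt \<kappa>0 \<kappa>1 m = (case m of 0 \<Rightarrow> 0
     | Suc k \<Rightarrow> szp \<kappa>0 \<kappa>1 k * szq \<kappa>0 \<kappa>1 k / sza \<kappa>0 \<kappa>1 k)"

definition fall :: "complex \<Rightarrow> nat \<Rightarrow> complex" where
  "fall x i = (\<Prod>l<i. x - of_nat l)"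

lemma fall_0 [simp]: "fall x 0 = 1" and fall_Suc: "fall x (Suc i) = fall x i * (x - of_nat i)"
  by (simp_all add: fall_def)

lemma fall_of_nat_eq_0: "n < i \<Longrightarrow> fall (of_nat n) i = 0"
  by (auto simp: fall_def)

text \<open>Truncated subtraction is harmless: once \<open>i\<close> exceeds \<open>n\<close>, the
  falling factorial already contains the factor 0.\<close>

lemma fall_of_nat_mult: "fall (of_nat n) i * (of_nat n - of_nat i) = fall (of_nat n) i * of_nat (n - i)"
  by (cases "i \<le> n") (auto simp: of_nat_diff fall_of_nat_eq_0)

lemma fall_of_nat_fact: "i \<le> n \<Longrightarrow> fall (of_nat n) i * fact (n - i) = fact n"
proof (induction i)
  case (Suc i)
  then obtain k where "n = Suc (i + k)" using less_imp_Suc_add[of i n] by auto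
  then show ?case using Suc by (simp add: fall_Suc mult_ac Suc_diff_le)
qed simp

lemma fall_pochhammer:
  "i \<le> n \<Longrightarrow> fall (x + of_nat n) i * pochhammer (x + 1) (n - i) = pochhammer (x + 1) n"
proof (induction i)
  case (Suc i)
  then obtain k where "n = Suc (i + k)" using less_imp_Suc_add[of i n] by auto
  then show ?case using Suc by (simp add: fall_Suc pochhammer_Suc Suc_diff_le algebra_simps)
qed simp

locale nonsingular = dihedral +
  assumes \<kappa>0: "\<forall>m::nat. m \<ge> 1 \<longrightarrow> - \<kappa>0 + 1/2 \<noteq> of_nat m"
    and \<kappa>1: "\<forall>m::nat. m \<ge> 1 \<longrightarrow> - \<kappa>1 + 1/2 \<noteq> of_nat m"
    and \<kappa>01: "\<forall>m::nat. m \<ge> 1 \<longrightarrow> - of_nat s * (\<kappa>0 + \<kappa>1) \<noteq> of_nat m"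
begin

abbreviation "p \<equiv> szp \<kappa>0 \<kappa>1"
abbreviation "q \<equiv> szq \<kappa>0 \<kappa>1"
abbreviation "sa \<equiv> sza \<kappa>0 \<kappa>1"
abbreviation "sb \<equiv> szb \<kappa>0 \<kappa>1"
abbreviation "st \<equiv> szt \<kappa>0 \<kappa>1"

definition \<gamma> :: complex where "\<gamma> = of_nat s * (\<kappa>0 + \<kappa>1)"

lemma \<kappa>0_neq: "of_nat n + \<kappa>0 + 1/2 \<noteq> 0" and \<kappa>1_neq: "of_nat n + \<kappa>1 + 1/2 \<noteq> 0"
proof -
  have "of_nat n + \<kappa> + 1/2 \<noteq> 0" if "\<forall>m::nat. m \<ge> 1 \<longrightarrow> - \<kappa> + 1/2 \<noteq> of_nat m" for \<kappa> :: complex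
  proof
    assume *: "of_nat n + \<kappa> + 1/2 = 0"
    have "- \<kappa> + 1/2 = of_nat (Suc n) - (of_nat n + \<kappa> + 1/2)" by (simp add: algebra_simps)
    with * have "- \<kappa> + 1/2 = of_nat (Suc n)" by simp
    moreover have "- \<kappa> + 1/2 \<noteq> of_nat (Suc n)" using that by force
    ultimately show False by contradiction
  qed
  then show "of_nat n + \<kappa>0 + 1/2 \<noteq> 0" "of_nat n + \<kappa>1 + 1/2 \<noteq> 0"
    using \<kappa>0 \<kappa>1 by blast+
qed

lemma \<gamma>_neq: "n \<ge> 1 \<Longrightarrow> \<gamma> + of_nat n \<noteq> 0"
  using \<kappa>01 by (auto simp: \<gamma>_def add_eq_0_iff)

lemma \<kappa>01_neq: "n \<ge> 1 \<Longrightarrow> \<kappa>0 + \<kappa>1 + of_nat n \<noteq> 0"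
proof
  assume "n \<ge> 1" "\<kappa>0 + \<kappa>1 + of_nat n = 0"
  then have "\<gamma> + of_nat (s * n) = 0"
    by (simp add: \<gamma>_def flip: distrib_left)
  with \<gamma>_neq[of "s * n"] \<open>n \<ge> 1\<close> s_pos show False by simp
qed

lemma pochhammer_\<gamma>_neq_0 [simp]: "pochhammer (\<gamma> + 1) n \<noteq> 0"
proof
  assume "pochhammer (\<gamma> + 1) n = 0"
  then obtain k where "\<gamma> + 1 = - of_nat k"
    by (auto simp: pochhammer_eq_0_iff)
  moreover have "\<gamma> + of_nat (Suc k) = (\<gamma> + 1) + of_nat k" by simp
  ultimately have "\<gamma> + of_nat (Suc k) = 0" by simp
  with \<gamma>_neq[of "Suc k"] show False by simp
qed

lemma p_neq_0 [simp]: "p m \<noteq> 0" and q_neq_0 [simp]: "q m \<noteq> 0"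
  using \<kappa>0_neq[of "m div 2"] \<kappa>1_neq[of "m div 2"] \<kappa>01_neq[of "m div 2 + 1"] of_nat_neq_0[of "m div 2", where 'a = complex]
  by (auto simp: szp_def szq_def add_ac)

lemma sa_eq: "sa m = (of_nat (Suc m) + \<kappa>0 + \<kappa>1) * (if even m then 1/2 else p m * q m / 2)"
proof (cases "even m")
  case True
  then show ?thesis by (auto elim!: evenE simp: sza_def szp_def szq_def field_simps)
next
  case False
  then obtain n where n: "m = Suc (2 * n)" by (auto elim!: oddE)
  have "of_nat (Suc n) \<noteq> (0 :: complex)" "of_nat n + \<kappa>0 + \<kappa>1 + 1 \<noteq> 0"
    using \<kappa>01_neq[of "Suc n"] of_nat_neq_0 by (auto simp: add_ac)
  moreover have len: "of_nat (Suc m) + \<kappa>0 + \<kappa>1 = of_nat (Suc n) + (of_nat n + \<kappa>0 + \<kappa>1 + 1)"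
    by (simp add: n)
  moreover have "(1 / x + 1 / y) / 2 = (x + y) * (1 / x * (1 / y) / 2)"
    if "x \<noteq> 0" "y \<noteq> 0" for x y :: complex
    using that by (simp add: field_simps)
  ultimately show ?thesis
    unfolding sza_def len if_not_P[OF False] unfolding n szp_odd szq_odd by blast
qed

lemma sa_neq_0 [simp]: "sa m \<noteq> 0"
  using \<kappa>01_neq[of "Suc m"] by (simp add: sa_eq add_ac)

text \<open>The ratio \<open>b / a\<close> written without division. \<open>T_F_aux\<close> uses it,
  scaled by \<open>s\<close>, to make \<open>T (G (Suc m))\<close> vanish.\<close>

lemma sb_eq: "sb m * (of_nat (Suc m) + \<kappa>0 + \<kappa>1) = sa m * eps (Suc m)"
proof (cases "even m")
  case True
  then show ?thesis
    unfolding sa_eq by (auto elim!: evenE simp: szb_def szp_def szq_def eps_def)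
next
  case False
  then obtain n where n: "m = Suc (2 * n)" by (auto elim!: oddE)
  have "of_nat (Suc n) \<noteq> (0 :: complex)" "of_nat n + \<kappa>0 + \<kappa>1 + 1 \<noteq> 0"
    using \<kappa>01_neq[of "Suc n"] of_nat_neq_0 by (auto simp: add_ac)
  then have "sb m = (\<kappa>0 + \<kappa>1) * (p m * q m / 2)"
    unfolding szb_def n szp_odd szq_odd by (simp add: divide_simps del: of_nat_Suc) simp
  then show ?thesis
    unfolding sa_eq using False by (simp add: eps_def mult_ac)
qed

lemma sa_sb: "sa m ^ 2 - sb m ^ 2 = p m * q m"
  by (simp add: sza_def szb_def power2_eq_square field_simps)

lemma st_Suc: "st (Suc m) = sa m - sb m ^ 2 / sa m"
  by (simp add: szt_def divide_simps) (simp add: power2_eq_square flip: sa_sb)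

lemma ff_0 [simp]: "ff \<kappa>0 \<kappa>1 0 = 1"
  using f0_even[of \<kappa>0 \<kappa>1 0] by (simp add: ff_def f1_0 homogenize_def scal_bconst)

lemma ff_Suc: "ff \<kappa>0 \<kappa>1 (Suc m)
  = bconst (sa m) * Z * ff \<kappa>0 \<kappa>1 m + bconst (sb m) * Zb * swap (ff \<kappa>0 \<kappa>1 m)"
proof -
  have "of_nat n + \<kappa>0 + \<kappa>1 + 1 \<noteq> 0" for n
    using \<kappa>01_neq[of "Suc n"] by (simp add: add_ac)
  note f1 = f1_Suc[OF this]
  have "sa m = p m * (1/2) + q m * (1/2)" "sb m = p m * (1/2) - q m * (1/2)"
    by (simp_all add: sza_def szb_def add_divide_distrib diff_divide_distrib)
  then show ?thesis
    by (simp only: ff_def swap_add swap_f0 swap_f1 f0_Suc f1 bconst_hom) (simp add: algebra_simps)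
qed

definition F :: "nat \<Rightarrow> bipoly" where "F m = subst2 (ff \<kappa>0 \<kappa>1 m) (Z ^ s) (Zb ^ s)"

definition G :: "nat \<Rightarrow> bipoly" where "G m = subst2 (ff \<kappa>0 \<kappa>1 m) (Zb ^ s) (Z ^ s)"

lemma swap_F [simp]: "swap (F m) = G m" and swap_G [simp]: "swap (G m) = F m"
  by (simp_all add: F_def G_def swap_subst2 swap_power)

lemma F_0 [simp]: "F 0 = 1" and G_0 [simp]: "G 0 = 1"
  by (simp_all add: F_def G_def)

lemma F_Suc: "F (Suc m) = bconst (sa m) * Z ^ s * F m + bconst (sb m) * Zb ^ s * G m"
  by (simp add: F_def G_def ff_Suc subst2_hom subst2_swap)

lemma G_Suc: "G (Suc m) = bconst (sa m) * Zb ^ s * G m + bconst (sb m) * Z ^ s * F m"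
  using arg_cong[OF F_Suc, of swap m] by (simp add: swap_hom)

lemma refl_class_F: "refl_class s m (F m)"
proof (induction m)
  case 0
  show ?case using refl_class_bconst[of s 1] by simp
next
  case (Suc m)
  have "refl_class s (0 + 1 + m) (bconst (sa m) * Z ^ s * F m)"
    by (intro refl_class_mult refl_class_bconst refl_class_Z_power s_pos Suc)
  moreover have "refl_class s (0 + 1 + m) (bconst (sb m) * swap (Z ^ s) * swap (F m))"
    by (intro refl_class_mult refl_class_bconst refl_class_swap refl_class_Z_power s_pos Suc)
  ultimately show ?case
    by (simp add: F_Suc refl_class_add swap_power)
qed

lemma refl_class_G: "refl_class s m (G m)"
  using refl_class_swap[OF refl_class_F] by simp

definition \<tau> :: "nat \<Rightarrow> complex" where "\<tau> m = st m * (of_nat (m * s) + \<gamma>)"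

lemma T_one: "T 1 = 0"
proof -
  have "divdiff \<eta> 1 = 0" if "\<eta> \<noteq> 0" for \<eta>
    using divdiff_invariant[of \<eta> 1] that by simp
  then show ?thesis by (simp add: dunkl_T_def scal_def)
qed

text \<open>The third conjunct is the form that the Euler identity for \<open>z T + zbar Tb\<close>
  takes once \<open>Tb\<close> kills \<open>F m\<close>. It is carried through the induction because
  it removes the \<open>G\<close> term from \<open>T (Z ^ s * F m)\<close>; both parts of the
  recursion then give multiples of \<open>Z ^ (s-1) * F m\<close>, and only the scalars remain to be
  compared.\<close>

lemma T_F_aux:
  "T (G m) = 0
    \<and> T (F m) = bconst (\<tau> m) * (Z ^ (s - 1) * F (m - 1))
    \<and> Z * T (F m) = bconst (of_nat (m * s) + \<gamma>) * F m - bconst (of_nat s * eps m) * G m"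
proof (induction m)
  case 0
  have "\<gamma> = of_nat s * eps 0" by (simp add: \<gamma>_def eps_def)
  then show ?case by (simp add: T_one \<tau>_def szt_def)
next
  case (Suc m)
  define N where "N = of_nat (Suc m * s) + \<gamma>"
  define e where "e = of_nat s * eps (Suc m)"
  have N: "N = of_nat s * (of_nat (Suc m) + \<kappa>0 + \<kappa>1)"
    by (simp add: N_def \<gamma>_def algebra_simps)
  have bN: "sb m * N = sa m * e"
    using sb_eq[of m] by (simp only: N e_def mult.left_commute)
  have Zs: "Z * Z ^ (s - 1) = Z ^ s"
    using s_pos by (simp flip: power_Suc)
  have 1: "T (Z ^ s * F m) = bconst N * (Z ^ (s - 1) * F m)"
  proof -
    have "Z ^ s * T (F m) = Z ^ (s - 1) * (Z * T (F m))"
      by (simp flip: Zs mult.assoc)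
    also have "Z * T (F m) = bconst (of_nat (m * s) + \<gamma>) * F m - bconst (of_nat s * eps m) * G m"
      using Suc by blast
    finally show ?thesis
      unfolding T_Z_power_mult[OF refl_class_F s_pos order_refl]
      by (simp add: N_def bconst_add bconst_of_nat algebra_simps)
  qed
  have 2: "T (Zb ^ s * G m) = - (bconst e * (Z ^ (s - 1) * F m))"
    using Suc T_Zb_power_s_mult[OF refl_class_G, of m] by (simp add: e_def)
  have "T (F (Suc m)) = bconst (sa m * N - sb m * e) * (Z ^ (s - 1) * F m)"
    unfolding F_Suc mult.assoc T_add T_bconst_mult 1 2 by (simp add: bconst_hom algebra_simps)
  moreover have "sa m * N - sb m * e = \<tau> (Suc m)"
  proof -
    have "sb m * e = sb m ^ 2 / sa m * N"
      using bN by (simp add: field_simps power2_eq_square)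
    then show ?thesis
      by (simp add: \<tau>_def st_Suc N_def algebra_simps)
  qed
  ultimately have TF: "T (F (Suc m)) = bconst (\<tau> (Suc m)) * (Z ^ (s - 1) * F m)"
    by simp
  have "T (G (Suc m)) = bconst (sb m * N - sa m * e) * (Z ^ (s - 1) * F m)"
    unfolding G_Suc mult.assoc T_add T_bconst_mult 1 2 by (simp add: bconst_hom algebra_simps)
  then have TG: "T (G (Suc m)) = 0"
    using bN by simp
  have "bconst N * F (Suc m) - bconst e * G (Suc m)
    = bconst (N * sa m - e * sb m) * (Z ^ s * F m) + bconst (N * sb m - e * sa m) * (Zb ^ s * G m)"
    unfolding F_Suc G_Suc by (simp add: bconst_hom algebra_simps)
  also have "\<dots> = bconst (\<tau> (Suc m)) * (Z ^ s * F m)"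
    using bN \<open>sa m * N - sb m * e = \<tau> (Suc m)\<close> by (simp add: mult.commute)
  also have "\<dots> = Z * T (F (Suc m))"
    unfolding TF Zs[symmetric] by (simp add: mult_ac)
  finally show ?case
    using TF TG by (simp add: N_def e_def)
qed

lemma T_G [simp]: "T (G m) = 0"
  and T_F_Suc: "T (F (Suc m)) = bconst (\<tau> (Suc m)) * (Z ^ (s - 1) * F m)"
  and Z_T_F: "Z * T (F m) = bconst (of_nat (m * s) + \<gamma>) * F m - bconst (of_nat s * eps m) * G m"
  using T_F_aux[of m] T_F_aux[of "Suc m"] by auto

lemma T_Z_power_F:
  assumes "1 \<le> i" "i \<le> s"
  shows "T (Z ^ i * F m) = bconst (of_nat (m * s + i) + \<gamma>) * (Z ^ (i - 1) * F m)"
proof -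
  have "Z ^ i * T (F m) = Z ^ (i - 1) * (Z * T (F m))"
    using assms by (cases i) (auto simp: mult_ac)
  then show ?thesis
    using T_Z_power_mult[OF refl_class_F assms, of m]
    by (simp add: Z_T_F bconst_add bconst_of_nat algebra_simps)
qed

text \<open>The factor \<open>of_nat j\<close> covers \<open>j = 0\<close>, where the truncated
  exponent alone would be wrong.\<close>

lemma Zb_rho_power: "of_nat j * (Zb * (Z * Zb) ^ (j - 1) * (Z * f)) = of_nat j * ((Z * Zb) ^ j * f)"
  by (cases j) (simp_all add: mult_ac)

lemma T_rho_power_Z_power_F:
  assumes "1 \<le> i" "i \<le> s"
  shows "T ((Z * Zb) ^ P * (Z ^ i * F m))
    = bconst (of_nat P + of_nat (m * s + i) + \<gamma>) * ((Z * Zb) ^ P * (Z ^ (i - 1) * F m))"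
proof -
  have "Z ^ i * F m = Z * (Z ^ (i - 1) * F m)"
    using assms by (cases i) auto
  then have "of_nat P * (Zb * (Z * Zb) ^ (P - 1) * (Z ^ i * F m)) = of_nat P * ((Z * Zb) ^ P * (Z ^ (i - 1) * F m))"
    by (simp only: Zb_rho_power)
  then show ?thesis
    unfolding T_rho_power_mult T_Z_power_F[OF assms] by (simp add: bconst_add bconst_of_nat algebra_simps)
qed

lemma T_rho_power_Zb_power_G:
  assumes "i < s"
  shows "T ((Z * Zb) ^ P * (Zb ^ i * G m)) = of_nat P * ((Z * Zb) ^ (P - 1) * (Zb ^ Suc i * G m))"
  unfolding T_rho_power_mult T_Zb_power_mult[OF refl_class_G assms] by (simp add: mult_ac)

lemma T_T_bar_F:
  "T (Tb ((Z * Zb) ^ j * F m))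
    = bconst (of_nat j * (of_nat j + of_nat (m * s) + \<gamma>)) * ((Z * Zb) ^ (j - 1) * F m)"
proof -
  \<comment> \<open>\<open>Tb\<close> annihilates \<open>F m\<close>, the mirror image of
    \<open>T_G\<close>, so only the power of \<open>Z * Zb\<close> is differentiated.\<close>
  have "Tb ((Z * Zb) ^ j * F m) = bconst (of_nat j) * ((Z * Zb) ^ (j - 1) * (Z ^ 1 * F m))"
    unfolding Tb_eq by (simp add: swap_hom T_rho_power_mult mult.commute[of Zb Z] bconst_of_nat flip: bconst_of_nat)
  then have "T (Tb ((Z * Zb) ^ j * F m))
    = bconst (of_nat j * (of_nat (j - 1) + of_nat (m * s + 1) + \<gamma>)) * ((Z * Zb) ^ (j - 1) * F m)"
    using T_rho_power_Z_power_F[of 1 "j - 1" m] s_pos by (simp add: T_bconst_mult bconst_mult mult.assoc)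
  also have "of_nat j * (of_nat (j - 1) + of_nat (m * s + 1) + \<gamma>) = of_nat j * (of_nat j + of_nat (m * s) + \<gamma>)"
    by (cases j) simp_all
  finally show ?thesis .
qed

text \<open>The mirror image of \<open>T_T_bar_F\<close> concerns \<open>Tb\<close> after
  \<open>T\<close>. Instead of establishing that the operators commute, the composition is computed
  directly.\<close>

lemma T_T_bar_G:
  "T (Tb ((Z * Zb) ^ j * G m))
    = bconst (of_nat j * (of_nat j + of_nat (m * s) + \<gamma>)) * ((Z * Zb) ^ (j - 1) * G m)"
proof (cases m)
  case 0
  then show ?thesis using T_T_bar_F[of j 0] by simp
next
  case (Suc k)
  let ?R = "(Z * Zb) ^ (j - 1)"
  have s: "s - 1 < s" "Suc (s - 1) = s" using s_pos by auto
  have swapR: "swap ((Z * Zb) ^ i) = (Z * Zb) ^ i" for i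
    by (simp add: swap_hom mult.commute)
  have "swap (T (F m)) = bconst (\<tau> m) * (Zb ^ (s - 1) * G k)"
    unfolding Suc T_F_Suc by (simp add: swap_hom)
  moreover have "Tb ((Z * Zb) ^ j * G m)
    = bconst (of_nat j) * (?R * (Z ^ 1 * G m)) + (Z * Zb) ^ j * swap (T (F m))"
    unfolding Tb_eq swap_mult swapR swap_G T_rho_power_mult
    by (simp add: swap_add swap_mult swapR bconst_of_nat[symmetric] mult_ac del: bconst_eq_0_iff)
  ultimately have "T (Tb ((Z * Zb) ^ j * G m)) = bconst (of_nat j) * T (?R * (Z ^ 1 * G m))
      + bconst (\<tau> m) * T ((Z * Zb) ^ j * (Zb ^ (s - 1) * G k))"
    by (simp add: T_add T_bconst_mult mult.left_commute[of "(Z * Zb) ^ j"])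
  also have "T ((Z * Zb) ^ j * (Zb ^ (s - 1) * G k)) = bconst (of_nat j) * (?R * (Zb ^ s * G k))"
    unfolding T_rho_power_Zb_power_G[OF s(1)] s(2) bconst_of_nat ..
  also have "bconst (of_nat j) * T (?R * (Z ^ 1 * G m))
    = bconst (of_nat j) * (?R * (bconst (of_nat j) * G m + bconst (of_nat s * eps m) * F m))"
  proof -
    have "T (Z ^ 1 * G m) = G m + bconst (of_nat s * eps m) * F m"
      unfolding T_Z_power_mult[OF refl_class_G order_refl s_pos] by simp
    moreover have "of_nat (j - 1) * (Zb * (Z * Zb) ^ (j - 1 - 1) * (Z ^ 1 * G m)) = of_nat (j - 1) * (?R * G m)"
      unfolding power_one_right by (rule Zb_rho_power)
    ultimately have "T (?R * (Z ^ 1 * G m))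
      = ?R * (of_nat (j - 1) * G m + (G m + bconst (of_nat s * eps m) * F m))"
      unfolding T_rho_power_mult by (simp add: algebra_simps)
    then show ?thesis
      by (cases j) (simp_all add: bconst_of_nat[symmetric] bconst_add algebra_simps del: bconst_eq_0_iff)
  qed
  also have "bconst (\<tau> m) * (bconst (of_nat j) * (?R * (Zb ^ s * G k)))
    = bconst (of_nat j) * (?R * swap (Z * T (F m)))"
  proof -
    have "swap (Z * T (F m)) = bconst (\<tau> m) * (Zb ^ Suc (s - 1) * G k)"
      unfolding Suc T_F_Suc by (simp add: swap_hom mult_ac)
    then show ?thesis unfolding s(2) by (simp add: mult_ac)
  qed
  \<comment> \<open>The Euler-type identity brings in \<open>- s eps m F m\<close>, which cancels
    the term that \<open>Z * G m\<close> produced.\<close>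
  also have "swap (Z * T (F m)) = bconst (of_nat (m * s) + \<gamma>) * G m - bconst (of_nat s * eps m) * F m"
    unfolding Z_T_F by (simp add: swap_hom)
  finally show ?thesis
    by (simp add: bconst_add bconst_mult algebra_simps)
qed

lemma T_funpow_rho_power_G:
  "i \<le> s \<Longrightarrow> (T ^^ i) ((Z * Zb) ^ P * G m)
    = bconst (fall (of_nat P) i) * ((Z * Zb) ^ (P - i) * (Zb ^ i * G m))"
proof (induction i)
  case (Suc i)
  have "(T ^^ Suc i) ((Z * Zb) ^ P * G m) = bconst (fall (of_nat P) i * of_nat (P - i))
      * ((Z * Zb) ^ (P - i - 1) * (Zb ^ Suc i * G m))"
    using Suc T_rho_power_Zb_power_G[of i "P - i" m]
    by (simp add: T_bconst_mult bconst_mult bconst_of_nat)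
  then show ?case
    by (simp add: fall_Suc fall_of_nat_mult)
qed simp

text \<open>Each application either lowers the power of \<open>Z * Zb\<close> or turns
  \<open>F (Suc m)\<close> into \<open>Z ^ (s-1) * F m\<close>; from then on it strips one factor
  \<open>Z\<close> at a time. After \<open>s\<close> applications that power of \<open>Z\<close> is
  used up.\<close>

lemma T_funpow_rho_power_F_Suc:
  fixes P m :: nat
  assumes "i \<le> s"
  defines "Q \<equiv> of_nat P + of_nat (Suc m * s) + \<gamma>"
  shows "(T ^^ i) ((Z * Zb) ^ P * F (Suc m))
    = bconst (fall (of_nat P) i) * ((Z * Zb) ^ (P - i) * (Zb ^ i * F (Suc m)))
      + bconst (st (Suc m) * (fall Q i - fall (of_nat P) i)) * ((Z * Zb) ^ P * (Z ^ (s - i) * F m))"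
  using assms(1)
proof (induction i)
  case (Suc i)
  define R where "R = (\<lambda>j. (Z * Zb) ^ j)"
  have i: "i < s" "1 \<le> s - i" "s - i - 1 = s - Suc i" using Suc.prems by auto
  have 1: "bconst (fall (of_nat P) i) * T (R (P - i) * (Zb ^ i * F (Suc m)))
    = bconst (fall (of_nat P) (Suc i)) * (R (P - Suc i) * (Zb ^ Suc i * F (Suc m)))
      + bconst (fall (of_nat P) i * \<tau> (Suc m)) * (R P * (Z ^ (s - Suc i) * F m))"
  proof -
    have T: "T (R (P - i) * (Zb ^ i * F (Suc m)))
      = of_nat (P - i) * (R (P - Suc i) * (Zb ^ Suc i * F (Suc m)))
        + bconst (\<tau> (Suc m)) * (R (P - i) * (Zb ^ i * (Z ^ (s - 1) * F m)))"
      unfolding R_def T_rho_power_mult T_Zb_power_mult[OF refl_class_F i(1)] T_F_Suc by (simp add: mult_ac)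
    show ?thesis
    proof (cases "i \<le> P")
      case True
      have "Z ^ (s - 1) = Z ^ i * Z ^ (s - Suc i)" "R P = R (P - i) * (Z * Zb) ^ i"
        using i True by (simp_all add: R_def flip: power_add)
      then have "R (P - i) * (Zb ^ i * (Z ^ (s - 1) * F m)) = R P * (Z ^ (s - Suc i) * F m)"
        by (simp add: power_mult_distrib mult_ac)
      with T show ?thesis
        by (simp add: fall_Suc fall_of_nat_mult bconst_mult bconst_of_nat distrib_left mult.assoc)
    next
      case False
      then show ?thesis by (simp add: fall_of_nat_eq_0)
    qed
  qed
  have 2: "T (R P * (Z ^ (s - i) * F m)) = bconst (Q - of_nat i) * (R P * (Z ^ (s - Suc i) * F m))"
  proof -
    have "of_nat P + of_nat (m * s + (s - i)) + \<gamma> = Q - of_nat i"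
      using i by (simp add: Q_def of_nat_diff)
    then show ?thesis
      using T_rho_power_Z_power_F[OF i(2), of P m] i(3) by (simp add: R_def)
  qed
  have "(T ^^ Suc i) (R P * F (Suc m)) = bconst (fall (of_nat P) i) * T (R (P - i) * (Zb ^ i * F (Suc m)))
    + bconst (st (Suc m) * (fall Q i - fall (of_nat P) i)) * T (R P * (Z ^ (s - i) * F m))"
    using Suc by (simp add: R_def T_add T_bconst_mult)
  also have "\<dots> = bconst (fall (of_nat P) (Suc i)) * (R (P - Suc i) * (Zb ^ Suc i * F (Suc m)))
    + bconst (fall (of_nat P) i * \<tau> (Suc m) + st (Suc m) * (fall Q i - fall (of_nat P) i) * (Q - of_nat i))
      * (R P * (Z ^ (s - Suc i) * F m))"
    unfolding 1 2 by (simp only: bconst_add bconst_mult) (simp add: algebra_simps)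
  \<comment> \<open>The scalars telescope because
    \<open>\<tau> (Suc m) = st (Suc m) * (Q - P)\<close>.\<close>
  also have "fall (of_nat P) i * \<tau> (Suc m) + st (Suc m) * (fall Q i - fall (of_nat P) i) * (Q - of_nat i)
    = st (Suc m) * (fall Q (Suc i) - fall (of_nat P) (Suc i))"
    by (simp add: \<tau>_def Q_def fall_Suc algebra_simps)
  finally show ?case by (simp add: R_def)
qed simp

end

section \<open>Structural constants\<close>

text \<open>A variant for coefficient statements, which are compatible with multiplication by a
  variable but not with general products.\<close>

lemma bipoly_Z_Zb_induct [case_names const Z Zb add]:
  assumes const: "\<And>c. P (bconst c)" and Z: "\<And>f. P f \<Longrightarrow> P (Z * f)" and Zb: "\<And>f. P f \<Longrightarrow> P (Zb * f)"
    and add: "\<And>f g. P f \<Longrightarrow> P g \<Longrightarrow> P (f + g)"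
  shows "P f"
proof (induction f)
  case 0
  show ?case using const[of 0] by simp
next
  case (pCons g f)
  have "P [:g:]"
  proof (induction g)
    case 0
    show ?case using const[of 0] by simp
  next
    case (pCons c g)
    have "[:pCons c g:] = bconst c + Zb * [:g:]"
      by (simp add: bconst_def Zb_def)
    then show ?case using add[OF const Zb[OF pCons(2)]] by simp
  qed
  moreover have "pCons g f = [:g:] + Z * f"
    by (simp add: Z_def)
  ultimately show ?case using add Z pCons.IH by simp
qed

lemma coeff_bconst_mult [simp]: "coeff (coeff (bconst c * f) a) b = c * coeff (coeff f a) b"
  by (simp add: bconst_def)

lemma coeff_Z_mult: "coeff (coeff (Z * f) a) b = (if a = 0 then 0 else coeff (coeff f (a - 1)) b)"
  by (cases a) (simp_all add: Z_def)

lemma coeff_Zb_mult: "coeff (coeff (Zb * f) a) b = (if b = 0 then 0 else coeff (coeff f a) (b - 1))"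
  by (cases b) (simp_all add: Zb_def)

lemma coeff_1: "coeff (coeff (1 :: bipoly) a) b = (if a = 0 \<and> b = 0 then 1 else 0)"
  by (simp add: one_pCons coeff_pCons split: nat.split)

lemma coeff_swap: "coeff (coeff (swap f) a) b = coeff (coeff f b) a"
proof (induction f arbitrary: a b rule: bipoly_Z_Zb_induct)
  case (const c)
  show ?case
    using coeff_bconst_mult[of c 1] by (simp only: swap_bconst mult_1_right coeff_1) simp
qed (simp_all add: swap_hom coeff_Z_mult coeff_Zb_mult)

lemma cf_add: "cf (f + g) i j = cf f i j + cf g i j"
  and cf_bconst_mult: "cf (bconst c * f) i j = c * cf f i j"
  and cf_diff: "cf (f - g) i j = cf f i j - cf g i j"
  and cf_swap: "cf (swap f) i j = cf f j i"
  by (simp_all add: cf_def coeff_swap)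

lemma cf_Z_mult: "cf (Z * f) i j = cf f (i - 1) j"
  by (auto simp: cf_def coeff_Z_mult nat_diff_distrib)

lemma cf_Zb_mult: "cf (Zb * f) i j = cf f i (j - 1)"
  by (auto simp: cf_def coeff_Zb_mult nat_diff_distrib)

lemma cf_neg [simp]: "i < 0 \<Longrightarrow> cf f i j = 0"
  by (simp add: cf_def)

section \<open>Recursion for the structural constants\<close>

context nonsingular
begin

abbreviation "\<nu> \<equiv> nu \<kappa>0 \<kappa>1"

lemma st_neq_0 [simp]: "st (Suc m) \<noteq> 0"
  by (simp add: szt_def)

lemma nu_odd: "\<nu> (Suc (2 * n)) = 2 * pochhammer (\<kappa>0 + 1/2) (Suc n) * pochhammer (\<kappa>1 + 1/2) (Suc n)
    / (fact n * pochhammer (\<kappa>0 + \<kappa>1 + 1) n * (\<kappa>0 + \<kappa>1 + 2 * of_nat n + 1))"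
  by (simp add: nu_def)

lemma nu_even: "\<nu> (Suc (Suc (2 * n))) = 2 * pochhammer (\<kappa>0 + 1/2) (Suc n) * pochhammer (\<kappa>1 + 1/2) (Suc n)
    / (fact n * pochhammer (\<kappa>0 + \<kappa>1 + 1) n * (\<kappa>0 + \<kappa>1 + 2 * of_nat (Suc n)))"
  by (simp add: nu_def)

lemma pochhammer_\<kappa>01_neq_0 [simp]: "pochhammer (\<kappa>0 + \<kappa>1 + 1) n \<noteq> 0"
proof
  assume "pochhammer (\<kappa>0 + \<kappa>1 + 1) n = 0"
  then obtain k where "\<kappa>0 + \<kappa>1 + 1 = - of_nat k"
    by (auto simp: pochhammer_eq_0_iff)
  moreover have "\<kappa>0 + \<kappa>1 + of_nat (Suc k) = (\<kappa>0 + \<kappa>1 + 1) + of_nat k" by simp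
  ultimately have "\<kappa>0 + \<kappa>1 + of_nat (Suc k) = 0" by simp
  with \<kappa>01_neq[of "Suc k"] show False by simp
qed

lemma nu_1: "\<nu> (Suc 0) = st (Suc 0)"
proof -
  define x where "x = \<kappa>0 + 1/2"
  define y where "y = \<kappa>1 + 1/2"
  have 1: "\<nu> (Suc 0) = 2 * x * y / (\<kappa>0 + \<kappa>1 + 1)"
    using nu_odd[of 0] unfolding x_def[symmetric] y_def[symmetric] by simp
  have 2: "p 0 = x" "q 0 = y" "sa 0 = (\<kappa>0 + \<kappa>1 + 1) / 2"
    by (simp_all add: sa_eq szp_def szq_def x_def y_def)
  show ?thesis
    unfolding 1 szt_def nat.case 2 by simp
qed

text \<open>This makes \<open>nu\<close> the normalisation in which the coefficient recursion takes
  the form \<open>st_A_Suc\<close>, with scalars 1 and \<open>sb m / sa m\<close> on the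
  right.\<close>

lemma nu_Suc_Suc: "\<nu> (Suc (Suc m)) = st (Suc (Suc m)) * sa m * \<nu> (Suc m)"
proof (cases "even m")
  case True
  then obtain n where n: "m = 2 * n" by (elim evenE)
  define x where "x = \<kappa>0 + \<kappa>1 + 2 * of_nat n + 1"
  have arg: "of_nat (Suc m) + \<kappa>0 + \<kappa>1 = x" "of_nat (Suc (Suc m)) + \<kappa>0 + \<kappa>1 = x + 1"
    "\<kappa>0 + \<kappa>1 + 2 * of_nat (Suc n) = x + 1"
    by (simp_all add: x_def n)
  have nz: "x \<noteq> 0" "x + 1 \<noteq> 0"
    using \<kappa>01_neq[of "Suc m"] \<kappa>01_neq[of "Suc (Suc m)"] unfolding arg[symmetric] by (simp_all add: add_ac)
  have 1: "sa m = x / 2" "st (Suc (Suc m)) = 2 / (x + 1)"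
    using True nz by (simp_all add: szt_def sa_eq arg del: of_nat_Suc)
  have "(x + 1) * \<nu> (Suc (Suc m)) = x * \<nu> (Suc m)"
  proof -
    define d where "d = fact n * pochhammer (\<kappa>0 + \<kappa>1 + 1) n"
    define e where "e = 2 * pochhammer (\<kappa>0 + 1/2) (Suc n) * pochhammer (\<kappa>1 + 1/2) (Suc n)"
    show ?thesis
      unfolding n nu_odd nu_even arg x_def[symmetric] d_def[symmetric] e_def[symmetric] using nz by simp
  qed
  then show ?thesis
    unfolding 1 using nz by (simp add: field_simps)
next
  case False
  then obtain n where n: "m = Suc (2 * n)" by (auto elim!: oddE)
  define x where "x = \<kappa>0 + \<kappa>1 + 2 * of_nat (Suc n)"
  define y where "y = \<kappa>0 + \<kappa>1 + 1 + of_nat n"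
  define a where "a = \<kappa>0 + 1/2 + of_nat (Suc n)"
  define b where "b = \<kappa>1 + 1/2 + of_nat (Suc n)"
  have arg: "of_nat (Suc m) + \<kappa>0 + \<kappa>1 = x" "of_nat (Suc (Suc m)) + \<kappa>0 + \<kappa>1 = x + 1"
    "\<kappa>0 + \<kappa>1 + 2 * of_nat (Suc n) + 1 = x + 1"
    by (simp_all add: x_def n)
  have nz: "x \<noteq> 0" "x + 1 \<noteq> 0" "y \<noteq> 0"
    using \<kappa>01_neq[of "Suc m"] \<kappa>01_neq[of "Suc (Suc m)"] \<kappa>01_neq[of "Suc n"]
    unfolding arg[symmetric] by (simp_all add: add_ac y_def)
  have "p m = 1 / of_nat (Suc n)" "q m = 1 / y"
    unfolding n szp_odd szq_odd y_def by (simp_all add: add_ac)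
  then have 1: "sa m = x / (2 * of_nat (Suc n) * y)"
    using False by (simp add: sa_eq arg del: of_nat_Suc)
  have "p (Suc m) = a" "q (Suc m) = b"
    unfolding n szp_even szq_even a_def b_def by (simp_all add: add_ac)
  then have 2: "st (Suc (Suc m)) = 2 * a * b / (x + 1)"
    using False by (simp add: szt_def sa_eq arg del: of_nat_Suc)
  have "\<nu> (Suc (Suc m)) * (of_nat (Suc n) * y * (x + 1)) = a * b * x * \<nu> (Suc m)"
  proof -
    define d where "d = fact n * pochhammer (\<kappa>0 + \<kappa>1 + 1) n"
    define e where "e = pochhammer (\<kappa>0 + 1/2) (Suc n) * pochhammer (\<kappa>1 + 1/2) (Suc n)"
    have "d \<noteq> 0" by (simp add: d_def)
    have \<nu>1: "\<nu> (Suc m) = 2 * e / (d * x)"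
      unfolding n nu_even d_def e_def x_def by (simp add: mult_ac)
    have \<nu>2: "\<nu> (Suc (Suc m)) = 2 * (e * a * b) / (d * (of_nat (Suc n) * y) * (x + 1))"
      using nu_odd[of "Suc n"] unfolding arg(3)
      by (simp add: n d_def e_def a_def b_def y_def pochhammer_Suc[of _ n] pochhammer_Suc[of _ "Suc n"] mult_ac
          del: of_nat_Suc)
    show ?thesis
      unfolding \<nu>1 \<nu>2 using nz \<open>d \<noteq> 0\<close> by (simp add: divide_simps del: of_nat_Suc)
  qed
  then show ?thesis
    unfolding 1 2 using nz by (simp add: divide_simps mult_ac del: of_nat_Suc)
qed

lemma nu_neq_0 [simp]: "\<nu> (Suc m) \<noteq> 0"
  by (induction m) (simp_all add: nu_1 nu_Suc_Suc)

text \<open>The coefficients of \<open>f0\<close> in degree \<open>m + 1\<close> carry the factor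
  \<open>p m / 2\<close> from \<open>f0_Suc\<close>; \<open>lam0\<close> cancels it and leaves the
  division by \<open>nu\<close>. The constant \<open>lam1\<close> does the same with
  \<open>q m\<close>.\<close>

lemma lam0_Suc: "lam0 \<kappa>0 \<kappa>1 (Suc m) = 2 / (p m * \<nu> (Suc m))"
proof (cases "even m")
  case True
  then obtain n where n: "m = 2 * n" by (elim evenE)
  have "p m = of_nat n + \<kappa>0 + 1/2" by (simp add: szp_def n)
  then show ?thesis
    unfolding n nu_odd by (simp add: lam0_def mult_ac)
next
  case False
  then obtain n where n: "m = Suc (2 * n)" by (auto elim!: oddE)
  define y where "y = \<kappa>0 + \<kappa>1 + of_nat (Suc n)"
  have "y \<noteq> 0"
    unfolding y_def by (rule \<kappa>01_neq) simp
  moreover have "pochhammer (\<kappa>0 + \<kappa>1 + 1) (Suc n) = pochhammer (\<kappa>0 + \<kappa>1 + 1) n * y"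
    by (simp add: pochhammer_Suc y_def add.assoc)
  moreover have "lam0 \<kappa>0 \<kappa>1 (Suc (Suc (2 * n)))
    = fact (Suc n) * pochhammer (\<kappa>0 + \<kappa>1 + 1) (Suc n) * (\<kappa>0 + \<kappa>1 + 2 * of_nat (Suc n))
      / (pochhammer (\<kappa>0 + 1/2) (Suc n) * pochhammer (\<kappa>1 + 1/2) (Suc n) * y)"
    by (simp add: lam0_def y_def)
  ultimately show ?thesis
    unfolding n nu_even szp_odd by simp
qed

lemma lam1_Suc: "lam1 \<kappa>0 \<kappa>1 (Suc m) = 2 / (q m * \<nu> (Suc m))"
proof (cases "even m")
  case True
  then obtain n where n: "m = 2 * n" by (elim evenE)
  have "q m = of_nat n + \<kappa>1 + 1/2" by (simp add: szq_def n)
  then show ?thesis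
    unfolding n nu_odd by (simp add: lam1_def mult_ac)
next
  case False
  then obtain n where n: "m = Suc (2 * n)" by (auto elim!: oddE)
  have "of_nat n + \<kappa>0 + \<kappa>1 + 1 = \<kappa>0 + \<kappa>1 + 1 + of_nat n" by simp
  then show ?thesis
    unfolding n nu_even szq_odd by (simp add: lam1_def pochhammer_Suc[of "\<kappa>0 + \<kappa>1 + 1"])
qed

end

section \<open>The images of the monomials with exponents divisible by \<open>s\<close>\<close>

context nonsingular
begin

text \<open>\<open>A U V\<close> is the coefficient of \<open>F (U + V)\<close> in the harmonic component of the normalised image of
  \<open>Z\<^sup>U\<^sup>s Zb\<^sup>V\<^sup>s\<close>; the value at \<open>U = V = 0\<close> splits the constant \<open>1\<close> evenly, as \<open>F 0 = G 0\<close>.\<close>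

definition A :: "nat \<Rightarrow> nat \<Rightarrow> complex" where
  "A U V = (if U + V = 0 then 1/2 else cf (ff \<kappa>0 \<kappa>1 (U + V - 1)) (int U - 1) (int V) / \<nu> (U + V))"

definition h :: "nat \<Rightarrow> nat \<Rightarrow> bipoly" where
  "h U V = bconst (A U V) * F (U + V) + bconst (A V U) * G (U + V)"

lemma A_0_left: "V > 0 \<Longrightarrow> A 0 V = 0"
  by (simp add: A_def)

lemma h_0_0 [simp]: "h 0 0 = 1"
  by (simp add: h_def A_def flip: bconst_add)

lemma swap_h: "swap (h U V) = h V U"
  by (simp add: h_def swap_hom add.commute)

lemma st_A_Suc_0: "st (Suc 0) * A (Suc 0) 0 = 1"
  by (simp add: A_def nu_1 cf_def coeff_1)

text \<open>Coefficient comparison in \<open>ff_Suc\<close>; the swapped summand turns into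
  \<open>A\<close> with exchanged arguments.\<close>

lemma st_A_Suc:
  assumes "U + V = Suc m"
  shows "st (Suc (Suc m)) * A (Suc U) V = A U V + sb m / sa m * A V U"
proof -
  have distribute: "c * ((a * x + b * y) / (c * a * n)) = x / n + b / a * (y / n)"
    if "c \<noteq> 0" "a \<noteq> 0" "n \<noteq> 0" for a b c n x y :: complex
    using that by (simp add: field_simps)
  have 1: "A (Suc U) V = (sa m * cf (ff \<kappa>0 \<kappa>1 m) (int U - 1) (int V)
      + sb m * cf (ff \<kappa>0 \<kappa>1 m) (int V - 1) (int U)) / \<nu> (Suc (Suc m))"
    using assms
    by (simp add: A_def ff_Suc mult.assoc cf_add cf_bconst_mult cf_Z_mult cf_Zb_mult cf_swap)
  have 2: "A U V = cf (ff \<kappa>0 \<kappa>1 m) (int U - 1) (int V) / \<nu> (Suc m)"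
    "A V U = cf (ff \<kappa>0 \<kappa>1 m) (int V - 1) (int U) / \<nu> (Suc m)"
    using assms by (simp_all add: A_def add.commute)
  show ?thesis
    unfolding 1 2 nu_Suc_Suc by (rule distribute) simp_all
qed

lemma bconst_st_Suc: "bconst (st (Suc m)) = bconst (sa m) - bconst (sb m / sa m) * bconst (sb m)"
  by (simp add: st_Suc power2_eq_square flip: bconst_mult bconst_diff)

lemma bconst_sb: "bconst (sb m) = bconst (sb m / sa m) * bconst (sa m)"
  by (simp flip: bconst_mult)

text \<open>Elimination of \<open>Zb ^ s * G m\<close> between \<open>F_Suc\<close> and
  \<open>G_Suc\<close>; the scalar that remains is \<open>a - b^2 / a\<close>.
  \<open>G_minus\<close> eliminates the other product.\<close>

lemma F_minus_st: "F (Suc m) - bconst (st (Suc m)) * (Z ^ s * F m) = bconst (sb m / sa m) * G (Suc m)"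
  unfolding F_Suc G_Suc bconst_st_Suc bconst_sb by (simp add: algebra_simps)

lemma G_minus: "G (Suc m) - bconst (sb m / sa m) * F (Suc m) = bconst (st (Suc m)) * (Zb ^ s * G m)"
  unfolding F_Suc G_Suc bconst_st_Suc bconst_sb by (simp add: algebra_simps)

lemma h_0_right: "bconst (st (Suc U) * A (Suc U) 0) * F U = h U 0"
proof (cases U)
  case 0
  then show ?thesis using st_A_Suc_0 by simp
next
  case (Suc m)
  have "st (Suc (Suc m)) * A (Suc U) 0 = A U 0"
    using st_A_Suc[of U 0 m] by (simp add: Suc A_0_left)
  then show ?thesis by (simp add: h_def Suc A_0_left)
qed

text \<open>Call a polynomial harmonic if \<open>T Tb\<close> kills it. In general
  \<open>Zb ^ s * h U V\<close> is not harmonic; subtracting the multiple of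
  \<open>(Z * Zb) ^ s\<close> leaves a multiple of \<open>Zb ^ s * G m\<close>, which
  \<open>G_minus\<close> expresses through the next \<open>F\<close> and \<open>G\<close>. The
  unwanted \<open>F\<close> part cancels the second summand of \<open>st_A_Suc\<close>.\<close>

lemma h_Suc_right:
  "bconst (st (Suc (U + Suc V)) * A (Suc U) (Suc V)) * F (U + Suc V)
    + (Zb ^ s * h U V - (Z * Zb) ^ s * (bconst (st (U + V) * A U V) * F (U + V - 1)))
    = h U (Suc V)"
proof -
  define m where "m = U + V"
  have 1: "st (Suc (U + Suc V)) * A (Suc U) (Suc V) = A U (Suc V) + sb m / sa m * A (Suc V) U"
    using st_A_Suc[of U "Suc V" m] by (simp add: m_def)
  have 2: "h U V - bconst (st m * A U V) * (Z ^ s * F (m - 1)) = bconst (st (Suc m) * A (Suc V) U) * G m"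
  proof (cases m)
    case 0
    \<comment> \<open>For \<open>m = 0\<close> the subtracted term vanishes by the default
      \<open>st 0 = 0\<close>, and \<open>h 0 0 = 1 = G 0\<close>.\<close>
    then show ?thesis using st_A_Suc_0 by (simp add: m_def szt_def)
  next
    case (Suc k)
    have "h U V - bconst (st m * A U V) * (Z ^ s * F (m - 1))
      = bconst (A U V) * (F (Suc k) - bconst (st (Suc k)) * (Z ^ s * F k)) + bconst (A V U) * G (Suc k)"
      using Suc by (simp add: h_def m_def bconst_mult algebra_simps)
    also have "\<dots> = bconst (A V U + sb k / sa k * A U V) * G (Suc k)"
      unfolding F_minus_st bconst_add bconst_mult[of "sb k / sa k"] distrib_right
      by (simp only: mult_ac add_ac)
    also have "A V U + sb k / sa k * A U V = st (Suc m) * A (Suc V) U"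
      using st_A_Suc[of V U k] Suc by (simp add: m_def add.commute)
    finally show ?thesis by (simp add: Suc)
  qed
  have "Zb ^ s * h U V - (Z * Zb) ^ s * (bconst (st m * A U V) * F (m - 1))
    = Zb ^ s * (h U V - bconst (st m * A U V) * (Z ^ s * F (m - 1)))"
    by (simp add: algebra_simps power_mult_distrib)
  also have "\<dots> = bconst (A (Suc V) U) * (bconst (st (Suc m)) * (Zb ^ s * G m))"
    unfolding 2 by (simp add: bconst_mult mult_ac)
  also have "\<dots> = bconst (A (Suc V) U) * (G (Suc m) - bconst (sb m / sa m) * F (Suc m))"
    unfolding G_minus ..
  finally have 3: "Zb ^ s * h U V - (Z * Zb) ^ s * (bconst (st m * A U V) * F (m - 1))
    = bconst (A (Suc V) U) * (G (Suc m) - bconst (sb m / sa m) * F (Suc m))" .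
  have "bconst (a + c * b) * f + bconst b * (g - bconst c * f) = bconst a * f + bconst b * g"
    for a b c f g
    by (simp only: bconst_add bconst_mult) (simp add: algebra_simps)
  moreover have "U + Suc V = Suc m" by (simp add: m_def)
  ultimately show ?thesis
    unfolding h_def[of U "Suc V"] 1 m_def[symmetric] 3 by (simp only:)
qed

text \<open>Chosen so that each of the two falling factorials in \<open>T_funpow_s_h\<close> merely
  shifts an index: the one in \<open>\<gamma>\<close> lowers \<open>n\<close>, the integral one
  lowers \<open>n\<close> and \<open>k\<close> together.\<close>

definition wcoeff :: "nat \<Rightarrow> nat \<Rightarrow> complex" where
  "wcoeff n k = 1 / (fact (k * s) * pochhammer (\<gamma> + 1) ((n - k) * s))"

definition w :: "nat \<Rightarrow> nat \<Rightarrow> bipoly" where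
  "w u v = (\<Sum>k\<le>min u v. bconst (wcoeff (u + v) k) * ((Z * Zb) ^ (k * s) * h (u - k) (v - k)))"

lemma swap_w: "swap (w u v) = w v u"
  by (simp add: w_def swap_sum swap_hom swap_h min.commute add.commute mult.commute[of Zb])

lemma T_funpow_add: "(T ^^ i) (f + g) = (T ^^ i) f + (T ^^ i) g"
  by (induction i) (simp_all add: T_add)

lemma T_funpow_bconst_mult: "(T ^^ i) (bconst c * f) = bconst c * (T ^^ i) f"
  by (induction i) (simp_all add: T_bconst_mult)

lemma T_funpow_0 [simp]: "(T ^^ i) 0 = 0"
  by (induction i) simp_all

lemma T_funpow_sum: "(T ^^ i) (\<Sum>k\<in>I. f k) = (\<Sum>k\<in>I. (T ^^ i) (f k))"
  by (induction I rule: infinite_finite_induct) (simp_all add: T_funpow_add)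

lemma T_funpow_s_F:
  "(T ^^ s) ((Z * Zb) ^ P * F m)
    = bconst (fall (of_nat P) s) * ((Z * Zb) ^ (P - s) * (Zb ^ s * F m))
      + bconst (st m * (fall (\<gamma> + of_nat (P + m * s)) s - fall (of_nat P) s)) * ((Z * Zb) ^ P * F (m - 1))"
proof (cases m)
  case 0
  then show ?thesis using T_funpow_rho_power_G[OF order_refl, of P 0] by (simp add: szt_def)
next
  case (Suc k)
  have Q: "of_nat P + of_nat (Suc k * s) + \<gamma> = \<gamma> + of_nat (P + Suc k * s)"
    by simp
  show ?thesis
    using T_funpow_rho_power_F_Suc[OF order_refl, of P k]
    by (simp only: Suc Q diff_self_eq_0 power_0 mult_1_left diff_Suc_1)
qed

lemma T_funpow_s_h:
  "(T ^^ s) ((Z * Zb) ^ P * h U V)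
    = bconst (fall (of_nat P) s) * ((Z * Zb) ^ (P - s) * (Zb ^ s * h U V))
      + bconst (fall (\<gamma> + of_nat (P + (U + V) * s)) s - fall (of_nat P) s)
        * ((Z * Zb) ^ P * (bconst (st (U + V) * A U V) * F (U + V - 1)))"
proof -
  have "(Z * Zb) ^ P * h U V = bconst (A U V) * ((Z * Zb) ^ P * F (U + V))
      + bconst (A V U) * ((Z * Zb) ^ P * G (U + V))"
    by (simp add: h_def algebra_simps)
  then have "(T ^^ s) ((Z * Zb) ^ P * h U V) = bconst (A U V) * (T ^^ s) ((Z * Zb) ^ P * F (U + V))
      + bconst (A V U) * (T ^^ s) ((Z * Zb) ^ P * G (U + V))"
    by (simp only: T_funpow_add T_funpow_bconst_mult)
  then show ?thesis
    unfolding T_funpow_s_F T_funpow_rho_power_G[OF order_refl]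
    by (simp only: h_def bconst_mult distrib_left mult_ac add_ac)
qed

lemma wcoeff_fall_\<gamma>:
  assumes "k \<le> n"
  shows "wcoeff (Suc n) k * fall (\<gamma> + of_nat ((Suc n - k) * s)) s = wcoeff n k"
proof -
  define x where "x = fall (\<gamma> + of_nat ((Suc n - k) * s)) s"
  have "(Suc n - k) * s - s = (n - k) * s" "s \<le> (Suc n - k) * s"
    using assms by (simp_all add: Suc_diff_le)
  then have eq: "pochhammer (\<gamma> + 1) ((Suc n - k) * s) = x * pochhammer (\<gamma> + 1) ((n - k) * s)"
    using fall_pochhammer[of s "(Suc n - k) * s" \<gamma>] by (simp add: x_def)
  moreover have "x \<noteq> 0"
    using eq pochhammer_\<gamma>_neq_0[of "(Suc n - k) * s"] by auto
  ultimately show ?thesis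
    unfolding wcoeff_def x_def[symmetric] by simp
qed

lemma wcoeff_fall_fact: "wcoeff (Suc n) (Suc k) * fall (of_nat (Suc k * s)) s = wcoeff n k"
proof -
  define x where "x = fall (of_nat (Suc k * s)) s"
  have eq: "fact (Suc k * s) = x * fact (k * s)"
    using fall_of_nat_fact[of s "Suc k * s"] unfolding x_def[symmetric] by simp
  moreover have "x \<noteq> 0"
    using eq fact_nonzero[of "Suc k * s", where 'a = complex] by auto
  ultimately show ?thesis
    unfolding wcoeff_def x_def[symmetric] diff_Suc_Suc by simp
qed

text \<open>\<open>T ^^ s\<close> splits the summand \<open>k\<close> into a part of weight
  \<open>wcoeff n k\<close> and one of weight \<open>wcoeff n (k-1)\<close>. Regrouped by weight,
  neighbouring summands combine to the left side of \<open>h_Suc_right\<close>; only the largest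
  index \<open>M\<close> needs separate care.\<close>

lemma T_funpow_s_w_Suc: "(T ^^ s) (w (Suc u) v) = w u v"
proof -
  define n where "n = u + v"
  define M where "M = min (Suc u) v"
  \<comment> \<open>\<open>\<alpha> k\<close> is the part of lower degree that \<open>T ^^ s\<close>
    creates from \<open>h\<close>. The summand \<open>k\<close> becomes \<open>\<beta> k\<close>
    plus \<open>\<delta> (k-1)\<close>, so \<open>\<beta> k\<close> and \<open>\<delta> k\<close>
    share a weight.\<close>
  define \<alpha> where "\<alpha> k = bconst (st (Suc u - k + (v - k)) * A (Suc u - k) (v - k)) * F (Suc u - k + (v - k) - 1)" for k
  define \<beta> where "\<beta> k = bconst (wcoeff n k) * ((Z * Zb) ^ (k * s) * \<alpha> k)" for k
  define \<delta> where "\<delta> k = bconst (wcoeff n k) * ((Z * Zb) ^ (k * s)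
      * (Zb ^ s * h (Suc u - Suc k) (v - Suc k) - (Z * Zb) ^ s * \<alpha> (Suc k)))" for k
  have summand: "bconst (wcoeff (Suc n) k) * (T ^^ s) ((Z * Zb) ^ (k * s) * h (Suc u - k) (v - k))
    = \<beta> k + (case k of 0 \<Rightarrow> 0 | Suc j \<Rightarrow> \<delta> j)" if "k \<le> M" for k
  proof -
    have k: "k \<le> Suc u" "k \<le> v" "k \<le> n" using that by (auto simp: M_def n_def)
    have "k + (Suc u - k + (v - k)) = Suc n - k"
      using k by (simp add: n_def)
    then have Q: "k * s + (Suc u - k + (v - k)) * s = (Suc n - k) * s"
      unfolding distrib_right[symmetric] by (rule arg_cong)
    have b: "wcoeff (Suc n) k * fall (\<gamma> + of_nat (k * s + (Suc u - k + (v - k)) * s)) s = wcoeff n k"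
      unfolding Q by (rule wcoeff_fall_\<gamma>[OF k(3)])
    have expand: "bconst (wcoeff (Suc n) k) * (T ^^ s) ((Z * Zb) ^ (k * s) * h (Suc u - k) (v - k))
      = bconst (wcoeff (Suc n) k * fall (of_nat (k * s)) s)
          * ((Z * Zb) ^ (k * s - s) * (Zb ^ s * h (Suc u - k) (v - k)))
        + bconst (wcoeff n k - wcoeff (Suc n) k * fall (of_nat (k * s)) s) * ((Z * Zb) ^ (k * s) * \<alpha> k)"
      unfolding T_funpow_s_h \<alpha>_def b[symmetric]
      by (simp only: distrib_left bconst_mult right_diff_distrib[symmetric] mult.assoc)
    show ?thesis
    proof (cases k)
      case 0
      have "fall 0 s = 0" using fall_of_nat_eq_0[of 0 s] s_pos by simp
      then show ?thesis
        unfolding expand \<beta>_def by (simp add: 0)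
    next
      case (Suc j)
      have d: "wcoeff (Suc n) k * fall (of_nat (k * s)) s = wcoeff n j"
        unfolding Suc by (rule wcoeff_fall_fact)
      have R: "(Z * Zb) ^ (k * s - s) = (Z * Zb) ^ (j * s)" "(Z * Zb) ^ (k * s) = (Z * Zb) ^ (j * s) * (Z * Zb) ^ s"
        unfolding Suc power_add[symmetric] by (simp_all add: add.commute)
      have "bconst a * (r * x) + bconst (b - a) * (r * r' * y) = bconst b * (r * r' * y) + bconst a * (r * (x - r' * y))"
        for a b and r r' x y :: bipoly
        by (simp only: bconst_diff) (simp add: algebra_simps)
      then show ?thesis
        unfolding expand d unfolding R \<beta>_def \<delta>_def Suc[symmetric] by (simp only: Suc nat.case)
    qed
  qed
  have \<beta>\<delta>: "\<beta> k + \<delta> k = bconst (wcoeff n k) * ((Z * Zb) ^ (k * s) * h (u - k) (v - k))"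
    if "k \<le> u" "k < v" for k
  proof -
    define V where "V = v - Suc k"
    have V: "v - k = Suc V" "v - Suc k = V"
      using that by (simp_all add: V_def Suc_diff_Suc)
    have U: "Suc u - k = Suc (u - k)" using that by (simp add: Suc_diff_le)
    have "\<alpha> k + (Zb ^ s * h (Suc u - Suc k) (v - Suc k) - (Z * Zb) ^ s * \<alpha> (Suc k)) = h (u - k) (v - k)"
      using h_Suc_right[of "u - k" V] unfolding \<alpha>_def U V by (simp only: diff_Suc_Suc add_Suc diff_Suc_1)
    then show ?thesis
      unfolding \<beta>_def \<delta>_def distrib_left[symmetric] by (rule arg_cong)
  qed
  have split: "(\<Sum>k\<le>j. f k) = (\<Sum>k<j. f k) + f j" for f :: "nat \<Rightarrow> bipoly" and j
    using sum.lessThan_Suc[of f j] by (simp only: lessThan_Suc_atMost)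
  have "(T ^^ s) (w (Suc u) v) = (\<Sum>k\<le>M. \<beta> k + (case k of 0 \<Rightarrow> 0 | Suc j \<Rightarrow> \<delta> j))"
    unfolding w_def T_funpow_sum T_funpow_bconst_mult M_def[symmetric] add_Suc n_def[symmetric]
    by (intro sum.cong refl summand) simp
  also have "\<dots> = (\<Sum>k<M. \<beta> k + \<delta> k) + \<beta> M"
    unfolding sum.distrib sum.atMost_shift[of "\<lambda>k. case k of 0 \<Rightarrow> 0 | Suc j \<Rightarrow> \<delta> j"]
    by (simp add: split)
  also have "\<dots> = (\<Sum>k<M. bconst (wcoeff n k) * ((Z * Zb) ^ (k * s) * h (u - k) (v - k))) + \<beta> M"
    by (intro arg_cong2[where f = "(+)"] sum.cong refl \<beta>\<delta>) (auto simp: M_def)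
  also have "\<dots> = w u v"
  proof (cases "v \<le> u")
    case True
    then have M: "M = v" "min u v = v" by (auto simp: M_def)
    have "\<alpha> v = h (u - v) 0"
      using h_0_right[of "u - v"] True by (simp add: \<alpha>_def Suc_diff_le)
    then show ?thesis
      by (simp add: M w_def n_def[symmetric] \<beta>_def split)
  next
    case False
    then have M: "M = Suc u" "min u v = u" by (auto simp: M_def)
    \<comment> \<open>Either \<open>A 0 V = 0\<close> for positive \<open>V\<close>, or the total
      index is 0 and \<open>st 0 = 0\<close>.\<close>
    have "\<alpha> (Suc u) = 0"
      by (cases "v - Suc u = 0") (simp_all add: \<alpha>_def A_0_left szt_def)
    then show ?thesis
      by (simp add: M w_def n_def[symmetric] \<beta>_def lessThan_Suc_atMost)
  qed
  finally show ?thesis .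
qed

lemma T_funpow_s_w_0: "(T ^^ s) (w 0 v) = 0"
proof -
  have "fall 0 s = 0" using fall_of_nat_eq_0[of 0 s] s_pos by simp
  moreover have "st v * A 0 v = 0"
    by (cases v) (simp_all add: szt_def A_0_left)
  ultimately show ?thesis
    unfolding w_def T_funpow_sum T_funpow_bconst_mult T_funpow_s_h by simp
qed

end

section \<open>Homogeneous polynomials\<close>

lemma homogeneous_iff_zero: "homogeneous d f \<longleftrightarrow> (\<forall>a b. a + b \<noteq> d \<longrightarrow> coeff (coeff f a) b = 0)"
  by (auto simp: homogeneous_def)

lemma homogeneous_0 [simp]: "homogeneous d 0"
  and homogeneous_add: "homogeneous d f \<Longrightarrow> homogeneous d g \<Longrightarrow> homogeneous d (f + g)"
  and homogeneous_diff: "homogeneous d f \<Longrightarrow> homogeneous d g \<Longrightarrow> homogeneous d (f - g)"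
  and homogeneous_bconst_mult: "homogeneous d f \<Longrightarrow> homogeneous d (bconst c * f)"
  by (simp_all add: homogeneous_iff_zero)

lemma homogeneous_1: "homogeneous 0 1"
  by (simp add: homogeneous_iff_zero coeff_1)

lemma homogeneous_Z_mult: "homogeneous d f \<Longrightarrow> homogeneous (Suc d) (Z * f)"
  and homogeneous_Zb_mult: "homogeneous d f \<Longrightarrow> homogeneous (Suc d) (Zb * f)"
  by (auto simp: homogeneous_iff_zero coeff_Z_mult coeff_Zb_mult)

lemma homogeneous_Z_power_mult: "homogeneous d f \<Longrightarrow> homogeneous (i + d) (Z ^ i * f)"
  by (induction i) (simp_all add: homogeneous_Z_mult mult.assoc)

lemma homogeneous_Zb_power_mult: "homogeneous d f \<Longrightarrow> homogeneous (i + d) (Zb ^ i * f)"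
  by (induction i) (simp_all add: homogeneous_Zb_mult mult.assoc)

lemma homogeneous_swap: "homogeneous d f \<Longrightarrow> homogeneous d (swap f)"
  by (auto simp: homogeneous_iff_zero coeff_swap add.commute)

lemma homogeneous_sum: "(\<And>i. i \<in> I \<Longrightarrow> homogeneous d (f i)) \<Longrightarrow> homogeneous d (\<Sum>i\<in>I. f i)"
  by (induction I rule: infinite_finite_induct) (simp_all add: homogeneous_add)

lemma homogeneous_monomial: "homogeneous (a + b) (Z ^ a * Zb ^ b)"
  using homogeneous_Z_power_mult[OF homogeneous_Zb_power_mult[OF homogeneous_1], of a b] by simp

lemma coeff_Z_power_mult:
  "coeff (coeff (Z ^ n * f) a) b = (if a < n then 0 else coeff (coeff f (a - n)) b)"
  by (induction n arbitrary: a) (auto simp: mult.assoc coeff_Z_mult)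

lemma coeff_Zb_power_mult:
  "coeff (coeff (Zb ^ n * f) a) b = (if b < n then 0 else coeff (coeff f a) (b - n))"
  by (induction n arbitrary: b) (auto simp: mult.assoc coeff_Zb_mult)

lemma coeff_monomial:
  "coeff (coeff (Z ^ a * Zb ^ b) i) j = (if i = a \<and> j = b then 1 else 0)"
  using coeff_Z_power_mult[of a "Zb ^ b" i j] coeff_Zb_power_mult[of b 1 "i - a" j]
  by (auto simp: coeff_1)

lemma coeff_bipoly_sum: "coeff (coeff (\<Sum>i\<in>I. f i :: bipoly) a) b = (\<Sum>i\<in>I. coeff (coeff (f i) a) b)"
  by (simp add: coeff_sum)

lemma homogeneous_eq_sum:
  assumes "homogeneous d f"
  shows "f = (\<Sum>a\<le>d. bconst (coeff (coeff f a) (d - a)) * (Z ^ a * Zb ^ (d - a)))"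
proof (intro poly_eqI)
  fix i j
  have "coeff (coeff (\<Sum>a\<le>d. bconst (coeff (coeff f a) (d - a)) * (Z ^ a * Zb ^ (d - a))) i) j
    = (\<Sum>a\<le>d. if a = i then (if i + j = d then coeff (coeff f i) j else 0) else 0)"
    unfolding coeff_bipoly_sum by (intro sum.cong) (auto simp: coeff_monomial)
  also have "\<dots> = coeff (coeff f i) j"
    using assms by (auto simp: homogeneous_iff_zero)
  finally show "coeff (coeff f i) j
    = coeff (coeff (\<Sum>a\<le>d. bconst (coeff (coeff f a) (d - a)) * (Z ^ a * Zb ^ (d - a))) i) j" ..
qed

lemma coeff_pderivb: "coeff (coeff (pderivb f) a) b = of_nat (Suc b) * coeff (coeff f a) (Suc b)"
  by (simp add: coeff_map_poly coeff_pderiv)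

lemma coeff_pderiv_bipoly: "coeff (coeff (pderiv f) a) b = of_nat (Suc a) * coeff (coeff f (Suc a)) b"
  for f :: bipoly
proof -
  have "coeff (pderiv f) a = smult (of_nat (Suc a)) (coeff f (Suc a))"
    by (simp add: coeff_pderiv of_nat_poly)
  then show ?thesis by simp
qed

lemma pderiv_funpow_eq_0_coeff:
  fixes f :: bipoly
  shows "(pderiv ^^ n) f = 0 \<Longrightarrow> n \<le> a \<Longrightarrow> coeff (coeff f a) b = 0"
proof (induction n arbitrary: f a)
  case (Suc n)
  then obtain c where "a = Suc c" by (cases a) auto
  moreover have "(pderiv ^^ n) (pderiv f) = 0"
    using Suc.prems(1) by (simp add: funpow_swap1)
  ultimately have "coeff (coeff (pderiv f) c) b = 0"
    using Suc.prems(2) by (intro Suc.IH) auto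
  then show ?case
    using \<open>a = Suc c\<close> by (auto simp: coeff_pderiv_bipoly simp del: of_nat_Suc)
qed simp

lemma pderivb_funpow_eq_0_coeff: "(pderivb ^^ n) f = 0 \<Longrightarrow> n \<le> b \<Longrightarrow> coeff (coeff f a) b = 0"
proof (induction n arbitrary: f b)
  case (Suc n)
  then obtain c where "b = Suc c" by (cases b) auto
  moreover have "(pderivb ^^ n) (pderivb f) = 0"
    using Suc.prems(1) by (simp add: funpow_swap1)
  ultimately have "coeff (coeff (pderivb f) a) c = 0"
    using Suc.prems(2) by (intro Suc.IH) auto
  then show ?case
    using \<open>b = Suc c\<close> by (auto simp: coeff_pderivb simp del: of_nat_Suc)
qed simp

text \<open>The division by factorials turns both partial derivatives into pure exponent
  shifts.\<close>

definition dmonom :: "nat \<Rightarrow> nat \<Rightarrow> bipoly" where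
  "dmonom a b = bconst (1 / (fact a * fact b)) * (Z ^ a * Zb ^ b)"

lemma dmonom_0_0 [simp]: "dmonom 0 0 = 1"
  by (simp add: dmonom_def)

lemma swap_dmonom: "swap (dmonom a b) = dmonom b a"
  by (simp add: dmonom_def swap_hom mult.commute)

lemma pderiv_dmonom: "pderiv (dmonom a b) = (if a = 0 then 0 else dmonom (a - 1) b)"
proof (cases a)
  case (Suc n)
  have "bconst (1 / (fact a * fact b)) * of_nat (Suc n) = bconst (1 / (fact n * fact b))"
    unfolding bconst_of_nat[symmetric] bconst_mult[symmetric] by (simp add: Suc del: of_nat_Suc)
  moreover have "pderiv (Z ^ Suc n * Zb ^ b) = of_nat (Suc n) * (Z ^ n * Zb ^ b)"
    by (simp only: pderiv_mult pderiv_power pderiv_Z pderiv_Zb diff_Suc_1) (simp add: mult_ac)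
  ultimately show ?thesis
    unfolding dmonom_def Suc pderiv_mult[of "bconst _"] by (simp flip: mult.assoc)
qed (simp add: dmonom_def pderiv_mult pderiv_power)

lemma pderivb_dmonom: "pderivb (dmonom a b) = (if b = 0 then 0 else dmonom a (b - 1))"
  using swap_pderiv[of "dmonom b a"] by (auto simp: swap_dmonom pderiv_dmonom)

lemma pderiv_funpow_dmonom: "(pderiv ^^ k) (dmonom a b) = (if a < k then 0 else dmonom (a - k) b)"
  by (induction k) (auto simp: pderiv_dmonom)

lemma pderivb_funpow_dmonom: "(pderivb ^^ k) (dmonom a b) = (if b < k then 0 else dmonom a (b - k))"
  by (induction k) (auto simp: pderivb_dmonom)

context nonsingular
begin

lemma homogeneous_F: "homogeneous (m * s) (F m)"
proof (induction m)
  case (Suc m)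
  have "homogeneous (s + m * s) (Z ^ s * F m)" "homogeneous (s + m * s) (Zb ^ s * swap (F m))"
    by (intro homogeneous_Z_power_mult homogeneous_Zb_power_mult homogeneous_swap Suc)+
  then show ?case
    by (simp add: F_Suc mult.assoc homogeneous_add homogeneous_bconst_mult)
qed (simp add: homogeneous_1)

lemma homogeneous_w: "homogeneous ((u + v) * s) (w u v)"
  unfolding w_def
proof (intro homogeneous_sum homogeneous_bconst_mult)
  fix k assume "k \<in> {..min u v}"
  then have "k * s + (k * s + (u - k + (v - k)) * s) = (u + v) * s"
    by (simp flip: distrib_right)
  moreover have "homogeneous ((u - k + (v - k)) * s) (h (u - k) (v - k))"
    unfolding h_def using homogeneous_swap[OF homogeneous_F]
    by (intro homogeneous_add homogeneous_bconst_mult homogeneous_F) simp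
  then have "homogeneous (k * s + (k * s + (u - k + (v - k)) * s)) (Z ^ (k * s) * (Zb ^ (k * s) * h (u - k) (v - k)))"
    by (intro homogeneous_Z_power_mult homogeneous_Zb_power_mult)
  ultimately show "homogeneous ((u + v) * s) ((Z * Zb) ^ (k * s) * h (u - k) (v - k))"
    by (simp add: power_mult_distrib mult.assoc)
qed

lemma Tb_funpow_eq: "(Tb ^^ i) f = swap ((T ^^ i) (swap f))"
  by (induction i) (simp_all add: Tb_eq)

lemma Tb_funpow_s_w_Suc: "(Tb ^^ s) (w u (Suc v)) = w u v"
  by (simp add: Tb_funpow_eq swap_w T_funpow_s_w_Suc)

lemma Tb_funpow_s_w_0: "(Tb ^^ s) (w u 0) = 0"
  by (simp add: Tb_funpow_eq swap_w T_funpow_s_w_0)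

definition TT :: "bipoly \<Rightarrow> bipoly" where "TT f = T (Tb f)"

lemma TT_add: "TT (f + g) = TT f + TT g"
  by (simp add: TT_def Tb_eq swap_add T_add)

lemma TT_bconst_mult: "TT (bconst c * f) = bconst c * TT f"
  by (simp add: TT_def Tb_eq swap_mult T_bconst_mult)

lemma TT_diff: "TT (f - g) = TT f - TT g"
  by (simp add: TT_def Tb_eq swap_diff T_diff)

lemma TT_funpow_bconst_mult: "(TT ^^ i) (bconst c * f) = bconst c * (TT ^^ i) f"
  by (induction i) (simp_all add: TT_bconst_mult)

lemma TT_funpow_sum: "(TT ^^ i) (\<Sum>k\<in>I. f k) = (\<Sum>k\<in>I. (TT ^^ i) (f k))"
proof -
  have "(TT ^^ i) 0 = 0"
    using TT_funpow_bconst_mult[of i 0 0] by simp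
  moreover have "(TT ^^ i) (f + g) = (TT ^^ i) f + (TT ^^ i) g" for f g
    by (induction i) (simp_all add: TT_add)
  ultimately show ?thesis
    by (induction I rule: infinite_finite_induct) simp_all
qed

text \<open>The \<open>F\<close> and \<open>G\<close> components receive the same scalar, which
  depends only on \<open>P\<close> and \<open>U + V\<close>; hence \<open>h\<close> is preserved as
  a whole.\<close>

lemma TT_rho_power_h:
  "TT ((Z * Zb) ^ P * h U V)
    = bconst (of_nat P * (\<gamma> + of_nat (P + (U + V) * s))) * ((Z * Zb) ^ (P - 1) * h U V)"
proof -
  have "(Z * Zb) ^ P * h U V = bconst (A U V) * ((Z * Zb) ^ P * F (U + V))
      + bconst (A V U) * ((Z * Zb) ^ P * G (U + V))" for P
    by (simp add: h_def algebra_simps)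
  note expand = this
  have c: "of_nat P * (of_nat P + of_nat ((U + V) * s) + \<gamma>) = of_nat P * (\<gamma> + of_nat (P + (U + V) * s))"
    by simp
  show ?thesis
    unfolding expand TT_add TT_bconst_mult
    unfolding TT_def T_T_bar_F T_T_bar_G c by (simp only: distrib_left mult_ac)
qed

lemma TT_funpow_rho_power_h:
  "(TT ^^ i) ((Z * Zb) ^ P * h U V)
    = bconst (fall (of_nat P) i * fall (\<gamma> + of_nat (P + (U + V) * s)) i) * ((Z * Zb) ^ (P - i) * h U V)"
proof (induction i)
  case (Suc i)
  define Q where "Q = \<gamma> + of_nat (P + (U + V) * s)"
  have "fall (of_nat P) i * fall Q i * (of_nat (P - i) * (\<gamma> + of_nat (P - i + (U + V) * s)))
    = fall (of_nat P) (Suc i) * fall Q (Suc i)"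
  proof (cases "i \<le> P")
    case True
    then show ?thesis by (simp add: fall_Suc Q_def of_nat_diff algebra_simps)
  next
    case False
    then show ?thesis by (simp add: fall_Suc fall_of_nat_eq_0)
  qed
  moreover have "(TT ^^ Suc i) ((Z * Zb) ^ P * h U V)
    = bconst (fall (of_nat P) i * fall Q i)
      * (bconst (of_nat (P - i) * (\<gamma> + of_nat (P - i + (U + V) * s))) * ((Z * Zb) ^ (P - i - 1) * h U V))"
    using Suc by (simp only: funpow.simps o_apply TT_bconst_mult TT_rho_power_h Q_def)
  ultimately show ?case
    unfolding Q_def[symmetric] by (simp add: bconst_mult[symmetric] mult.assoc[symmetric])
qed simp

definition wr :: "nat \<Rightarrow> nat \<Rightarrow> nat \<Rightarrow> bipoly" where
  "wr r u v = (\<Sum>k\<le>min u v. bconst (1 / (fact (k * s + r) * pochhammer (\<gamma> + 1) ((u + v - k) * s + r)))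
     * ((Z * Zb) ^ (k * s + r) * h (u - k) (v - k)))"

text \<open>The summand \<open>k = 0\<close> contains no power of \<open>Z * Zb\<close> and is
  annihilated. In each of the others the two falling factorials shorten the factorial and the
  Pochhammer symbol by \<open>s - r\<close>, and \<open>k\<close> is renumbered by one.\<close>

lemma TT_funpow_w:
  assumes "r < s"
  shows "(TT ^^ (s - r)) (w (Suc u) (Suc v)) = wr r u v"
proof -
  define j where "j = s - r"
  have j: "0 < j" "j + r = s" using assms by (auto simp: j_def)
  define f where "f k = bconst (wcoeff (Suc u + Suc v) k) * (TT ^^ j) ((Z * Zb) ^ (k * s) * h (Suc u - k) (Suc v - k))" for k
  have "f 0 = 0"
  proof -
    have "fall (of_nat (0 * s)) j = 0" using j by (intro fall_of_nat_eq_0) simp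
    then show ?thesis unfolding f_def TT_funpow_rho_power_h by simp
  qed
  moreover have "f (Suc k) = bconst (1 / (fact (k * s + r) * pochhammer (\<gamma> + 1) ((u + v - k) * s + r)))
     * ((Z * Zb) ^ (k * s + r) * h (u - k) (v - k))" if "k \<le> min u v" for k
  proof -
    define P where "P = Suc k * s"
    define N where "N = (Suc u + Suc v - Suc k) * s"
    have "Suc k + (u - k + (v - k)) = Suc u + Suc v - Suc k" using that by arith
    then have "P + (u - k + (v - k)) * s = N"
      unfolding P_def N_def distrib_right[symmetric] by (rule arg_cong)
    have "k \<le> u + v" using that by simp
    then have "Suc u + Suc v - Suc k = Suc (u + v - k)" by (simp add: Suc_diff_le)
    then have N: "j \<le> N" "N - j = (u + v - k) * s + r" using j unfolding N_def by auto
    have P: "j \<le> P" "P - j = k * s + r" using j unfolding P_def by auto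
    have 1: "fact P = fall (of_nat P) j * fact (k * s + r)"
      using fall_of_nat_fact[OF P(1)] by (simp add: P(2))
    have 2: "pochhammer (\<gamma> + 1) N = fall (\<gamma> + of_nat N) j * pochhammer (\<gamma> + 1) ((u + v - k) * s + r)"
      using fall_pochhammer[OF N(1), of \<gamma>] by (simp add: N(2))
    have nz: "fall (of_nat P) j \<noteq> 0" "fall (\<gamma> + of_nat N) j \<noteq> 0"
      using 1 2 fact_nonzero[of P, where 'a = complex] pochhammer_\<gamma>_neq_0[of N] by auto
    have "wcoeff (Suc u + Suc v) (Suc k) = 1 / (fact P * pochhammer (\<gamma> + 1) N)"
      by (simp only: wcoeff_def P_def N_def)
    also have "\<dots> * (fall (of_nat P) j * fall (\<gamma> + of_nat N) j)
      = 1 / (fact (k * s + r) * pochhammer (\<gamma> + 1) ((u + v - k) * s + r))"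
      unfolding 1 2 using nz by (simp add: field_simps)
    finally show ?thesis
      unfolding f_def P_def[symmetric] TT_funpow_rho_power_h diff_Suc_Suc
        \<open>P + (u - k + (v - k)) * s = N\<close> P(2) mult.assoc[symmetric] bconst_mult[symmetric]
      by (simp only: mult.assoc)
  qed
  ultimately have "(\<Sum>k\<le>Suc (min u v). f k) = wr r u v"
    unfolding sum.atMost_Suc_shift wr_def by simp
  moreover have "(TT ^^ j) (w (Suc u) (Suc v)) = (\<Sum>k\<le>Suc (min u v). f k)"
    unfolding w_def TT_funpow_sum TT_funpow_bconst_mult f_def min_Suc_Suc ..
  ultimately show ?thesis by (simp add: j_def)
qed

end

section \<open>The intertwining operator\<close>

context nonsingular
begin

text \<open>By \<open>f0_Suc\<close> and \<open>f1_Suc\<close> the two parts in degree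
  \<open>m + 1\<close> are multiples of \<open>Z f + Zb swap f\<close> and
  \<open>Z f - Zb swap f\<close> with \<open>f = ff m\<close>. Their coefficients are thus the sum
  and the difference of the very coefficients that define \<open>A U V\<close> and
  \<open>A V U\<close>.\<close>

lemma lam0_cf_f0: "U + V = Suc m \<Longrightarrow> lam0 \<kappa>0 \<kappa>1 (Suc m) * cf (f0 \<kappa>0 \<kappa>1 (Suc m)) (int U) (int V) = A U V + A V U"
  and lam1_cf_f1: "U + V = Suc m \<Longrightarrow> lam1 \<kappa>0 \<kappa>1 (Suc m) * cf (f1 \<kappa>0 \<kappa>1 (Suc m)) (int U) (int V) = A U V - A V U"
proof -
  assume UV: "U + V = Suc m"
  define X where "X = cf (ff \<kappa>0 \<kappa>1 m) (int U - 1) (int V)"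
  define Y where "Y = cf (ff \<kappa>0 \<kappa>1 m) (int V - 1) (int U)"
  have A: "A U V = X / \<nu> (Suc m)" "A V U = Y / \<nu> (Suc m)"
    using UV by (simp_all add: A_def X_def Y_def add.commute)
  have "of_nat n + \<kappa>0 + \<kappa>1 + 1 \<noteq> 0" for n
    using \<kappa>01_neq[of "Suc n"] by (simp add: add_ac)
  note f1 = f1_Suc[OF this]
  have swap_ff: "swap (ff \<kappa>0 \<kappa>1 m) = f0 \<kappa>0 \<kappa>1 m - f1 \<kappa>0 \<kappa>1 m"
    by (simp add: ff_def swap_add swap_f0 swap_f1)
  have "f0 \<kappa>0 \<kappa>1 (Suc m) = bconst (p m * (1/2)) * (Z * ff \<kappa>0 \<kappa>1 m + Zb * swap (ff \<kappa>0 \<kappa>1 m))"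
    unfolding f0_Suc swap_ff unfolding ff_def bconst_mult by (simp add: algebra_simps)
  then have f0: "cf (f0 \<kappa>0 \<kappa>1 (Suc m)) (int U) (int V) = p m * (1/2) * (X + Y)"
    by (simp only: cf_bconst_mult cf_add cf_Z_mult cf_Zb_mult cf_swap X_def Y_def)
  show "lam0 \<kappa>0 \<kappa>1 (Suc m) * cf (f0 \<kappa>0 \<kappa>1 (Suc m)) (int U) (int V) = A U V + A V U"
    unfolding lam0_Suc A f0 by (simp add: add_divide_distrib)
  have "f1 \<kappa>0 \<kappa>1 (Suc m) = bconst (q m * (1/2)) * (Z * ff \<kappa>0 \<kappa>1 m - Zb * swap (ff \<kappa>0 \<kappa>1 m))"
    unfolding f1 swap_ff unfolding ff_def bconst_mult by (simp add: algebra_simps)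
  then have f1: "cf (f1 \<kappa>0 \<kappa>1 (Suc m)) (int U) (int V) = q m * (1/2) * (X - Y)"
    by (simp only: cf_bconst_mult cf_diff cf_Z_mult cf_Zb_mult cf_swap X_def Y_def)
  show "lam1 \<kappa>0 \<kappa>1 (Suc m) * cf (f1 \<kappa>0 \<kappa>1 (Suc m)) (int U) (int V) = A U V - A V U"
    unfolding lam1_Suc A f1 by (simp add: diff_divide_distrib)
qed

lemma F_eq: "F m = subst2 (f0 \<kappa>0 \<kappa>1 m) (Z ^ s) (Zb ^ s) + subst2 (f1 \<kappa>0 \<kappa>1 m) (Z ^ s) (Zb ^ s)"
  by (simp add: F_def ff_def subst2_add)

lemma G_eq: "G m = subst2 (f0 \<kappa>0 \<kappa>1 m) (Z ^ s) (Zb ^ s) - subst2 (f1 \<kappa>0 \<kappa>1 m) (Z ^ s) (Zb ^ s)"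
proof -
  have "G m = subst2 (swap (ff \<kappa>0 \<kappa>1 m)) (Z ^ s) (Zb ^ s)"
    by (simp add: G_def subst2_swap)
  then show ?thesis
    by (simp add: ff_def swap_add swap_f0 swap_f1 subst2_diff)
qed

lemma half_mult_double: "bconst (1/2) * (bconst c * (f + f)) = bconst c * f"
proof -
  have "bconst (1/2) * (g + g) = g" for g
    unfolding distrib_left distrib_right[symmetric] bconst_add[symmetric] by simp
  then show ?thesis by (simp only: distrib_left)
qed

lemma half_h_add:
  "bconst (1/2) * (h U V + h V U) = bconst (lam0 \<kappa>0 \<kappa>1 (U + V) * cf (f0 \<kappa>0 \<kappa>1 (U + V)) (int U) (int V))
     * subst2 (f0 \<kappa>0 \<kappa>1 (U + V)) (Z ^ s) (Zb ^ s)"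
proof (cases "U + V")
  case 0
  have "f0 \<kappa>0 \<kappa>1 0 = 1"
    using f0_even[of \<kappa>0 \<kappa>1 0] by (simp add: homogenize_def scal_bconst)
  then show ?thesis
    using 0 half_mult_double[of 1 1] by (simp add: lam0_def cf_def coeff_1)
next
  case (Suc m)
  have "V + U = Suc m" using Suc by simp
  then have "h U V + h V U = bconst (A U V + A V U) * (F (Suc m) + G (Suc m))"
    unfolding h_def Suc bconst_add by (simp add: algebra_simps)
  also have "F (Suc m) + G (Suc m)
    = subst2 (f0 \<kappa>0 \<kappa>1 (Suc m)) (Z ^ s) (Zb ^ s) + subst2 (f0 \<kappa>0 \<kappa>1 (Suc m)) (Z ^ s) (Zb ^ s)"
    unfolding F_eq G_eq by simp
  finally show ?thesis
    by (simp only: half_mult_double lam0_cf_f0[OF Suc] Suc)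
qed

lemma half_h_diff:
  assumes "U + V > 0"
  shows "bconst (1/2) * (h U V - h V U)
    = bconst (lam1 \<kappa>0 \<kappa>1 (U + V) * cf (f1 \<kappa>0 \<kappa>1 (U + V)) (int U) (int V))
      * subst2 (f1 \<kappa>0 \<kappa>1 (U + V)) (Z ^ s) (Zb ^ s)"
proof -
  obtain m where Suc: "U + V = Suc m" using assms by (cases "U + V") auto
  have "V + U = Suc m" using Suc by simp
  then have "h U V - h V U = bconst (A U V - A V U) * (F (Suc m) - G (Suc m))"
    unfolding h_def Suc bconst_diff by (simp add: algebra_simps)
  also have "F (Suc m) - G (Suc m)
    = subst2 (f1 \<kappa>0 \<kappa>1 (Suc m)) (Z ^ s) (Zb ^ s) + subst2 (f1 \<kappa>0 \<kappa>1 (Suc m)) (Z ^ s) (Zb ^ s)"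
    unfolding F_eq G_eq by simp
  finally show ?thesis
    by (simp only: half_mult_double lam1_cf_f1[OF Suc] Suc)
qed

definition wr_denom :: "nat \<Rightarrow> nat \<Rightarrow> nat \<Rightarrow> nat \<Rightarrow> complex" where
  "wr_denom r u v k = fact (k * s + r) * pochhammer (of_nat s * \<kappa>0 + of_nat s * \<kappa>1 + 1) ((v * s + r) + (u - k) * s)"

lemma wr_eq:
  assumes "v \<le> u"
  shows "wr r u v = (\<Sum>k\<le>v. bconst (1 / wr_denom r u v k) * ((Z * Zb) ^ (k * s + r) * h (u - k) (v - k)))"
    and "wr r v u = (\<Sum>k\<le>v. bconst (1 / wr_denom r u v k) * ((Z * Zb) ^ (k * s + r) * h (v - k) (u - k)))"
proof -
  have "wr_denom r u v k = fact (k * s + r) * pochhammer (\<gamma> + 1) ((u + v - k) * s + r)" if "k \<le> v" for k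
  proof -
    have "(v * s + r) + (u - k) * s = (v + (u - k)) * s + r"
      by (simp add: distrib_right)
    also have "v + (u - k) = u + v - k" using that assms by simp
    finally have "(v * s + r) + (u - k) * s = (u + v - k) * s + r" .
    then show ?thesis by (simp only: wr_denom_def \<gamma>_def distrib_left)
  qed
  then show "wr r u v = (\<Sum>k\<le>v. bconst (1 / wr_denom r u v k) * ((Z * Zb) ^ (k * s + r) * h (u - k) (v - k)))"
    "wr r v u = (\<Sum>k\<le>v. bconst (1 / wr_denom r u v k) * ((Z * Zb) ^ (k * s + r) * h (v - k) (u - k)))"
    using assms unfolding wr_def by (simp_all add: add.commute)
qed

lemma h_eq_ff:
  assumes "U + V > 0"
  shows "h U V = bconst (inverse (\<nu> (U + V)))
    * (bconst (cf (ff \<kappa>0 \<kappa>1 (U + V - 1)) (int U - 1) (int V)) * F (U + V)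
     + bconst (cf (ff \<kappa>0 \<kappa>1 (U + V - 1)) (int V - 1) (int U)) * G (U + V))"
proof -
  have "A U V = inverse (\<nu> (U + V)) * cf (ff \<kappa>0 \<kappa>1 (U + V - 1)) (int U - 1) (int V)"
    "A V U = inverse (\<nu> (U + V)) * cf (ff \<kappa>0 \<kappa>1 (U + V - 1)) (int V - 1) (int U)"
    using assms unfolding A_def add.commute[of V U] divide_inverse_commute by simp_all
  then show ?thesis
    unfolding h_def by (simp only: bconst_mult distrib_left mult.assoc)
qed

end

locale intertwiner = nonsingular +
  fixes V :: "bipoly \<Rightarrow> bipoly"
  assumes intertwining_V: "intertwining s \<kappa>0 \<kappa>1 V"
begin

lemma linear_V: "Vector_Spaces.linear scal scal V"
  using intertwining_V by (simp add: intertwining_def)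

lemma V_add: "V (f + g) = V f + V g"
  and V_bconst_mult: "V (bconst c * f) = bconst c * V f"
  using linear_V by (auto simp: Vector_Spaces.linear_iff scal_bconst)

lemma V_0 [simp]: "V 0 = 0"
  using V_bconst_mult[of 0 0] by simp

lemma V_diff: "V (f - g) = V f - V g"
  using V_add[of "f - g" g] by (simp add: algebra_simps)

lemma V_bconst [simp]: "V (bconst c) = bconst c"
  using V_bconst_mult[of c 1] intertwining_V by (simp add: intertwining_def)

lemma T_V: "T (V f) = V (pderiv f)" and Tb_V: "Tb (V f) = V (pderivb f)"
  and homogeneous_V: "homogeneous d f \<Longrightarrow> homogeneous d (V f)"
  using intertwining_V by (simp_all add: intertwining_def)

lemma T_funpow_V: "(T ^^ k) (V f) = V ((pderiv ^^ k) f)"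
  by (induction k) (simp_all add: T_V)

lemma Tb_funpow_V: "(Tb ^^ k) (V f) = V ((pderivb ^^ k) f)"
  by (induction k) (simp_all add: Tb_V)

lemma V_eq_0D_const: "V [:c:] = 0 \<Longrightarrow> c = 0"
proof (induction "degree c" arbitrary: c rule: less_induct)
  case less
  have "V [:pderiv c:] = 0"
    using Tb_V[of "[:c:]"] less.prems T_0 by (simp add: map_poly_pCons Tb_eq)
  then have "degree c = 0"
    using less.hyps[of "pderiv c"] by (cases "degree c = 0") (auto simp: degree_pderiv pderiv_eq_0_iff)
  then obtain a where "c = [:a:]" by (elim degree_eq_zeroE)
  then show ?case using less.prems V_bconst[of a] by (simp add: bconst_def)
qed

text \<open>From \<open>V (pderiv f) = T (V f) = 0\<close>, induction on the degree yields
  \<open>pderiv f = 0\<close>, so \<open>f\<close> does not involve \<open>Z\<close>.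
  \<open>V_eq_0D_const\<close> argues in the same way in \<open>Zb\<close>.\<close>

lemma V_eq_0D: "V f = 0 \<Longrightarrow> f = 0"
proof (induction "degree f" arbitrary: f rule: less_induct)
  case less
  have "V (pderiv f) = 0"
    using T_V[of f] less.prems by simp
  then have "degree f = 0"
    using less.hyps[of "pderiv f"] by (cases "degree f = 0") (auto simp: degree_pderiv pderiv_eq_0_iff)
  then obtain c where "f = [:c:]" by (elim degree_eq_zeroE)
  then show ?case using less.prems V_eq_0D_const by simp
qed

text \<open>A dimension count: \<open>V\<close> maps the span of the \<open>d + 1\<close> monomials
  of degree \<open>d\<close> injectively into itself, and an element outside the image would give
  \<open>d + 2\<close> independent vectors there.\<close>

lemma homogeneous_in_range_V:
  assumes "homogeneous d f"
  obtains g where "homogeneous d g" "f = V g"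
proof -
  interpret L: Vector_Spaces.linear scal scal V by (rule linear_V)
  define m where "m a = Z ^ a * Zb ^ (d - a)" for a
  define B where "B = m ` {..d}"
  have inj_V: "inj V"
  proof (rule injI)
    fix x y assume "V x = V y"
    then have "V (x - y) = 0" by (simp add: V_diff)
    then show "x = y" using V_eq_0D[of "x - y"] by simp
  qed
  have inj_m: "inj_on m {..d}"
  proof (rule inj_onI)
    fix a b assume "a \<in> {..d}" "b \<in> {..d}" "m a = m b"
    then have "coeff (coeff (m a) a) (d - a) = coeff (coeff (m b) a) (d - a)" by simp
    then show "a = b" by (auto simp: m_def coeff_monomial split: if_splits)
  qed
  have "L.vs1.independent B"
  proof (rule L.vs1.independent_if_scalars_zero)
    show "finite B" by (simp add: B_def)
    fix c x assume sum: "(\<Sum>x\<in>B. scal (c x) x) = 0" and "x \<in> B"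
    then obtain b where b: "b \<le> d" "x = m b" by (auto simp: B_def)
    have "0 = coeff (coeff (\<Sum>a\<le>d. scal (c (m a)) (m a)) b) (d - b)"
      using sum by (simp add: B_def sum.reindex[OF inj_m])
    also have "\<dots> = (\<Sum>a\<le>d. if a = b then c (m b) else 0)"
      unfolding coeff_bipoly_sum scal_bconst by (intro sum.cong) (auto simp: m_def coeff_monomial)
    finally show "c x = 0" using b by simp
  qed
  then have ind: "L.vs1.independent (V ` B)"
    using L.independent_inj_image inj_V by blast
  have in_span: "homogeneous d p \<Longrightarrow> p \<in> L.vs1.span B" for p
  proof -
    assume "homogeneous d p"
    then have p: "p = (\<Sum>a\<le>d. scal (coeff (coeff p a) (d - a)) (m a))"
      unfolding m_def scal_bconst by (rule homogeneous_eq_sum)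
    show "p \<in> L.vs1.span B"
      by (subst p, intro L.vs1.span_sum L.vs1.span_scale L.vs1.span_base) (auto simp: B_def)
  qed
  have hom_B: "homogeneous d x" if "x \<in> B" for x
  proof -
    from that obtain a where "a \<le> d" "x = m a" by (auto simp: B_def)
    then show ?thesis using homogeneous_monomial[of a "d - a"] by (simp add: m_def)
  qed
  then have "homogeneous d (V x)" if "x \<in> B" for x
    using that by (intro homogeneous_V)
  then have sub: "insert f (V ` B) \<subseteq> L.vs1.span B"
    using in_span assms by blast
  have "f \<in> L.vs1.span (V ` B)"
  proof (rule ccontr)
    assume f: "f \<notin> L.vs1.span (V ` B)"
    then have "L.vs1.independent (insert f (V ` B))"
      using ind by (rule L.vs1.independent_insertI)
    then have "card (insert f (V ` B)) \<le> card B"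
      using L.vs1.independent_span_bound[of B] sub by (auto simp: B_def)
    moreover have "f \<notin> V ` B"
      using f L.vs1.span_base by blast
    ultimately show False
      by (simp add: B_def card_image inj_on_subset[OF inj_V])
  qed
  then obtain g where g: "g \<in> L.vs1.span B" "f = V g"
    using L.span_image by blast
  have "L.vs1.subspace {p. homogeneous d p}"
    by (rule L.vs1.subspaceI) (simp_all add: homogeneous_add scal_bconst homogeneous_bconst_mult)
  then have "homogeneous d g"
    using L.vs1.span_minimal[of B "{p. homogeneous d p}"] hom_B g(1) by blast
  then show thesis using that g(2) by blast
qed

lemma T_funpow_V_dmonom: "(T ^^ k) (V (dmonom a b)) = (if a < k then 0 else V (dmonom (a - k) b))"
  by (simp add: T_funpow_V pderiv_funpow_dmonom)

lemma Tb_funpow_V_dmonom: "(Tb ^^ k) (V (dmonom a b)) = (if b < k then 0 else V (dmonom a (b - k)))"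
  by (simp add: Tb_funpow_V pderivb_funpow_dmonom)

lemma TT_V: "TT (V f) = V (pderiv (pderivb f))"
  by (simp add: TT_def T_V Tb_V)

lemma TT_funpow_V_dmonom: "k \<le> a \<Longrightarrow> k \<le> b \<Longrightarrow> (TT ^^ k) (V (dmonom a b)) = V (dmonom (a - k) (b - k))"
  by (induction k) (simp_all add: TT_V pderiv_dmonom pderivb_dmonom)

lemma Tb_diff: "Tb (f - g) = Tb f - Tb g"
  by (simp add: Tb_eq swap_diff T_diff)

lemma T_funpow_diff: "(T ^^ k) (f - g) = (T ^^ k) f - (T ^^ k) g"
  by (induction k) (simp_all add: T_diff)

lemma Tb_funpow_diff: "(Tb ^^ k) (f - g) = (Tb ^^ k) f - (Tb ^^ k) g"
  by (induction k) (simp_all add: Tb_diff)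

text \<open>If one index is 0, the sum reduces to the harmonic term \<open>h u v\<close>.\<close>

lemma TT_w_0: "u = 0 \<or> v = 0 \<Longrightarrow> TT (w u v) = 0"
proof -
  assume "u = 0 \<or> v = 0"
  then have "w u v = bconst (wcoeff (u + v) 0) * ((Z * Zb) ^ 0 * h u v)"
    by (auto simp: w_def)
  then show ?thesis
    unfolding TT_bconst_mult TT_rho_power_h by (simp only: TT_bconst_mult TT_rho_power_h) simp
qed

text \<open>The difference of both sides is \<open>V g\<close> for some homogeneous \<open>g\<close>; since \<open>V\<close> is injective and
  intertwines, the \<open>s\<close>-th derivatives of \<open>g\<close> with respect to both variables vanish. For
  \<open>u + v \<ge> 2\<close> the degree then forces \<open>g = 0\<close>; for \<open>u + v = 1\<close> one also needs the mixed derivative.\<close>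

lemma V_dmonom_eq_w: "V (dmonom (u * s) (v * s)) = w u v"
proof (induction "u + v" arbitrary: u v rule: less_induct)
  case less
  define D where "D = V (dmonom (u * s) (v * s)) - w u v"
  have s: "0 < s" using s_pos by simp
  have TD: "(T ^^ s) D = 0"
  proof (cases u)
    case 0
    then show ?thesis using s by (simp add: D_def T_funpow_diff T_funpow_V_dmonom T_funpow_s_w_0)
  next
    case (Suc u')
    then show ?thesis
      using less[of u' v] by (simp add: D_def T_funpow_diff T_funpow_V_dmonom T_funpow_s_w_Suc)
  qed
  have TbD: "(Tb ^^ s) D = 0"
  proof (cases v)
    case 0
    then show ?thesis using s by (simp add: D_def Tb_funpow_diff Tb_funpow_V_dmonom Tb_funpow_s_w_0)
  next
    case (Suc v')
    then show ?thesis
      using less[of u v'] by (simp add: D_def Tb_funpow_diff Tb_funpow_V_dmonom Tb_funpow_s_w_Suc)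
  qed
  have "homogeneous ((u + v) * s) (V (dmonom (u * s) (v * s)))"
    using homogeneous_monomial[of "u * s" "v * s"]
    by (intro homogeneous_V) (simp add: dmonom_def homogeneous_bconst_mult distrib_right)
  then have hom: "homogeneous ((u + v) * s) D"
    unfolding D_def by (intro homogeneous_diff homogeneous_w)
  then obtain g where hom_g: "homogeneous ((u + v) * s) g" and g: "D = V g"
    by (rule homogeneous_in_range_V)
  have "(pderiv ^^ s) g = 0" "(pderivb ^^ s) g = 0"
    using TD TbD by (auto simp: g T_funpow_V Tb_funpow_V intro: V_eq_0D)
  then have small: "coeff (coeff g i) j = 0" if "s \<le> i \<or> s \<le> j" for i j
    using that pderiv_funpow_eq_0_coeff pderivb_funpow_eq_0_coeff by blast
  show ?case
  proof (cases "u + v = 0")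
    case True
    have "wcoeff 0 0 = 1" by (simp add: wcoeff_def)
    then show ?thesis using True by (simp add: w_def V_bconst[of 1, simplified])
  next
    case False
    have "g = 0"
    proof (intro poly_eqI)
      fix i j
      show "coeff (coeff g i) j = coeff (coeff 0 i) j"
      proof (cases "i < s \<and> j < s \<and> i + j = (u + v) * s")
        case True
        then have "(u + v) * s < 2 * s" by linarith
        then have "u + v < 2" by simp
        then have uv: "u + v = 1" using False by linarith
        have "TT D = 0"
        proof -
          have "u = 0 \<or> v = 0" using uv by auto
          moreover from this have "pderiv (pderivb (dmonom (u * s) (v * s))) = 0"
            by (auto simp: pderivb_dmonom pderiv_dmonom)
          ultimately show ?thesis by (simp add: D_def TT_diff TT_V TT_w_0)
        qed
        then have "pderiv (pderivb g) = 0"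
          by (simp add: g TT_V V_eq_0D)
        then have "coeff (coeff (pderiv (pderivb g)) (i - 1)) (j - 1) = 0" by simp
        \<comment> \<open>Since \<open>i + j = s\<close> while both are below \<open>s\<close>, both
          are positive, and the mixed derivative detects the coefficient.\<close>
        moreover have "Suc (i - 1) = i" "Suc (j - 1) = j"
          using True uv by auto
        ultimately have "of_nat i * (of_nat j * coeff (coeff g i) j) = 0"
          by (simp only: coeff_pderiv_bipoly coeff_pderivb)
        then show ?thesis using True uv by auto
      next
        case False
        then show ?thesis
          using small hom_g by (auto simp: homogeneous_iff_zero not_less)
      qed
    qed
    then show ?thesis using g by (simp add: D_def)
  qed
qed

lemma V_dmonom_eq_wr:
  assumes "r < s"
  shows "V (dmonom (u * s + r) (v * s + r)) = wr r u v"
proof -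
  have "Suc u * s - (s - r) = u * s + r" "Suc v * s - (s - r) = v * s + r"
    using assms by auto
  then have "V (dmonom (u * s + r) (v * s + r)) = (TT ^^ (s - r)) (V (dmonom (Suc u * s) (Suc v * s)))"
    by (subst TT_funpow_V_dmonom) simp_all
  then show ?thesis
    by (simp only: V_dmonom_eq_w TT_funpow_w[OF assms])
qed

lemma V_monomial:
  assumes "r < s"
  shows "V (Z ^ (u * s + r) * Zb ^ (v * s + r))
    = bconst (fact (u * s + r) * fact (v * s + r)) * wr r u v"
proof -
  have "Z ^ (u * s + r) * Zb ^ (v * s + r)
    = bconst (fact (u * s + r) * fact (v * s + r)) * dmonom (u * s + r) (v * s + r)"
    by (simp add: dmonom_def flip: mult.assoc bconst_mult)
  then show ?thesis
    by (simp only: V_bconst_mult V_dmonom_eq_wr[OF assms])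
qed

end

theorem theorem2:
  fixes s a b u v r :: nat and \<kappa>0 \<kappa>1 :: complex and V :: "bipoly \<Rightarrow> bipoly"
  assumes "s \<ge> 1"
    and "\<forall>m::nat. m \<ge> 1 \<longrightarrow> - \<kappa>0 + 1/2 \<noteq> of_nat m"
    and "\<forall>m::nat. m \<ge> 1 \<longrightarrow> - \<kappa>1 + 1/2 \<noteq> of_nat m"
    and "\<forall>m::nat. m \<ge> 1 \<longrightarrow> - of_nat s * (\<kappa>0 + \<kappa>1) \<noteq> of_nat m"
    and "intertwining s \<kappa>0 \<kappa>1 V"
    and "a \<ge> b" and "[a = b] (mod s)"
    and "a = u * s + r" and "b = v * s + r" and "r < s"
  shows
    "(a > b \<longrightarrow>
       V (Z ^ a * Zb ^ b) =
         scal (fact a * fact b)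
           (\<Sum>k\<le>v.
              scal (inverse (nu \<kappa>0 \<kappa>1 (u + v - 2 * k))
                    / (fact (k * s + r)
                       * pochhammer (of_nat s * \<kappa>0 + of_nat s * \<kappa>1 + 1) (b + (u - k) * s)))
                ((Z * Zb) ^ (k * s + r) *
                  (scal (cf (ff \<kappa>0 \<kappa>1 (u + v - 2 * k - 1)) (int u - int k - 1) (int v - int k))
                     (subst2 (ff \<kappa>0 \<kappa>1 (u + v - 2 * k)) (Z ^ s) (Zb ^ s))
                   + scal (cf (ff \<kappa>0 \<kappa>1 (u + v - 2 * k - 1)) (int v - int k - 1) (int u - int k))
                     (subst2 (ff \<kappa>0 \<kappa>1 (u + v - 2 * k)) (Zb ^ s) (Z ^ s)))))
       \<and>
       V (scal (1/2) (Z ^ a * Zb ^ b - Z ^ b * Zb ^ a)) =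
         scal (fact a * fact b)
           (\<Sum>k\<le>v.
              scal (lam1 \<kappa>0 \<kappa>1 (u + v - 2 * k)
                    * cf (f1 \<kappa>0 \<kappa>1 (u + v - 2 * k)) (int u - int k) (int v - int k)
                    / (fact (k * s + r)
                       * pochhammer (of_nat s * \<kappa>0 + of_nat s * \<kappa>1 + 1) (b + (u - k) * s)))
                ((Z * Zb) ^ (k * s + r)
                  * subst2 (f1 \<kappa>0 \<kappa>1 (u + v - 2 * k)) (Z ^ s) (Zb ^ s))))
     \<and>
     V (scal (1/2) (Z ^ a * Zb ^ b + Z ^ b * Zb ^ a)) =
       scal (fact a * fact b)
         (\<Sum>k\<le>v.
            scal (lam0 \<kappa>0 \<kappa>1 (u + v - 2 * k)
                  * cf (f0 \<kappa>0 \<kappa>1 (u + v - 2 * k)) (int u - int k) (int v - int k)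
                  / (fact (k * s + r)
                     * pochhammer (of_nat s * \<kappa>0 + of_nat s * \<kappa>1 + 1) (b + (u - k) * s)))
              ((Z * Zb) ^ (k * s + r)
                * subst2 (f0 \<kappa>0 \<kappa>1 (u + v - 2 * k)) (Z ^ s) (Zb ^ s)))"
proof -
  interpret intertwiner s \<kappa>0 \<kappa>1 V
    using assms(1-5) by unfold_locales
  have vu: "v \<le> u"
    using assms(1,6,8,9) by simp
  let ?f = "fact a * fact b :: complex"
  have mono: "V (Z ^ a * Zb ^ b) = bconst ?f * wr r u v" "V (Z ^ b * Zb ^ a) = bconst ?f * wr r v u"
    unfolding assms(8,9) V_monomial[OF \<open>r < s\<close>] by (simp_all only: mult.commute[of "fact (v * s + r)"])
  have d: "fact (k * s + r) * pochhammer (of_nat s * \<kappa>0 + of_nat s * \<kappa>1 + 1) (b + (u - k) * s) = wr_denom r u v k" for k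
    unfolding wr_denom_def assms(9) ..
  have idx: "u + v - 2 * k = (u - k) + (v - k)" "int u - int k = int (u - k)" "int v - int k = int (v - k)"
    if "k \<le> v" for k
    using that vu by auto
  \<comment> \<open>The strict inequality gives \<open>u > v\<close>, so every index
    \<open>u + v - 2 k\<close> is positive; at index 0 the constants \<open>nu\<close> and
    \<open>lam1\<close> carry no meaning.\<close>
  have pos: "0 < u - k + (v - k)" if "k \<le> v" "b < a" for k
    using that assms(8,9) vu by (cases "u = k") auto
  have half: "V (scal (1/2) f) = bconst (1/2) * V f" for f
    by (simp only: scal_bconst V_bconst_mult)
  have pull: "bconst (1/2) * (bconst c * x) = bconst c * (bconst (1/2) * x)" for c x
    by (rule mult.left_commute)
  \<comment> \<open>A common template for the symmetric and the antisymmetric formula: the factor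
    1/2 is moved inwards to \<open>h\<close>, where \<open>half_h_add\<close> or
    \<open>half_h_diff\<close> absorbs it.\<close>
  have merge: "bconst (1/2) * (bconst (1 / d) * (x * g)) = bconst (c / d) * (x * y)"
    if "bconst (1/2) * g = bconst c * y" for c d x y g
  proof -
    have "bconst (1/2) * (bconst (1 / d) * (x * g)) = bconst (1 / d) * (x * (bconst (1/2) * g))"
      by (simp only: mult_ac)
    also have "\<dots> = bconst (c / d) * (x * y)"
      unfolding that unfolding divide_inverse bconst_mult by (simp only: mult_ac) simp
    finally show ?thesis .
  qed
  have 1: "V (Z ^ a * Zb ^ b) = scal ?f (\<Sum>k\<le>v. scal (inverse (nu \<kappa>0 \<kappa>1 (u + v - 2 * k)) / wr_denom r u v k)
      ((Z * Zb) ^ (k * s + r) *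
        (scal (cf (ff \<kappa>0 \<kappa>1 (u + v - 2 * k - 1)) (int u - int k - 1) (int v - int k))
           (subst2 (ff \<kappa>0 \<kappa>1 (u + v - 2 * k)) (Z ^ s) (Zb ^ s))
         + scal (cf (ff \<kappa>0 \<kappa>1 (u + v - 2 * k - 1)) (int v - int k - 1) (int u - int k))
           (subst2 (ff \<kappa>0 \<kappa>1 (u + v - 2 * k)) (Zb ^ s) (Z ^ s)))))" if "b < a"
    unfolding mono wr_eq[OF vu] scal_bconst
  proof (intro arg_cong[where f = "(*) (bconst ?f)"] sum.cong refl)
    fix k assume "k \<in> {..v}"
    then have k: "k \<le> v" by simp
    have "bconst (1 / d) * (x * (bconst c * y)) = bconst (c / d) * (x * y)" for c d x y
      unfolding divide_inverse bconst_mult by (simp only: mult_ac) simp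
    then show "bconst (1 / wr_denom r u v k) * ((Z * Zb) ^ (k * s + r) * h (u - k) (v - k))
      = bconst (inverse (nu \<kappa>0 \<kappa>1 (u + v - 2 * k)) / wr_denom r u v k) * ((Z * Zb) ^ (k * s + r) *
        (bconst (cf (ff \<kappa>0 \<kappa>1 (u + v - 2 * k - 1)) (int u - int k - 1) (int v - int k))
           * subst2 (ff \<kappa>0 \<kappa>1 (u + v - 2 * k)) (Z ^ s) (Zb ^ s)
         + bconst (cf (ff \<kappa>0 \<kappa>1 (u + v - 2 * k - 1)) (int v - int k - 1) (int u - int k))
           * subst2 (ff \<kappa>0 \<kappa>1 (u + v - 2 * k)) (Zb ^ s) (Z ^ s)))"
      unfolding idx[OF k] h_eq_ff[OF pos[OF k that]] F_def G_def by blast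
  qed
  have 2: "V (scal (1/2) (Z ^ a * Zb ^ b - Z ^ b * Zb ^ a)) = scal ?f (\<Sum>k\<le>v.
      scal (lam1 \<kappa>0 \<kappa>1 (u + v - 2 * k) * cf (f1 \<kappa>0 \<kappa>1 (u + v - 2 * k)) (int u - int k) (int v - int k) / wr_denom r u v k)
        ((Z * Zb) ^ (k * s + r) * subst2 (f1 \<kappa>0 \<kappa>1 (u + v - 2 * k)) (Z ^ s) (Zb ^ s)))" if "b < a"
    unfolding half V_diff mono right_diff_distrib[symmetric] pull wr_eq[OF vu] sum_subtractf[symmetric]
    unfolding scal_bconst sum_distrib_left[of "bconst (1/2)"]
  proof (intro arg_cong[where f = "(*) (bconst ?f)"] sum.cong refl)
    fix k assume "k \<in> {..v}"
    then have k: "k \<le> v" by simp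
    show "bconst (1/2) * (bconst (1 / wr_denom r u v k) * ((Z * Zb) ^ (k * s + r) * (h (u - k) (v - k) - h (v - k) (u - k))))
      = bconst (lam1 \<kappa>0 \<kappa>1 (u + v - 2 * k) * cf (f1 \<kappa>0 \<kappa>1 (u + v - 2 * k)) (int u - int k) (int v - int k) / wr_denom r u v k)
        * ((Z * Zb) ^ (k * s + r) * subst2 (f1 \<kappa>0 \<kappa>1 (u + v - 2 * k)) (Z ^ s) (Zb ^ s))"
      unfolding idx[OF k] by (rule merge[OF half_h_diff[OF pos[OF k that]]])
  qed
  have 3: "V (scal (1/2) (Z ^ a * Zb ^ b + Z ^ b * Zb ^ a)) = scal ?f (\<Sum>k\<le>v.
      scal (lam0 \<kappa>0 \<kappa>1 (u + v - 2 * k) * cf (f0 \<kappa>0 \<kappa>1 (u + v - 2 * k)) (int u - int k) (int v - int k) / wr_denom r u v k)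
        ((Z * Zb) ^ (k * s + r) * subst2 (f0 \<kappa>0 \<kappa>1 (u + v - 2 * k)) (Z ^ s) (Zb ^ s)))"
    unfolding half V_add mono distrib_left[symmetric] pull wr_eq[OF vu] sum.distrib[symmetric]
    unfolding scal_bconst sum_distrib_left[of "bconst (1/2)"]
  proof (intro arg_cong[where f = "(*) (bconst ?f)"] sum.cong refl)
    fix k assume "k \<in> {..v}"
    then have k: "k \<le> v" by simp
    show "bconst (1/2) * (bconst (1 / wr_denom r u v k) * ((Z * Zb) ^ (k * s + r) * (h (u - k) (v - k) + h (v - k) (u - k))))
      = bconst (lam0 \<kappa>0 \<kappa>1 (u + v - 2 * k) * cf (f0 \<kappa>0 \<kappa>1 (u + v - 2 * k)) (int u - int k) (int v - int k) / wr_denom r u v k)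
        * ((Z * Zb) ^ (k * s + r) * subst2 (f0 \<kappa>0 \<kappa>1 (u + v - 2 * k)) (Z ^ s) (Zb ^ s))"
      unfolding idx[OF k] by (rule merge[OF half_h_add])
  qed
  show ?thesis
    unfolding d using 1 2 3 by blast
qed

end
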